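(* Fix $L>0$ and let $\mathcal{F}_L=\{g\in C^1(\mathbb{R}^d):\kappa_g(r)\ge-r^{-1}f_L(r)\ \forall r>0\}$. Then for all $0\le t\le T<+\infty$: if $g\in\mathcal{F}_L$ then $U^{T,g}_t\in\mathcal{F}_L$.
   Context: For a differentiable $U:\mathbb{R}^d\to\mathbb{R}$ and $r>0$, $\kappa_U(r)=\inf\{|x-y|^{-2}\langle\nabla U(x)-\nabla U(y),x-y\rangle:|x-y|=r\}$. For $L>0$, $f_L(r)=2L^{1/2}\tanh(rL^{1/2}/2)$, $r\ge0$. For a function $g$ and $0\le t<T$, $U^{T,g}_t(x)=-\log\Big((2\pi(T-t))^{-d/2}\int\exp\big(-\tfrac{|y-x|^2}{2(T-t)}-g(y)\big)\mathrm{d}y\Big)$, and $U^{T,g}_T=g$; this is the solution of the HJB equation $\partial_t\varphi_t+\frac12\Delta\varphi_t-\frac12|\nabla\varphi_t|^2=0$, $\varphi_T=g$. *)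

theory Defs
  imports "HOL-Analysis.Analysis"
begin

definition grad :: "('a::euclidean_space \<Rightarrow> real) \<Rightarrow> 'a \<Rightarrow> 'a" where
  "grad U x = (THE v. (U has_derivative (\<lambda>h. v \<bullet> h)) (at x))"

definition C1 :: "('a::euclidean_space \<Rightarrow> real) \<Rightarrow> bool" where
  "C1 U \<longleftrightarrow> (\<exists>G. (\<forall>x. (U has_derivative (\<lambda>h. G x \<bullet> h)) (at x)) \<and> continuous_on UNIV G)"

text \<open>kappa_U(r), an infimum taken in the extended reals (it may be -infinity).\<close>
definition kappa :: "('a::euclidean_space \<Rightarrow> real) \<Rightarrow> real \<Rightarrow> ereal" where
  "kappa U r = (INF p \<in> {(x, y). norm (x - y) = r}.
      ereal (((grad U (fst p) - grad U (snd p)) \<bullet> (fst p - snd p)) / (norm (fst p - snd p))\<^sup>2))"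

definition fL :: "real \<Rightarrow> real \<Rightarrow> real" where
  "fL L r = 2 * sqrt L * tanh (r * sqrt L / 2)"

definition FL :: "real \<Rightarrow> ('a::euclidean_space \<Rightarrow> real) set" where
  "FL L = {g. C1 g \<and> (\<forall>r>0. kappa g r \<ge> ereal (- fL L r / r))}"

definition UTg :: "real \<Rightarrow> ('a::euclidean_space \<Rightarrow> real) \<Rightarrow> real \<Rightarrow> 'a \<Rightarrow> real" where
  "UTg T g t x = (if t = T then g x else
     - ln ((2 * pi * (T - t)) powr (- real DIM('a) / 2) *
        (\<integral>y. exp (- (norm (y - x))\<^sup>2 / (2 * (T - t)) - g y) \<partial>lborel)))"

end

theory Submission
  imports Defs "HOL-Probability.Probability"
begin

text \<open>
  Write \<open>p(\<tau>,x)\<close> for the gradient of the solution at time \<open>T - \<tau>\<close>. It is the mean of \<open>\<nabla>g\<close> under the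
  Gibbs measure with density proportional to \<open>exp(-|y - x|\<^sup>2/2\<tau> - g(y))\<close>, whose derivatives in \<open>x\<close>
  and \<open>\<tau>\<close> are covariances, and it solves the viscous Burgers equation \<open>p\<^sub>\<tau> = \<Delta>p/2 - Dp[p]\<close>. With
  \<open>r = |x - y|\<close> and \<open>e = (x - y)/r\<close>, the excess \<open>W = \<langle>p(x) - p(y), e\<rangle> + f(r)\<close> obeys a differential
  inequality \<open>W\<^sub>\<tau> \<ge> A W + f'(r) W\<close>, where \<open>A\<close> is the generator of two copies of the diffusion with
  drift \<open>-p\<close> coupled by reflection: its second order part only uses the directions \<open>(e,-e)\<close> and
  \<open>(b,b)\<close> with \<open>b \<bottom> e\<close>, along which \<open>e\<close> is constant, and \<open>2f'' + ff' \<le> 0\<close> absorbs the remaining terms.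
  A maximum principle for \<open>W + \<epsilon> exp(c\<tau>)(1 + |x|\<^sup>2 + |y|\<^sup>2)\<close> then propagates \<open>W \<ge> 0\<close> from \<open>\<tau> = 0\<close>.

  The maximum principle needs growth and Lipschitz bounds on \<open>p\<close> that are uniform as \<open>\<tau> \<rightarrow> 0\<close>.
  They hold if \<open>\<nabla>g\<close> is Lipschitz, since the Gibbs measure concentrates at \<open>x\<close>. A general \<open>g\<close> is
  approximated by its Moreau envelopes, which have Lipschitz gradients and satisfy the bound for
  the profile \<open>r \<mapsto> f(r/(1 - \<lambda>\<Lambda>))\<close>, \<open>\<Lambda> = sup f'\<close>; such a rescaling preserves \<open>2f'' + ff' \<le> 0\<close>
  because \<open>f\<close> is concave.
\<close>


section \<open>Derivatives and minima\<close>

lemma has_vector_derivative_along_line: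
  assumes "(F has_derivative F') (at (x + s *\<^sub>R a))"
  shows "((\<lambda>s. F (x + s *\<^sub>R a)) has_vector_derivative F' a) (at s)"
proof -
  have "((\<lambda>s. F (x + s *\<^sub>R a)) has_derivative (\<lambda>k. F' (k *\<^sub>R a))) (at s)"
    by (rule has_derivative_compose[of "\<lambda>s. x + s *\<^sub>R a"])
       (use assms in \<open>auto intro!: derivative_eq_intros\<close>)
  moreover have "linear F'" using assms by (rule has_derivative_linear)
  ultimately show ?thesis by (simp add: has_vector_derivative_def linear_cmul)
qed

lemma has_derivative_divideR:
  fixes N :: "'p::real_normed_vector \<Rightarrow> 'b::real_normed_vector" and D :: "'p \<Rightarrow> real"
  assumes "(N has_derivative N') (at x)" "(D has_derivative D') (at x)" "D x \<noteq> 0"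
  shows "((\<lambda>x. N x /\<^sub>R D x) has_derivative (\<lambda>h. (N' h - D' h *\<^sub>R (N x /\<^sub>R D x)) /\<^sub>R D x)) (at x)"
  using has_derivative_scaleR[OF Deriv.has_derivative_inverse[OF assms(3,2)] assms(1)]
  by (rule has_derivative_eq_rhs) (simp add: fun_eq_iff algebra_simps)

lemma has_derivative_sgn:
  fixes x :: "'a::real_inner"
  assumes "x \<noteq> 0"
  shows "(sgn has_derivative (\<lambda>h. (h - (h \<bullet> sgn x) *\<^sub>R sgn x) /\<^sub>R norm x)) (at x)"
  using has_derivative_divideR[OF has_derivative_ident has_derivative_norm[OF assms]] assms
  by (simp add: sgn_div_norm[abs_def])

lemma gderivI_quadratic_remainder:
  fixes F :: "'a::real_inner \<Rightarrow> real"
  assumes "\<And>y. \<bar>F y - F x - v \<bullet> (y - x)\<bar> \<le> C * (norm (y - x))\<^sup>2"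
  shows "GDERIV F x :> v"
proof -
  have "((\<lambda>y. norm (F y - F x - (y - x) \<bullet> v) / norm (y - x)) \<longlongrightarrow> 0) (at x)"
  proof (rule Lim_null_comparison)
    show "\<forall>\<^sub>F y in at x. norm (norm (F y - F x - (y - x) \<bullet> v) / norm (y - x)) \<le> C * norm (y - x)"
      unfolding eventually_at_filter using assms
      by (auto intro!: always_eventually
        simp: divide_le_eq power2_eq_square mult.assoc inner_commute)
    have "((\<lambda>y. C * norm (y - x)) \<longlongrightarrow> C * norm (x - x)) (at x)" by (intro tendsto_intros)
    then show "((\<lambda>y. C * norm (y - x)) \<longlongrightarrow> 0) (at x)" by simp
  qed
  then show ?thesis unfolding gderiv_def has_derivative_iff_norm
    by (simp add: bounded_linear_inner_left)
qed

lemma gderiv_continuous: "(\<And>x. GDERIV F x :> G x) \<Longrightarrow> continuous_on S F"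
  unfolding gderiv_def by (intro continuous_at_imp_continuous_on ballI has_derivative_continuous)

lemma gderiv_minimum_eq_zero:
  assumes "GDERIV F x :> v" "\<And>y. F x \<le> F y"
  shows "v = 0"
proof -
  have "(\<lambda>h. h \<bullet> v) = (\<lambda>h. 0)"
    using assms by (intro has_derivative_local_min[where f = F and x = x]) (auto simp: gderiv_def)
  then have "v \<bullet> v = 0" by metis
  then show ?thesis by simp
qed

lemma second_derivative_nonneg_at_local_min:
  fixes \<psi> \<psi>' :: "real \<Rightarrow> real"
  assumes "0 < d" and deriv: "\<And>s. \<bar>s\<bar> < d \<Longrightarrow> (\<psi> has_real_derivative \<psi>' s) (at s)"
    and deriv2: "(\<psi>' has_real_derivative c) (at 0)" and local_min: "\<And>s. \<bar>s\<bar> < d \<Longrightarrow> \<psi> 0 \<le> \<psi> s"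
  shows "0 \<le> c"
proof (rule ccontr)
  assume "\<not> 0 \<le> c"
  have critical: "\<psi>' 0 = 0"
    by (rule DERIV_local_min[OF deriv \<open>0 < d\<close>]) (use local_min \<open>0 < d\<close> in auto)
  obtain e where decreasing: "0 < e" "\<And>h. h > 0 \<Longrightarrow> h < e \<Longrightarrow> \<psi>' (0 + h) < \<psi>' 0"
    using DERIV_neg_dec_right[OF deriv2] \<open>\<not> 0 \<le> c\<close> by auto
  define h where "h = min d e / 2"
  have h_bounds: "0 < h" "h < d" "h < e" using \<open>0 < d\<close> decreasing(1) by (auto simp: h_def)
  obtain w where mean_value: "0 < w" "w < h" "\<psi> h - \<psi> 0 = (h - 0) * \<psi>' w"
    using MVT2[OF h_bounds(1), of \<psi> \<psi>'] deriv h_bounds by (metis abs_of_nonneg le_less_trans)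
  have "\<psi>' w < 0" using decreasing(2)[of w] mean_value h_bounds critical by auto
  then have "\<psi> h < \<psi> 0" using mean_value h_bounds mult_pos_neg[of h "\<psi>' w"] by simp
  then show False using local_min[of h] h_bounds by simp
qed

lemma continuous_attains_inf_coercive:
  fixes F :: "'a::heine_borel \<Rightarrow> real"
  assumes "continuous_on UNIV F" "0 \<le> R" and far: "\<And>z. R < dist a z \<Longrightarrow> F a \<le> F z"
  obtains q where "\<And>z. F q \<le> F z"
proof -
  obtain q where q_min: "q \<in> cball a R" "\<And>z. z \<in> cball a R \<Longrightarrow> F q \<le> F z"
    using continuous_attains_inf[OF compact_cball, of a R F] assms(1,2) continuous_on_subset
    by force
  have "F q \<le> F a" using q_min(2) assms(2) by simp
  then have "F q \<le> F z" for z
    using q_min(2)[of z] far[of z] by (cases "z \<in> cball a R") auto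
  then show ?thesis using that by blast
qed

section \<open>Orthonormal bases\<close>

definition orthonormal_basis :: "'a::euclidean_space set \<Rightarrow> bool" where
  "orthonormal_basis S \<longleftrightarrow> pairwise orthogonal S \<and> (\<forall>b\<in>S. norm b = 1) \<and> span S = UNIV"

lemma orthonormal_basis_Basis: "orthonormal_basis Basis"
  by (auto simp: orthonormal_basis_def pairwise_def orthogonal_def inner_Basis)

lemma orthonormal_basis_containing:
  fixes e :: "'a::euclidean_space"
  assumes "norm e = 1"
  obtains S where "orthonormal_basis S" "e \<in> S"
  using vector_in_orthonormal_basis[OF assms] unfolding orthonormal_basis_def by metis

lemma orthonormal_basis_finite_card:
  fixes S :: "'a::euclidean_space set"
  assumes "orthonormal_basis S"
  shows "finite S" and "card S = DIM('a)"
proof -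
  have "0 \<notin> S" using assms by (auto simp: orthonormal_basis_def)
  then have "independent S"
    using assms by (simp add: orthonormal_basis_def pairwise_orthogonal_independent)
  moreover have "span S = UNIV" using assms by (simp add: orthonormal_basis_def)
  ultimately show "finite S" "card S = DIM('a)"
    using finiteI_independent dim_eq_card[of S UNIV] by (auto simp: dim_UNIV)
qed

lemma sum_inner_scaleR_orthonormal_basis:
  assumes "orthonormal_basis S"
  shows "(\<Sum>b\<in>S. (z \<bullet> b) *\<^sub>R b) = z"
  using assms orthonormal_basis_finite_card(1)[OF assms]
  by (intro orthonormal_basis_expand) (auto simp: orthonormal_basis_def)

lemma sum_inner_square_orthonormal_basis:
  assumes "orthonormal_basis S"
  shows "(\<Sum>b\<in>S. (z \<bullet> b)\<^sup>2) = (norm z)\<^sup>2"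
proof -
  have "z \<bullet> z = z \<bullet> (\<Sum>b\<in>S. (z \<bullet> b) *\<^sub>R b)"
    by (simp only: sum_inner_scaleR_orthonormal_basis[OF assms])
  then show ?thesis by (simp add: inner_sum_right power2_norm_eq_inner) (simp add: power2_eq_square)
qed

section \<open>Differentiation under the integral sign\<close>

lemma integral_dominated_convergence_at:
  fixes Q :: "'p::metric_space \<Rightarrow> 'm \<Rightarrow> 'b::{banach, second_countable_topology}"
  assumes "0 < e" and meas: "\<And>x. x \<in> ball a e \<Longrightarrow> Q x \<in> borel_measurable M" "q \<in> borel_measurable M"
    and pointwise: "\<And>y. ((\<lambda>x. Q x y) \<longlongrightarrow> q y) (at a)"
    and bound: "\<And>x y. x \<in> ball a e \<Longrightarrow> norm (Q x y) \<le> B y" and "integrable M B"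
  shows "((\<lambda>x. \<integral>y. Q x y \<partial>M) \<longlongrightarrow> (\<integral>y. q y \<partial>M)) (at a)"
  unfolding tendsto_at_iff_sequentially
proof (intro allI impI)
  fix X :: "nat \<Rightarrow> 'p"
  assume X_limit: "\<forall>i. X i \<in> UNIV - {a}" "X \<longlonglongrightarrow> a"
  obtain N where N_ball: "\<And>n. n \<ge> N \<Longrightarrow> X n \<in> ball a e"
    using X_limit(2) \<open>0 < e\<close> unfolding lim_sequentially by (metis dist_commute mem_ball)
  have "(\<lambda>n. Q (X n) y) \<longlonglongrightarrow> q y" for y
    using pointwise[of y] X_limit unfolding tendsto_at_iff_sequentially comp_def by blast
  then have "(\<lambda>n. Q (X (n + N)) y) \<longlonglongrightarrow> q y" for y by (rule LIMSEQ_ignore_initial_segment)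
  then have "(\<lambda>n. \<integral>y. Q (X (n + N)) y \<partial>M) \<longlonglongrightarrow> (\<integral>y. q y \<partial>M)"
    using meas bound N_ball \<open>integrable M B\<close>
    by (intro integral_dominated_convergence[where w = B]) auto
  then show "((\<lambda>x. \<integral>y. Q x y \<partial>M) \<circ> X) \<longlonglongrightarrow> (\<integral>y. q y \<partial>M)"
    unfolding comp_def by (rule LIMSEQ_offset)
qed

lemma norm_integral_le_integral:
  fixes \<Phi> :: "'m \<Rightarrow> 'b::{banach, second_countable_topology}"
  assumes "integrable M \<Phi>" "integrable M B" "\<And>y. norm (\<Phi> y) \<le> B y"
  shows "norm (\<integral>y. \<Phi> y \<partial>M) \<le> (\<integral>y. B y \<partial>M)"
  by (rule order_trans[OF integral_norm_bound integral_mono]) (use assms in auto)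

lemma bounded_linear_integral_dominated:
  fixes F :: "'m \<Rightarrow> 'p::real_normed_vector \<Rightarrow> 'b::{banach, second_countable_topology}"
  assumes linear: "\<And>y. linear (F y)" and meas: "\<And>h. (\<lambda>y. F y h) \<in> borel_measurable M"
    and dominating: "integrable M B" "\<And>y. 0 \<le> B y" and bound: "\<And>y h. norm (F y h) \<le> B y * norm h"
  shows "integrable M (\<lambda>y. F y h)" and "bounded_linear (\<lambda>h. \<integral>y. F y h \<partial>M)"
proof -
  show integrable: "integrable M (\<lambda>y. F y h)" for h
  proof (rule Bochner_Integration.integrable_bound)
    show "integrable M (\<lambda>y. B y * norm h)" using dominating(1) by simp
    show "AE y in M. norm (F y h) \<le> norm (B y * norm h)" using bound dominating(2)
      by (auto simp: abs_mult)
  qed (rule meas)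
  show "bounded_linear (\<lambda>h. \<integral>y. F y h \<partial>M)"
  proof (rule bounded_linear_intro)
    show "(\<integral>y. F y (a + b) \<partial>M) = (\<integral>y. F y a \<partial>M) + (\<integral>y. F y b \<partial>M)" for a b
      by (simp add: linear_add[OF linear] integrable)
    show "(\<integral>y. F y (r *\<^sub>R a) \<partial>M) = r *\<^sub>R (\<integral>y. F y a \<partial>M)" for r a
      by (simp add: linear_cmul[OF linear])
    show "norm (\<integral>y. F y h \<partial>M) \<le> norm h * (\<integral>y. B y \<partial>M)" for h
      using norm_integral_le_integral[OF integrable _ bound, of h] dominating(1)
      by (simp add: mult.commute)
  qed
qed

lemma norm_difference_quotient_le:
  fixes F :: "'p::real_normed_vector \<Rightarrow> 'b::real_normed_vector"
  assumes "0 \<le> B" "x \<in> ball a e"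
    and deriv: "\<And>x. x \<in> ball a e \<Longrightarrow> (F has_derivative F' x) (at x)"
    and bound: "\<And>x h. x \<in> ball a e \<Longrightarrow> norm (F' x h) \<le> B * norm h"
  shows "norm ((F x - F a - F' a (x - a)) /\<^sub>R norm (x - a)) \<le> 2 * B"
proof (cases "x = a")
  case False
  have centre: "a \<in> ball a e" using le_less_trans[OF zero_le_dist[of a x]] assms(2) by simp
  have "norm (F x - F a) \<le> B * norm (x - a)"
  proof (rule differentiable_bound[where S = "ball a e" and f' = F'])
    show "onorm (F' z) \<le> B" if "z \<in> ball a e" for z
      by (rule onorm_bound) (use assms(1) bound[OF that] in auto)
  qed (use assms(2) centre deriv in \<open>auto intro: has_derivative_at_withinI\<close>)
  then have "norm (F x - F a - F' a (x - a)) \<le> 2 * B * norm (x - a)"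
    using bound[OF centre, of "x - a"] norm_triangle_ineq4[of "F x - F a" "F' a (x - a)"]
    by linarith
  then show ?thesis using False by (simp add: inverse_eq_divide pos_divide_le_eq)
qed (use assms(1) in simp)

lemma has_derivative_integral_dominated:
  fixes F :: "'p::real_normed_vector \<Rightarrow> 'm \<Rightarrow> 'b::{banach, second_countable_topology}"
  assumes "0 < e"
    and integrable: "\<And>x. x \<in> ball a e \<Longrightarrow> integrable M (F x)"
    and deriv: "\<And>x y. x \<in> ball a e \<Longrightarrow> ((\<lambda>x. F x y) has_derivative F' x y) (at x)"
    and bound: "\<And>x y h. x \<in> ball a e \<Longrightarrow> norm (F' x y h) \<le> B y * norm h"
    and dominating: "integrable M B" "\<And>y. 0 \<le> B y"
    and meas: "\<And>h. (\<lambda>y. F' a y h) \<in> borel_measurable M"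
  shows "((\<lambda>x. \<integral>y. F x y \<partial>M) has_derivative (\<lambda>h. \<integral>y. F' a y h \<partial>M)) (at a)"
proof -
  have centre: "a \<in> ball a e" using \<open>0 < e\<close> by simp
  have linear: "linear (F' a y)" for y using deriv[OF centre] has_derivative_linear by blast
  note F'_integral = bounded_linear_integral_dominated[OF linear meas dominating bound[OF centre]]
  define Q where "Q x y = (F x y - F a y - F' a y (x - a)) /\<^sub>R norm (x - a)" for x y
  have Q_integrable: "integrable M (Q x)" if "x \<in> ball a e" for x
    unfolding Q_def using integrable[OF that] integrable[OF centre] F'_integral(1) by auto
  have "((\<lambda>x. \<integral>y. Q x y \<partial>M) \<longlongrightarrow> (\<integral>y. 0 \<partial>M)) (at a)"
  proof (rule integral_dominated_convergence_at[OF \<open>0 < e\<close>, where B = "\<lambda>y. 2 * B y"])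
    show "((\<lambda>x. Q x y) \<longlongrightarrow> 0) (at a)" for y
      using deriv[OF centre, of y] unfolding has_derivative_iff_norm Q_def
      by (subst tendsto_norm_zero_iff[symmetric]) (simp add: divide_inverse mult.commute)
    show "norm (Q x y) \<le> 2 * B y" if "x \<in> ball a e" for x y
      unfolding Q_def by (rule norm_difference_quotient_le[OF dominating(2) that deriv bound])
  qed (use dominating Q_integrable in auto)
  moreover have "(\<integral>y. Q x y \<partial>M) =
      ((\<integral>y. F x y \<partial>M) - (\<integral>y. F a y \<partial>M) - (\<integral>y. F' a y (x - a) \<partial>M)) /\<^sub>R norm (x - a)"
    if "x \<in> ball a e" for x
    unfolding Q_def by (simp add: integrable[OF that] integrable[OF centre] F'_integral(1))
  then have "\<forall>\<^sub>F x in at a. (\<integral>y. Q x y \<partial>M) =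
      ((\<integral>y. F x y \<partial>M) - (\<integral>y. F a y \<partial>M) - (\<integral>y. F' a y (x - a) \<partial>M)) /\<^sub>R norm (x - a)"
    using eventually_at_ball[OF \<open>0 < e\<close>] by (rule eventually_mono[rotated]) auto
  ultimately have "((\<lambda>x. ((\<integral>y. F x y \<partial>M) - (\<integral>y. F a y \<partial>M) - (\<integral>y. F' a y (x - a) \<partial>M))
      /\<^sub>R norm (x - a)) \<longlongrightarrow> 0) (at a)"
    using tendsto_cong by force
  from tendsto_norm_zero[OF this] show ?thesis
    unfolding has_derivative_iff_norm using F'_integral(2)
    by (simp add: divide_inverse mult.commute)
qed

lemma
  fixes \<phi> :: "'a::euclidean_space \<Rightarrow> 'b::{banach, second_countable_topology}"
  assumes "\<phi> \<in> borel_measurable borel"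
  shows lborel_integral_translate: "(\<integral>y. \<phi> (a + y) \<partial>lborel) = (\<integral>y. \<phi> y \<partial>lborel)"
    and lborel_integrable_translate: "integrable lborel (\<lambda>y. \<phi> (a + y)) \<longleftrightarrow> integrable lborel \<phi>"
  using integral_distr[of "(+) a" lborel borel \<phi>] integrable_distr_eq[of "(+) a" lborel borel \<phi>]
    assms
  by (simp_all add: lborel_distr_plus)

text \<open>The integral of a translate does not depend on the translation.\<close>

lemma integral_directional_derivative_eq_zero:
  fixes w :: "'a::euclidean_space \<Rightarrow> 'b::{banach, second_countable_topology}"
  assumes w_integrable: "integrable lborel w" and deriv: "\<And>y. (w has_derivative w' y) (at y)"
    and meas: "(\<lambda>y. w' y a) \<in> borel_measurable borel"
    and dominating: "integrable lborel B" "\<And>y s. \<bar>s\<bar> < 1 \<Longrightarrow> norm (w' (y + s *\<^sub>R a) a) \<le> B y"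
  shows "(\<integral>y. w' y a \<partial>lborel) = 0"
proof -
  have "((\<lambda>s. \<integral>y. w (y + s *\<^sub>R a) \<partial>lborel) has_derivative
      (\<lambda>k. \<integral>y. k *\<^sub>R w' (y + 0 *\<^sub>R a) a \<partial>lborel)) (at 0)"
  proof (rule has_derivative_integral_dominated[where e = 1 and B = B
        and F' = "\<lambda>s y k. k *\<^sub>R w' (y + s *\<^sub>R a) a"])
    show "integrable lborel (\<lambda>y. w (y + s *\<^sub>R a))" for s
      using lborel_integrable_translate[of w "s *\<^sub>R a"] w_integrable by (simp add: add.commute)
    show "((\<lambda>s. w (y + s *\<^sub>R a)) has_derivative (\<lambda>k. k *\<^sub>R w' (y + s *\<^sub>R a) a)) (at s)" for s y
      using has_vector_derivative_along_line[of w "w' (y + s *\<^sub>R a)" y s a, OF deriv]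
      by (simp add: has_vector_derivative_def)
    show "norm (k *\<^sub>R w' (y + s *\<^sub>R a) a) \<le> B y * norm k" if "s \<in> ball 0 1" for s y k
      using mult_right_mono[OF dominating(2)[of s y], of "norm k"] that by (simp add: mult.commute)
    show "0 \<le> B y" for y by (rule order_trans[OF norm_ge_zero dominating(2)[of 0 y]]) simp
  qed (use dominating(1) meas in auto)
  moreover have "(\<integral>y. w (y + s *\<^sub>R a) \<partial>lborel) = (\<integral>y. w y \<partial>lborel)" for s
    using lborel_integral_translate[of w "s *\<^sub>R a"] w_integrable by (simp add: add.commute)
  ultimately have "((\<lambda>s. \<integral>y. w y \<partial>lborel) has_derivative (\<lambda>k. k *\<^sub>R (\<integral>y. w' y a \<partial>lborel)))
      (at (0::real))"
    by simp
  then have "(\<lambda>k. k *\<^sub>R (\<integral>y. w' y a \<partial>lborel)) = (\<lambda>k::real. 0)"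
    by (rule has_derivative_unique) (rule has_derivative_const)
  then show ?thesis by (metis scaleR_one)
qed

section \<open>Functions of exponential growth\<close>

lemma integrable_exp_neg_abs:
  assumes "0 < c"
  shows "integrable lborel (\<lambda>t::real. exp (- (c * \<bar>t\<bar>)))"
proof -
  have half: "set_integrable lebesgue {0..} (\<lambda>t. exp (- (c * t)))"
    using integrable_on_exp_minus_to_infinity[OF assms, of 0]
    by (intro nonnegative_absolutely_integrable_1) auto
  then have "set_integrable lborel {0..} (\<lambda>t. exp (- (c * t)))"
    unfolding set_integrable_def by (subst (asm) integrable_completion) auto
  then have right: "integrable lborel (\<lambda>t. indicator {0..} t * exp (- (c * t)))"
    by (simp add: set_integrable_def)
  then have left: "integrable lborel (\<lambda>t. indicator {..0} t * exp (c * t))"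
    using lborel_integrable_real_affine[OF right, of "-1" 0]
    by (simp add: indicator_def cong: if_cong)
  show ?thesis
    by (rule Bochner_Integration.integrable_bound[OF
      Bochner_Integration.integrable_add[OF right left]])
       (auto simp: indicator_def)
qed

lemma integrable_lborel_prod_Basis:
  fixes h :: "real \<Rightarrow> real"
  assumes "integrable lborel h" "\<And>t. 0 \<le> h t"
  shows "integrable lborel (\<lambda>y::'a::euclidean_space. \<Prod>b\<in>Basis. h (y \<bullet> b))"
proof (rule integrableI_bounded)
  have [measurable]: "h \<in> borel_measurable borel" using assms(1) by auto
  show "(\<lambda>y::'a. \<Prod>b\<in>Basis. h (y \<bullet> b)) \<in> borel_measurable lborel" by measurable
  have "(\<integral>\<^sup>+y. ennreal (norm (\<Prod>b\<in>(Basis::'a set). h (y \<bullet> b))) \<partial>lborel)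
      = (\<integral>\<^sup>+y. (\<Prod>b\<in>(Basis::'a set). ennreal (h (y \<bullet> b))) \<partial>lborel)"
    by (simp add: prod_ennreal assms(2) prod_nonneg)
  also have "\<dots> = (\<Prod>b\<in>(Basis::'a set). \<integral>\<^sup>+t. ennreal (h t) \<partial>lborel)"
    by (rule nn_integral_lborel_prod) auto
  also have "\<dots> < \<infinity>"
    using assms by (simp add: power_less_top_ennreal nn_integral_eq_integral)
  finally show "(\<integral>\<^sup>+y. ennreal (norm (\<Prod>b\<in>(Basis::'a set). h (y \<bullet> b))) \<partial>lborel) < \<infinity>" .
qed

lemma integrable_exp_neg_norm:
  "integrable lborel (\<lambda>y::'a::euclidean_space. exp (- norm y))"
proof (rule Bochner_Integration.integrable_bound)
  let ?c = "1 / real DIM('a)"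
  show "integrable lborel (\<lambda>y::'a. \<Prod>b\<in>Basis. exp (- (?c * \<bar>y \<bullet> b\<bar>)))"
    by (intro integrable_lborel_prod_Basis integrable_exp_neg_abs) auto
  have "exp (- norm y) \<le> (\<Prod>b\<in>Basis. exp (- (?c * \<bar>y \<bullet> b\<bar>)))" for y :: 'a
  proof -
    have "(\<Sum>b\<in>Basis. \<bar>y \<bullet> b\<bar>) \<le> (\<Sum>b\<in>(Basis::'a set). norm y)"
      by (intro sum_mono) (simp add: Basis_le_norm)
    then have "?c * (\<Sum>b\<in>Basis. \<bar>y \<bullet> b\<bar>) \<le> norm y"
      by (simp add: field_simps)
    then show ?thesis by (simp add: sum_negf sum_distrib_left flip: exp_sum)
  qed
  then show "AE y::'a in lborel. norm (exp (- norm y)) \<le> norm (\<Prod>b\<in>Basis. exp (- (?c * \<bar>y \<bullet> b\<bar>)))"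
    by (intro AE_I2) (simp add: abs_prod)
qed simp

definition exp_growth :: "('a::euclidean_space \<Rightarrow> 'b::euclidean_space) \<Rightarrow> bool" where
  "exp_growth \<Phi> \<longleftrightarrow> \<Phi> \<in> borel_measurable borel \<and> (\<exists>A B. \<forall>y. norm (\<Phi> y) \<le> A * exp (B * norm y))"

lemma exp_growth_measurable [measurable_dest]: "exp_growth \<Phi> \<Longrightarrow> \<Phi> \<in> borel_measurable borel"
  by (simp add: exp_growth_def)

lemma exp_growthI:
  assumes "\<Phi> \<in> borel_measurable borel" "\<And>y. norm (\<Phi> y) \<le> A * exp (B * norm y)"
  shows "exp_growth \<Phi>"
  using assms unfolding exp_growth_def by blast

lemma exp_growthE:
  assumes "exp_growth \<Phi>"
  obtains A B where "0 \<le> A" "0 \<le> B" "\<And>y. norm (\<Phi> y) \<le> A * exp (B * norm y)"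
proof -
  obtain A B where \<Phi>_le: "\<And>y. norm (\<Phi> y) \<le> A * exp (B * norm y)"
    using assms unfolding exp_growth_def by blast
  have "A * exp (B * norm y) \<le> \<bar>A\<bar> * exp (\<bar>B\<bar> * norm y)" for y :: 'a
    by (intro mult_mono) (auto intro: mult_right_mono)
  then show ?thesis using that[of "\<bar>A\<bar>" "\<bar>B\<bar>"] \<Phi>_le order_trans by fastforce
qed

lemma exp_growth_linear:
  assumes "\<Phi> \<in> borel_measurable borel" "0 \<le> b" "\<And>y. norm (\<Phi> y) \<le> a + b * norm y"
  shows "exp_growth \<Phi>"
proof (rule exp_growthI[where A = "\<bar>a\<bar> + b" and B = 1])
  fix y :: 'a
  have "norm y \<le> exp (norm y)" using exp_ge_add_one_self[of "norm y"] by linarith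
  then have "\<bar>a\<bar> * 1 + b * norm y \<le> \<bar>a\<bar> * exp (norm y) + b * exp (norm y)"
    using assms(2) by (intro add_mono mult_left_mono) auto
  then show "norm (\<Phi> y) \<le> (\<bar>a\<bar> + b) * exp (1 * norm y)"
    using assms(3)[of y] by (simp add: algebra_simps)
qed fact

lemma exp_growth_const: "exp_growth (\<lambda>_. c)"
  by (rule exp_growth_linear[where a = "norm c" and b = 0]) auto

lemma exp_growth_ident: "exp_growth (\<lambda>y. y)"
  by (rule exp_growth_linear[where a = 0 and b = 1]) auto

lemma exp_growth_norm: "exp_growth \<Phi> \<Longrightarrow> exp_growth (\<lambda>y. norm (\<Phi> y))"
  unfolding exp_growth_def by auto

lemma exp_growth_add:
  assumes \<Phi>_growth: "exp_growth \<Phi>" and \<Psi>_growth: "exp_growth \<Psi>"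
  shows "exp_growth (\<lambda>y. \<Phi> y + \<Psi> y)"
proof -
  obtain A B where \<Phi>_le: "0 \<le> A" "0 \<le> B" "\<And>y. norm (\<Phi> y) \<le> A * exp (B * norm y)"
    using exp_growthE[OF \<Phi>_growth] by metis
  obtain A' B' where \<Psi>_le: "0 \<le> A'" "0 \<le> B'" "\<And>y. norm (\<Psi> y) \<le> A' * exp (B' * norm y)"
    using exp_growthE[OF \<Psi>_growth] by metis
  show ?thesis
  proof (rule exp_growthI[where A = "A + A'" and B = "B + B'"])
    show "(\<lambda>y. \<Phi> y + \<Psi> y) \<in> borel_measurable borel" using assms by measurable
    fix y :: 'a
    have "A * exp (B * norm y) + A' * exp (B' * norm y)
        \<le> A * exp ((B + B') * norm y) + A' * exp ((B + B') * norm y)"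
      using \<Phi>_le \<Psi>_le by (intro add_mono mult_left_mono) (auto intro: mult_right_mono)
    then show "norm (\<Phi> y + \<Psi> y) \<le> (A + A') * exp ((B + B') * norm y)"
      using norm_triangle_ineq[of "\<Phi> y" "\<Psi> y"] \<Phi>_le(3)[of y] \<Psi>_le(3)[of y]
      by (simp add: distrib_right)
  qed
qed

lemma exp_growth_product:
  assumes \<Phi>_growth: "exp_growth \<Phi>" and \<Psi>_growth: "exp_growth \<Psi>"
    and product: "\<And>a b. norm (m a b) \<le> norm a * norm b"
    and meas: "(\<lambda>y. m (\<Phi> y) (\<Psi> y)) \<in> borel_measurable borel"
  shows "exp_growth (\<lambda>y. m (\<Phi> y) (\<Psi> y))"
proof -
  obtain A B where \<Phi>_le: "0 \<le> A" "0 \<le> B" "\<And>y. norm (\<Phi> y) \<le> A * exp (B * norm y)"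
    using exp_growthE[OF \<Phi>_growth] by metis
  obtain A' B' where \<Psi>_le: "0 \<le> A'" "0 \<le> B'" "\<And>y. norm (\<Psi> y) \<le> A' * exp (B' * norm y)"
    using exp_growthE[OF \<Psi>_growth] by metis
  show ?thesis
  proof (rule exp_growthI[where A = "A * A'" and B = "B + B'"])
    fix y :: 'a
    have "norm (\<Phi> y) * norm (\<Psi> y) \<le> (A * exp (B * norm y)) * (A' * exp (B' * norm y))"
      using \<Phi>_le \<Psi>_le by (intro mult_mono) auto
    then show "norm (m (\<Phi> y) (\<Psi> y)) \<le> A * A' * exp ((B + B') * norm y)"
      using product[of "\<Phi> y" "\<Psi> y"] by (simp add: algebra_simps exp_add)
  qed fact
qed

lemma exp_growth_scaleR:
  "exp_growth q \<Longrightarrow> exp_growth \<Phi> \<Longrightarrow> exp_growth (\<lambda>y. q y *\<^sub>R \<Phi> y)"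
  by (rule exp_growth_product) auto

lemma exp_growth_mult:
  fixes q :: "'a::euclidean_space \<Rightarrow> real"
  shows "exp_growth q \<Longrightarrow> exp_growth r \<Longrightarrow> exp_growth (\<lambda>y. q y * r y)"
  using exp_growth_scaleR[of q r] by simp

lemma exp_growth_inner:
  "exp_growth \<Phi> \<Longrightarrow> exp_growth \<Psi> \<Longrightarrow> exp_growth (\<lambda>y. \<Phi> y \<bullet> \<Psi> y)"
  by (rule exp_growth_product) (auto intro: Cauchy_Schwarz_ineq2)

lemma exp_growth_uminus: "exp_growth \<Phi> \<Longrightarrow> exp_growth (\<lambda>y. - \<Phi> y)"
  unfolding exp_growth_def by auto

lemma exp_growth_diff: "exp_growth \<Phi> \<Longrightarrow> exp_growth \<Psi> \<Longrightarrow> exp_growth (\<lambda>y. \<Phi> y - \<Psi> y)"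
  using exp_growth_add[of \<Phi> "\<lambda>y. - \<Psi> y"] exp_growth_uminus[of \<Psi>] by simp

lemma exp_growth_divide:
  fixes q :: "'a::euclidean_space \<Rightarrow> real"
  shows "exp_growth q \<Longrightarrow> exp_growth (\<lambda>y. q y / c)"
  using exp_growth_mult[of q "\<lambda>_. inverse c"] by (simp add: divide_inverse exp_growth_const)

lemma exp_growth_power:
  fixes q :: "'a::euclidean_space \<Rightarrow> real"
  shows "exp_growth q \<Longrightarrow> exp_growth (\<lambda>y. (q y)^n)"
  by (induction n) (auto intro: exp_growth_const exp_growth_mult)

lemmas exp_growth_intros = exp_growth_const exp_growth_ident exp_growth_norm exp_growth_add
  exp_growth_scaleR exp_growth_mult exp_growth_inner exp_growth_uminus
  exp_growth_diff exp_growth_divide exp_growth_power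

section \<open>Gaussian integrals\<close>

text \<open>Without the factor \<open>(2\<pi>\<tau>)\<close> to the power \<open>-d/2\<close>, which cancels in Gibbs means.\<close>

definition gauss_kernel :: "real \<Rightarrow> 'a::euclidean_space \<Rightarrow> 'a \<Rightarrow> real" where
  "gauss_kernel \<tau> x y = exp (- (norm (y - x))\<^sup>2 / (2 * \<tau>))"

definition gauss_integral :: "real \<Rightarrow> ('a::euclidean_space \<Rightarrow> 'b::euclidean_space) \<Rightarrow> 'a \<Rightarrow> 'b" where
  "gauss_integral \<tau> \<Phi> x = (\<integral>y. gauss_kernel \<tau> x y *\<^sub>R \<Phi> y \<partial>lborel)"

lemma gauss_kernel_pos: "0 < gauss_kernel \<tau> x y"
  by (simp add: gauss_kernel_def)

lemma gauss_kernel_measurable [measurable]: "gauss_kernel \<tau> x \<in> borel_measurable borel"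
  unfolding gauss_kernel_def by measurable

lemma gauss_kernel_has_derivative:
  assumes "0 < \<tau>"
  shows "((\<lambda>x. gauss_kernel \<tau> x y) has_derivative
    (\<lambda>h. gauss_kernel \<tau> x y * (((y - x) \<bullet> h) / \<tau>))) (at x)"
proof -
  have "((\<lambda>x. - ((y - x) \<bullet> (y - x)) / (2 * \<tau>)) has_derivative (\<lambda>h. ((y - x) \<bullet> h) / \<tau>)) (at x)"
    using assms
    by (auto intro!: derivative_eq_intros simp: inner_commute field_simps fun_eq_iff inner_simps)
  from has_derivative_exp[OF this] show ?thesis
    unfolding gauss_kernel_def power2_norm_eq_inner by (simp add: mult.commute)
qed

lemma gauss_kernel_has_derivative_right:
  assumes "0 < \<tau>"
  shows "(gauss_kernel \<tau> x has_derivative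
    (\<lambda>h. gauss_kernel \<tau> x y * (((x - y) \<bullet> h) / \<tau>))) (at y)"
proof -
  have kernel_commute: "gauss_kernel \<tau> x = (\<lambda>z. gauss_kernel \<tau> z x)"
    by (simp add: gauss_kernel_def fun_eq_iff norm_minus_commute)
  show ?thesis unfolding kernel_commute by (rule gauss_kernel_has_derivative[OF assms])
qed

lemma gauss_kernel_has_time_derivative:
  assumes "0 < \<tau>"
  shows "((\<lambda>\<tau>. gauss_kernel \<tau> x y) has_derivative
    (\<lambda>h. gauss_kernel \<tau> x y * (h / (2 * \<tau>\<^sup>2) * (norm (y - x))\<^sup>2))) (at \<tau>)"
  unfolding gauss_kernel_def using assms
  by (auto intro!: derivative_eq_intros simp: fun_eq_iff field_simps power2_eq_square)

lemma gauss_kernel_exp_le: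
  assumes "0 < \<tau>" "\<tau> \<le> T" "norm x \<le> R" "0 \<le> B"
  shows "gauss_kernel \<tau> x y * exp (B * norm y)
    \<le> exp ((B + 1) * R + (B + 1)\<^sup>2 * T / 2) * exp (- norm y)"
proof -
  define \<rho> where "\<rho> = norm (y - x)"
  have "norm y \<le> R + \<rho>" unfolding \<rho>_def using norm_triangle_sub[of y x] assms by linarith
  then have "(B + 1) * norm y \<le> (B + 1) * (R + \<rho>)" using assms by (intro mult_left_mono) auto
  moreover have "(B + 1) * \<rho> - \<rho>\<^sup>2 / (2 * \<tau>) \<le> (B + 1)\<^sup>2 * \<tau> / 2"
  proof -
    have "0 \<le> (\<rho> - (B + 1) * \<tau>)\<^sup>2 / (2 * \<tau>)" using assms by simp
    also have "\<dots> = \<rho>\<^sup>2 / (2 * \<tau>) - (B + 1) * \<rho> + (B + 1)\<^sup>2 * \<tau> / 2"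
      using assms by (simp add: power2_eq_square field_simps)
    finally show ?thesis by simp
  qed
  moreover have "(B + 1)\<^sup>2 * \<tau> / 2 \<le> (B + 1)\<^sup>2 * T / 2"
    using assms by (intro divide_right_mono mult_left_mono) auto
  ultimately have "- \<rho>\<^sup>2 / (2 * \<tau>) + B * norm y \<le> (B + 1) * R + (B + 1)\<^sup>2 * T / 2 + - norm y"
    by (simp add: algebra_simps)
  then show ?thesis unfolding gauss_kernel_def \<rho>_def by (simp flip: exp_add)
qed

lemma exp_growth_gauss_kernel_bound:
  assumes "exp_growth \<Phi>"
  obtains C where "0 \<le> C" and "\<And>\<tau> x y. 0 < \<tau> \<Longrightarrow> \<tau> \<le> T \<Longrightarrow> norm x \<le> R
    \<Longrightarrow> gauss_kernel \<tau> x y * norm (\<Phi> y) \<le> C * exp (- norm y)"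
proof -
  obtain A B where \<Phi>_le: "0 \<le> A" "0 \<le> B" "\<And>y. norm (\<Phi> y) \<le> A * exp (B * norm y)"
    using exp_growthE[OF assms(1)] by metis
  define E where "E = exp ((B + 1) * R + (B + 1)\<^sup>2 * T / 2)"
  have "gauss_kernel \<tau> x y * norm (\<Phi> y) \<le> (A * E) * exp (- norm y)"
    if "0 < \<tau>" "\<tau> \<le> T" "norm x \<le> R" for \<tau> x y
  proof -
    have "gauss_kernel \<tau> x y * norm (\<Phi> y) \<le> gauss_kernel \<tau> x y * (A * exp (B * norm y))"
      using \<Phi>_le(3) by (intro mult_left_mono less_imp_le[OF gauss_kernel_pos])
    also have "\<dots> = A * (gauss_kernel \<tau> x y * exp (B * norm y))" by simp
    also have "\<dots> \<le> A * (E * exp (- norm y))"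
      unfolding E_def using that \<Phi>_le by (intro mult_left_mono gauss_kernel_exp_le) auto
    finally show ?thesis by simp
  qed
  moreover have "0 \<le> A * E" using \<Phi>_le by (simp add: E_def)
  ultimately show ?thesis using that by blast
qed

lemma integrable_gauss_kernel:
  assumes "0 < \<tau>" "exp_growth \<Phi>"
  shows "integrable lborel (\<lambda>y. gauss_kernel \<tau> x y *\<^sub>R \<Phi> y)"
proof -
  obtain C where C_dominates: "0 \<le> C" "\<And>y. gauss_kernel \<tau> x y * norm (\<Phi> y) \<le> C * exp (- norm y)"
    using exp_growth_gauss_kernel_bound[OF assms(2), of \<tau> "norm x"] assms(1) by (metis order_refl)
  show ?thesis
  proof (rule Bochner_Integration.integrable_bound)
    show "integrable lborel (\<lambda>y::'a. C * exp (- norm y))"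
      by (intro integrable_mult_right integrable_exp_neg_norm)
    show "(\<lambda>y. gauss_kernel \<tau> x y *\<^sub>R \<Phi> y) \<in> borel_measurable lborel"
      using exp_growth_measurable[OF assms(2)] by simp
    show "AE y in lborel. norm (gauss_kernel \<tau> x y *\<^sub>R \<Phi> y) \<le> norm (C * exp (- norm y))"
      using C_dominates by (simp add: abs_mult less_imp_le[OF gauss_kernel_pos])
  qed
qed

lemma gauss_integral_has_derivative_dominated:
  fixes \<sigma> :: "'p::real_normed_vector \<Rightarrow> real" and \<xi> :: "'p \<Rightarrow> 'a::euclidean_space"
  assumes "0 < e" and range: "\<And>z. z \<in> ball a e \<Longrightarrow> 0 < \<sigma> z \<and> \<sigma> z \<le> T \<and> norm (\<xi> z) \<le> R"
    and deriv: "\<And>z y. z \<in> ball a e \<Longrightarrow> ((\<lambda>z. gauss_kernel (\<sigma> z) (\<xi> z) y) has_derivative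
      (\<lambda>h. gauss_kernel (\<sigma> z) (\<xi> z) y * q z y h)) (at z)"
    and bound: "\<And>z y h. z \<in> ball a e \<Longrightarrow> \<bar>q z y h\<bar> \<le> B y * norm h"
    and meas: "\<And>h. (\<lambda>y. q a y h) \<in> borel_measurable borel"
    and B_growth: "exp_growth B" and \<Phi>_growth: "exp_growth \<Phi>"
  shows "((\<lambda>z. gauss_integral (\<sigma> z) \<Phi> (\<xi> z)) has_derivative
    (\<lambda>h. gauss_integral (\<sigma> a) (\<lambda>y. q a y h *\<^sub>R \<Phi> y) (\<xi> a))) (at a)"
proof -
  let ?k = "\<lambda>z. gauss_kernel (\<sigma> z) (\<xi> z)"
  obtain D where D_dominates: "0 \<le> D" "\<And>\<tau> x y. 0 < \<tau> \<Longrightarrow> \<tau> \<le> T \<Longrightarrow> norm x \<le> R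
      \<Longrightarrow> gauss_kernel \<tau> x y * norm (B y *\<^sub>R \<Phi> y) \<le> D * exp (- norm y)"
    using exp_growth_gauss_kernel_bound[OF exp_growth_scaleR[OF B_growth \<Phi>_growth], of T R] by blast
  have "((\<lambda>z. \<integral>y. ?k z y *\<^sub>R \<Phi> y \<partial>lborel) has_derivative
      (\<lambda>h. \<integral>y. (?k a y * q a y h) *\<^sub>R \<Phi> y \<partial>lborel)) (at a)"
  proof (rule has_derivative_integral_dominated[OF \<open>0 < e\<close>, where B = "\<lambda>y. D * exp (- norm y)"
        and F' = "\<lambda>z y h. (?k z y * q z y h) *\<^sub>R \<Phi> y"])
    fix z y h assume z_in_ball: "z \<in> ball a e"
    show "integrable lborel (\<lambda>y. ?k z y *\<^sub>R \<Phi> y)"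
      using range[OF z_in_ball] by (intro integrable_gauss_kernel \<Phi>_growth) simp
    show "((\<lambda>z. ?k z y *\<^sub>R \<Phi> y) has_derivative (\<lambda>h. (?k z y * q z y h) *\<^sub>R \<Phi> y)) (at z)"
      by (rule has_derivative_scaleR_left[OF deriv[OF z_in_ball]])
    have "\<bar>q z y h\<bar> \<le> \<bar>B y\<bar> * norm h"
      using bound[OF z_in_ball, of y h]
        mult_right_mono[OF abs_ge_self norm_ge_zero[of h], of "B y"] by linarith
    then have "?k z y * \<bar>q z y h\<bar> * norm (\<Phi> y) \<le> ?k z y * (\<bar>B y\<bar> * norm h) * norm (\<Phi> y)"
      by (intro mult_right_mono mult_left_mono less_imp_le[OF gauss_kernel_pos]) auto
    also have "\<dots> = ?k z y * norm (B y *\<^sub>R \<Phi> y) * norm h" by simp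
    also have "\<dots> \<le> D * exp (- norm y) * norm h"
      using range[OF z_in_ball] by (intro mult_right_mono D_dominates) auto
    finally show "norm ((?k z y * q z y h) *\<^sub>R \<Phi> y) \<le> D * exp (- norm y) * norm h"
      by (simp add: abs_mult less_imp_le[OF gauss_kernel_pos])
  next
    show "(\<lambda>y. (?k a y * q a y h) *\<^sub>R \<Phi> y) \<in> borel_measurable lborel" for h
      using exp_growth_measurable[OF \<Phi>_growth] meas[of h] by simp
  qed (use D_dominates(1) in \<open>auto intro!: integrable_exp_neg_norm\<close>)
  then show ?thesis unfolding gauss_integral_def by simp
qed

lemma gauss_integral_has_derivative:
  assumes \<tau>_pos: "0 < \<tau>" and \<Phi>_growth: "exp_growth \<Phi>"
  shows "(gauss_integral \<tau> \<Phi> has_derivative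
    (\<lambda>h. gauss_integral \<tau> (\<lambda>y. (((y - x) \<bullet> h) / \<tau>) *\<^sub>R \<Phi> y) x)) (at x)"
proof (rule gauss_integral_has_derivative_dominated[where e = 1 and \<sigma> = "\<lambda>_. \<tau>" and \<xi> = "\<lambda>z. z"
      and q = "\<lambda>z y h. ((y - z) \<bullet> h) / \<tau>" and B = "\<lambda>y. (norm y + (norm x + 1)) / \<tau>"])
  fix z y h assume z_in_ball: "z \<in> ball x 1"
  have norm_z: "norm z \<le> norm x + 1"
    using z_in_ball norm_triangle_sub[of z x] by (simp add: dist_norm norm_minus_commute)
  then show "0 < \<tau> \<and> \<tau> \<le> \<tau> \<and> norm z \<le> norm x + 1" using \<tau>_pos by simp
  show "((\<lambda>z. gauss_kernel \<tau> z y) has_derivative (\<lambda>h. gauss_kernel \<tau> z y * (((y - z) \<bullet> h) / \<tau>)))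
      (at z)"
    by (rule gauss_kernel_has_derivative[OF \<tau>_pos])
  have "\<bar>(y - z) \<bullet> h\<bar> \<le> norm (y - z) * norm h" by (rule Cauchy_Schwarz_ineq2)
  also have "\<dots> \<le> (norm y + (norm x + 1)) * norm h"
    using norm_triangle_ineq4[of y z] norm_z by (intro mult_right_mono) auto
  finally show "\<bar>((y - z) \<bullet> h) / \<tau>\<bar> \<le> (norm y + (norm x + 1)) / \<tau> * norm h"
    using \<tau>_pos by (simp add: divide_right_mono)
qed (use \<Phi>_growth in \<open>auto intro!: exp_growth_intros\<close>)

lemma gauss_integral_has_time_derivative:
  assumes \<tau>_pos: "0 < \<tau>" and \<Phi>_growth: "exp_growth \<Phi>"
  shows "((\<lambda>\<tau>. gauss_integral \<tau> \<Phi> x) has_derivative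
    (\<lambda>h. gauss_integral \<tau> (\<lambda>y. (h / (2 * \<tau>\<^sup>2) * (norm (y - x))\<^sup>2) *\<^sub>R \<Phi> y) x)) (at \<tau>)"
proof (rule gauss_integral_has_derivative_dominated[where e = "\<tau> / 2" and \<sigma> = "\<lambda>t. t"
  and \<xi> = "\<lambda>_. x"
      and q = "\<lambda>t y h. h / (2 * t\<^sup>2) * (norm (y - x))\<^sup>2" and B = "\<lambda>y. 2 / \<tau>\<^sup>2 * (norm (y - x))\<^sup>2"
      and T = "2 * \<tau>" and R = "norm x"])
  fix t y h assume "t \<in> ball \<tau> (\<tau> / 2)"
  then have t_bounds: "\<tau> / 2 \<le> t" "t \<le> 2 * \<tau>" "0 < t"
    using \<tau>_pos by (auto simp: dist_real_def abs_if split: if_splits)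
  then show "0 < t \<and> t \<le> 2 * \<tau> \<and> norm x \<le> norm x" by simp
  show "((\<lambda>t. gauss_kernel t x y) has_derivative
      (\<lambda>h. gauss_kernel t x y * (h / (2 * t\<^sup>2) * (norm (y - x))\<^sup>2))) (at t)"
    by (rule gauss_kernel_has_time_derivative[OF t_bounds(3)])
  have "2 * (\<tau> / 2)\<^sup>2 \<le> 2 * t\<^sup>2" using t_bounds \<tau>_pos by (intro mult_left_mono power_mono) auto
  then have "\<bar>h\<bar> / (2 * t\<^sup>2) \<le> \<bar>h\<bar> / (2 * (\<tau> / 2)\<^sup>2)"
    using t_bounds(3) \<tau>_pos by (intro divide_left_mono) auto
  also have "\<dots> = 2 / \<tau>\<^sup>2 * \<bar>h\<bar>" by (simp add: power_divide)
  finally show "\<bar>h / (2 * t\<^sup>2) * (norm (y - x))\<^sup>2\<bar> \<le> 2 / \<tau>\<^sup>2 * (norm (y - x))\<^sup>2 * norm h"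
    using mult_right_mono[of _ _ "(norm (y - x))\<^sup>2"] by (fastforce simp: abs_mult mult_ac)
qed (use \<tau>_pos \<Phi>_growth in \<open>auto intro!: exp_growth_intros\<close>)

lemma gauss_integral_by_parts:
  fixes \<Psi> :: "'a::euclidean_space \<Rightarrow> real"
  assumes \<tau>_pos: "0 < \<tau>" and \<Psi>_growth: "exp_growth \<Psi>" and \<Psi>'_growth: "exp_growth (\<lambda>y. \<Psi>' y a)"
    and deriv: "\<And>y. (\<Psi> has_derivative \<Psi>' y) (at y)"
  shows "gauss_integral \<tau> (\<lambda>y. \<Psi>' y a) x = gauss_integral \<tau> (\<lambda>y. ((y - x) \<bullet> a) / \<tau> * \<Psi> y) x"
proof -
  let ?\<Theta> = "\<lambda>y a. \<Psi>' y a - ((y - x) \<bullet> a) / \<tau> * \<Psi> y"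
  have weighted: "exp_growth (\<lambda>y. ((y - x) \<bullet> a) / \<tau> * \<Psi> y)" by (intro exp_growth_intros \<Psi>_growth)
  have \<Theta>_growth: "exp_growth (\<lambda>y. ?\<Theta> y a)" by (intro exp_growth_diff \<Psi>'_growth weighted)
  obtain C where C_dominates: "0 \<le> C" "\<And>y. gauss_kernel \<tau> x y * \<bar>?\<Theta> y a\<bar> \<le> C * exp (- norm y)"
    using exp_growth_gauss_kernel_bound[OF \<Theta>_growth, of \<tau> "norm x"] \<tau>_pos
    by (metis order_refl real_norm_def)
  have "(\<integral>y. gauss_kernel \<tau> x y * ?\<Theta> y a \<partial>lborel) = 0"
  proof (rule integral_directional_derivative_eq_zero[
      where B = "\<lambda>y. C * exp (norm a) * exp (- norm y)"])
    show "integrable lborel (\<lambda>y. gauss_kernel \<tau> x y * \<Psi> y)"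
      using integrable_gauss_kernel[OF \<tau>_pos \<Psi>_growth] by simp
    show "((\<lambda>y. gauss_kernel \<tau> x y * \<Psi> y) has_derivative (\<lambda>a. gauss_kernel \<tau> x y * ?\<Theta> y a))
        (at y)" for y
      by (rule has_derivative_eq_rhs[OF
        has_derivative_mult[OF gauss_kernel_has_derivative_right[OF \<tau>_pos] deriv]])
         (simp add: fun_eq_iff inner_diff_left diff_divide_distrib algebra_simps)
    show "(\<lambda>y. gauss_kernel \<tau> x y * ?\<Theta> y a) \<in> borel_measurable borel"
      using exp_growth_measurable[OF \<Theta>_growth] by simp
    fix y s assume "\<bar>s\<bar> < (1::real)"
    then have "norm (s *\<^sub>R a) \<le> norm a" by (simp add: mult_left_le_one_le)
    then have "norm y \<le> norm a + norm (y + s *\<^sub>R a)"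
      using norm_triangle_ineq4[of "y + s *\<^sub>R a" "s *\<^sub>R a"] by simp
    then have "exp (- norm (y + s *\<^sub>R a)) \<le> exp (norm a) * exp (- norm y)"
      by (simp flip: exp_add)
    then have "C * exp (- norm (y + s *\<^sub>R a)) \<le> C * exp (norm a) * exp (- norm y)"
      using mult_left_mono[OF _ C_dominates(1)] by (simp add: mult.assoc)
    then show "norm (gauss_kernel \<tau> x (y + s *\<^sub>R a) * ?\<Theta> (y + s *\<^sub>R a) a)
        \<le> C * exp (norm a) * exp (- norm y)"
      using C_dominates(2)[of "y + s *\<^sub>R a"]
      by (simp add: abs_mult less_imp_le[OF gauss_kernel_pos])
  qed (auto intro!: integrable_exp_neg_norm)
  then show ?thesis
    using integrable_gauss_kernel[OF \<tau>_pos \<Psi>'_growth, of x]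
      integrable_gauss_kernel[OF \<tau>_pos weighted, of x]
    by (simp add: gauss_integral_def right_diff_distrib)
qed

lemma gauss_integral_pos:
  fixes \<Phi> :: "'a::euclidean_space \<Rightarrow> real"
  assumes "0 < \<tau>" "exp_growth \<Phi>" and pos: "\<And>y. 0 < \<Phi> y"
  shows "0 < gauss_integral \<tau> \<Phi> x"
proof -
  have kernel_pos: "0 < gauss_kernel \<tau> x y *\<^sub>R \<Phi> y" for y
    using pos[of y] gauss_kernel_pos[of \<tau> x y] by simp
  have "gauss_integral \<tau> \<Phi> x \<noteq> 0"
  proof
    assume "gauss_integral \<tau> \<Phi> x = 0"
    then have "AE y::'a in lborel. gauss_kernel \<tau> x y *\<^sub>R \<Phi> y = 0"
      using integral_nonneg_eq_0_iff_AE[OF integrable_gauss_kernel[OF assms(1,2), of x]] kernel_pos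
      unfolding gauss_integral_def by (auto intro: less_imp_le)
    then have "AE y::'a in lborel. False"
      by (rule eventually_mono) (use kernel_pos in \<open>simp add: less_le\<close>)
    then show False by (subst (asm) AE_iff_measurable[OF _ refl]) auto
  qed
  moreover have "0 \<le> gauss_integral \<tau> \<Phi> x"
    unfolding gauss_integral_def
    by (intro Bochner_Integration.integral_nonneg less_imp_le[OF kernel_pos])
  ultimately show ?thesis by simp
qed

lemma gauss_integral_tendsto:
  assumes "0 < \<tau>" "exp_growth \<Psi>"
    and meas: "\<And>n. \<Phi>\<^sub>n n \<in> borel_measurable borel" "\<Phi> \<in> borel_measurable borel"
    and pointwise: "\<And>y. (\<lambda>n. \<Phi>\<^sub>n n y) \<longlonglongrightarrow> \<Phi> y" and bound: "\<And>n y. norm (\<Phi>\<^sub>n n y) \<le> \<Psi> y"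
  shows "(\<lambda>n. gauss_integral \<tau> (\<Phi>\<^sub>n n) x) \<longlonglongrightarrow> gauss_integral \<tau> \<Phi> x"
  unfolding gauss_integral_def
proof (rule integral_dominated_convergence)
  show "(\<lambda>y. gauss_kernel \<tau> x y *\<^sub>R \<Phi> y) \<in> borel_measurable lborel"
    "(\<lambda>y. gauss_kernel \<tau> x y *\<^sub>R \<Phi>\<^sub>n n y) \<in> borel_measurable lborel" for n using meas by auto
  show "integrable lborel (\<lambda>y. gauss_kernel \<tau> x y *\<^sub>R \<Psi> y)"
    by (rule integrable_gauss_kernel[OF assms(1,2)])
  show "AE y in lborel. (\<lambda>n. gauss_kernel \<tau> x y *\<^sub>R \<Phi>\<^sub>n n y) \<longlonglongrightarrow> gauss_kernel \<tau> x y *\<^sub>R \<Phi> y"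
    using pointwise by (auto intro!: tendsto_intros)
  show "AE y in lborel. norm (gauss_kernel \<tau> x y *\<^sub>R \<Phi>\<^sub>n n y) \<le> gauss_kernel \<tau> x y *\<^sub>R \<Psi> y" for n
    using bound by (auto intro!: mult_left_mono simp: less_imp_le[OF gauss_kernel_pos])
qed

section \<open>Covariances\<close>

definition covariance ::
    "'m measure \<Rightarrow> ('m \<Rightarrow> real) \<Rightarrow> ('m \<Rightarrow> 'b::{banach, second_countable_topology}) \<Rightarrow> 'b" where
  "covariance M q \<Phi> = (\<integral>y. q y *\<^sub>R \<Phi> y \<partial>M) - (\<integral>y. q y \<partial>M) *\<^sub>R (\<integral>y. \<Phi> y \<partial>M)"

lemma covariance_sum_left:
  assumes "\<And>i. i \<in> I \<Longrightarrow> integrable M (q i)" "\<And>i. i \<in> I \<Longrightarrow> integrable M (\<lambda>y. q i y *\<^sub>R \<Phi> y)"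
  shows "covariance M (\<lambda>y. \<Sum>i\<in>I. q i y) \<Phi> = (\<Sum>i\<in>I. covariance M (q i) \<Phi>)"
  using assms
  by (simp add: covariance_def scaleR_sum_left sum_subtractf Bochner_Integration.integral_sum)

lemma covariance_scale_left: "covariance M (\<lambda>y. c * q y) \<Phi> = c *\<^sub>R covariance M q \<Phi>"
  by (simp add: covariance_def scaleR_diff_right flip: scaleR_scaleR)

context prob_space
begin

lemma covariance_shift:
  assumes "integrable M q" "integrable M \<Phi>" "integrable M (\<lambda>y. q y *\<^sub>R \<Phi> y)"
  shows "covariance M (\<lambda>y. q y - c) (\<lambda>y. \<Phi> y - v) = covariance M q \<Phi>"
  using assms by (simp add: covariance_def scaleR_diff_left scaleR_diff_right prob_space)

lemma third_cumulant_shift: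
  fixes \<Phi> :: "'a \<Rightarrow> 'b::{banach, second_countable_topology}"
  assumes [simp]: "integrable M q" "integrable M (\<lambda>y. (q y)\<^sup>2)" "integrable M \<Phi>"
    "integrable M (\<lambda>y. q y *\<^sub>R \<Phi> y)" "integrable M (\<lambda>y. (q y)\<^sup>2 *\<^sub>R \<Phi> y)"
  shows "covariance M q (\<lambda>y. q y *\<^sub>R \<Phi> y) - covariance M q q *\<^sub>R expectation \<Phi>
      - expectation q *\<^sub>R covariance M q \<Phi>
    = covariance M (\<lambda>y. (q y - c)\<^sup>2) \<Phi> - (2 * (expectation q - c)) *\<^sub>R covariance M q \<Phi>"
proof -
  have "covariance M (\<lambda>y. (q y - c)\<^sup>2) \<Phi>
      = covariance M (\<lambda>y. (q y)\<^sup>2) \<Phi> - (2 * c) *\<^sub>R covariance M q \<Phi>"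
  proof -
    have square: "(q y - c)\<^sup>2 = (q y)\<^sup>2 - (2 * c) * q y + c\<^sup>2" for y
      by (simp add: power2_diff)
    have square_scaleR: "((q y - c)\<^sup>2) *\<^sub>R \<Phi> y
        = (q y)\<^sup>2 *\<^sub>R \<Phi> y - (2 * c) *\<^sub>R (q y *\<^sub>R \<Phi> y) + c\<^sup>2 *\<^sub>R \<Phi> y" for y
      unfolding square by (simp only: scaleR_left_distrib scaleR_left_diff_distrib scaleR_scaleR)
    show ?thesis
      unfolding covariance_def square_scaleR
      unfolding square
      by (simp add: prob_space del: scaleR_scaleR) (simp add: algebra_simps)
  qed
  moreover have "covariance M q (\<lambda>y. q y *\<^sub>R \<Phi> y) - covariance M q q *\<^sub>R expectation \<Phi>
      - expectation q *\<^sub>R covariance M q \<Phi>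
    = covariance M (\<lambda>y. (q y)\<^sup>2) \<Phi> - (2 * expectation q) *\<^sub>R covariance M q \<Phi>"
    by (simp add: covariance_def power2_eq_square algebra_simps flip: scaleR_left_distrib)
  ultimately show ?thesis by (simp add: algebra_simps)
qed

lemma expectation_square_le:
  fixes \<rho> :: "'a \<Rightarrow> real"
  assumes "integrable M \<rho>" "integrable M (\<lambda>y. (\<rho> y)\<^sup>2)"
  shows "(expectation \<rho>)\<^sup>2 \<le> expectation (\<lambda>y. (\<rho> y)\<^sup>2)"
  using variance_eq[OF assms] variance_positive[of \<rho>] by simp

lemma norm_covariance_le:
  fixes \<rho> :: "'a \<Rightarrow> real"
  assumes integrable: "integrable M q" "integrable M \<Phi>" "integrable M (\<lambda>y. q y *\<^sub>R \<Phi> y)"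
    "integrable M \<rho>" "integrable M (\<lambda>y. (\<rho> y)\<^sup>2)"
    and "0 \<le> a" "0 \<le> b" and \<rho>_nonneg: "\<And>y. 0 \<le> \<rho> y"
    and q_bound: "\<And>y. \<bar>q y\<bar> \<le> a * \<rho> y" and \<Phi>_bound: "\<And>y. norm (\<Phi> y) \<le> b * \<rho> y"
  shows "norm (covariance M q \<Phi>) \<le> 2 * a * b * expectation (\<lambda>y. (\<rho> y)\<^sup>2)"
proof -
  have "norm (expectation (\<lambda>y. q y *\<^sub>R \<Phi> y)) \<le> expectation (\<lambda>y. a * b * (\<rho> y)\<^sup>2)"
  proof (rule norm_integral_le_integral)
    show "norm (q y *\<^sub>R \<Phi> y) \<le> a * b * (\<rho> y)\<^sup>2" for y
      using mult_mono[OF q_bound \<Phi>_bound, of y y] assms(6) \<rho>_nonneg[of y]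
      by (simp add: power2_eq_square mult_ac)
  qed (use integrable in auto)
  moreover have "norm (expectation q *\<^sub>R expectation \<Phi>) \<le> a * b * (expectation \<rho>)\<^sup>2"
  proof -
    have "\<bar>expectation q\<bar> \<le> expectation (\<lambda>y. a * \<rho> y)"
      using norm_integral_le_integral[of M q "\<lambda>y. a * \<rho> y"] integrable q_bound by simp
    moreover have "norm (expectation \<Phi>) \<le> expectation (\<lambda>y. b * \<rho> y)"
      using norm_integral_le_integral[of M \<Phi> "\<lambda>y. b * \<rho> y"] integrable \<Phi>_bound by simp
    moreover have "0 \<le> expectation \<rho>" using \<rho>_nonneg by simp
    ultimately have "\<bar>expectation q\<bar> * norm (expectation \<Phi>)
        \<le> (a * expectation \<rho>) * (b * expectation \<rho>)"
      using assms(6) by (intro mult_mono) auto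
    then show ?thesis by (simp add: power2_eq_square mult_ac)
  qed
  moreover have "a * b * (expectation \<rho>)\<^sup>2 \<le> a * b * expectation (\<lambda>y. (\<rho> y)\<^sup>2)"
    using assms(6,7) by (intro mult_left_mono expectation_square_le integrable) auto
  ultimately show ?thesis
    unfolding covariance_def
    using norm_triangle_ineq4[of "expectation (\<lambda>y. q y *\<^sub>R \<Phi> y)" "expectation q *\<^sub>R expectation \<Phi>"]
    by simp
qed

end

section \<open>Gibbs measures\<close>

definition partition_function :: "('a::euclidean_space \<Rightarrow> real) \<Rightarrow> real \<Rightarrow> 'a \<Rightarrow> real" where
  "partition_function g \<tau> = gauss_integral \<tau> (\<lambda>y. exp (- g y))"

definition gibbs :: "('a::euclidean_space \<Rightarrow> real) \<Rightarrow> real \<Rightarrow> 'a \<Rightarrow> 'a measure" where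
  "gibbs g \<tau> x = density lborel
     (\<lambda>y. ennreal (gauss_kernel \<tau> x y * exp (- g y) / partition_function g \<tau> x))"

abbreviation gibbs_mean ::
    "('a::euclidean_space \<Rightarrow> real) \<Rightarrow> real \<Rightarrow> ('a \<Rightarrow> 'b::{banach, second_countable_topology})
      \<Rightarrow> 'a \<Rightarrow> 'b" where
  "gibbs_mean g \<tau> \<Phi> x \<equiv> \<integral>y. \<Phi> y \<partial>gibbs g \<tau> x"

definition gibbs_mean_deriv ::
    "('a::euclidean_space \<Rightarrow> real) \<Rightarrow> real \<Rightarrow> ('a \<Rightarrow> 'b::euclidean_space) \<Rightarrow> 'a \<Rightarrow> 'a \<Rightarrow> 'b" where
  "gibbs_mean_deriv g \<tau> \<Phi> x h = covariance (gibbs g \<tau> x) (\<lambda>y. y \<bullet> h) \<Phi> /\<^sub>R \<tau>"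

definition gibbs_mean_deriv2 ::
    "('a::euclidean_space \<Rightarrow> real) \<Rightarrow> real \<Rightarrow> ('a \<Rightarrow> 'b::euclidean_space) \<Rightarrow> 'a \<Rightarrow> 'a \<Rightarrow> 'a \<Rightarrow> 'b" where
  "gibbs_mean_deriv2 g \<tau> \<Phi> x a h =
     (covariance (gibbs g \<tau> x) (\<lambda>y. y \<bullet> h) (\<lambda>y. (y \<bullet> a) *\<^sub>R \<Phi> y)
      - covariance (gibbs g \<tau> x) (\<lambda>y. y \<bullet> h) (\<lambda>y. y \<bullet> a) *\<^sub>R gibbs_mean g \<tau> \<Phi> x
      - gibbs_mean g \<tau> (\<lambda>y. y \<bullet> a) x *\<^sub>R covariance (gibbs g \<tau> x) (\<lambda>y. y \<bullet> h) \<Phi>) /\<^sub>R \<tau>\<^sup>2"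

definition gibbs_mean_time_deriv ::
    "('a::euclidean_space \<Rightarrow> real) \<Rightarrow> real \<Rightarrow> ('a \<Rightarrow> 'b::euclidean_space) \<Rightarrow> 'a \<Rightarrow> 'b" where
  "gibbs_mean_time_deriv g \<tau> \<Phi> x = covariance (gibbs g \<tau> x) (\<lambda>y. (norm (y - x))\<^sup>2) \<Phi> /\<^sub>R (2 * \<tau>\<^sup>2)"

text \<open>The gradient of \<open>- ln (partition_function g \<tau>)\<close>.\<close>

definition gibbs_drift :: "('a::euclidean_space \<Rightarrow> real) \<Rightarrow> real \<Rightarrow> 'a \<Rightarrow> 'a" where
  "gibbs_drift g \<tau> x = (x - gibbs_mean g \<tau> (\<lambda>y. y) x) /\<^sub>R \<tau>"

locale exp_potential =
  fixes g :: "'a::euclidean_space \<Rightarrow> real"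
  assumes exp_growth_weight: "exp_growth (\<lambda>y. exp (- g y))"
begin

lemma partition_function_pos: "0 < \<tau> \<Longrightarrow> 0 < partition_function g \<tau> x"
  unfolding partition_function_def by (rule gauss_integral_pos[OF _ exp_growth_weight]) auto

lemma gibbs_density_measurable [measurable]:
  "(\<lambda>y. gauss_kernel \<tau> x y * exp (- g y) / partition_function g \<tau> x) \<in> borel_measurable borel"
  using exp_growth_measurable[OF exp_growth_weight] by measurable

lemma gibbs_density_nonneg:
  "0 < \<tau> \<Longrightarrow> 0 \<le> gauss_kernel \<tau> x y * exp (- g y) / partition_function g \<tau> x"
  using partition_function_pos[of \<tau> x] by (simp add: less_imp_le[OF gauss_kernel_pos])

lemma integrable_gibbs:
  assumes "0 < \<tau>" "exp_growth \<Phi>"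
  shows "integrable (gibbs g \<tau> x) \<Phi>"
proof -
  have "exp_growth (\<lambda>y. (exp (- g y) / partition_function g \<tau> x) *\<^sub>R \<Phi> y)"
    by (intro exp_growth_intros exp_growth_weight assms)
  from integrable_gauss_kernel[OF assms(1) this, of x] show ?thesis
    unfolding gibbs_def using exp_growth_measurable[OF assms(2)] gibbs_density_nonneg[OF assms(1)]
    by (subst integrable_density) auto
qed

lemma gibbs_mean_eq_quotient:
  assumes "0 < \<tau>" "\<Phi> \<in> borel_measurable borel"
  shows "gibbs_mean g \<tau> \<Phi> x
    = gauss_integral \<tau> (\<lambda>y. exp (- g y) *\<^sub>R \<Phi> y) x /\<^sub>R partition_function g \<tau> x"
proof -
  have "gibbs_mean g \<tau> \<Phi> x
      = (\<integral>y. (gauss_kernel \<tau> x y * exp (- g y) / partition_function g \<tau> x) *\<^sub>R \<Phi> y \<partial>lborel)"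
    unfolding gibbs_def using assms gibbs_density_nonneg[OF assms(1)]
    by (subst integral_density) simp_all
  also have
    "\<dots> = (\<integral>y. (gauss_kernel \<tau> x y *\<^sub>R exp (- g y) *\<^sub>R \<Phi> y) /\<^sub>R partition_function g \<tau> x \<partial>lborel)"
    by (simp add: divide_inverse mult_ac)
  finally show ?thesis by (simp only: gauss_integral_def integral_scaleR_right)
qed

lemma gauss_integral_weight:
  assumes "0 < \<tau>" "exp_growth \<Phi>"
  shows "gauss_integral \<tau> (\<lambda>y. exp (- g y) *\<^sub>R \<Phi> y) x
      = partition_function g \<tau> x *\<^sub>R gibbs_mean g \<tau> \<Phi> x"
  using gibbs_mean_eq_quotient[OF assms(1) exp_growth_measurable[OF assms(2)], of x]
    partition_function_pos[OF assms(1), of x] by simp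

lemma prob_space_gibbs:
  assumes "0 < \<tau>"
  shows "prob_space (gibbs g \<tau> x)"
proof (rule prob_spaceI)
  have "integrable lborel (\<lambda>y. gauss_kernel \<tau> x y * exp (- g y) / partition_function g \<tau> x)"
    using integrable_gauss_kernel[OF assms exp_growth_weight] by simp
  then have "emeasure (gibbs g \<tau> x) (space (gibbs g \<tau> x))
      = ennreal (\<integral>y. gauss_kernel \<tau> x y * exp (- g y) / partition_function g \<tau> x \<partial>lborel)"
    unfolding gibbs_def using gibbs_density_nonneg[OF assms]
    by (simp add: emeasure_density nn_integral_eq_integral)
  also have "(\<integral>y. gauss_kernel \<tau> x y * exp (- g y) / partition_function g \<tau> x \<partial>lborel) = 1"
    using partition_function_pos[OF assms, of x]
    by (simp add: partition_function_def gauss_integral_def)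
  finally show "emeasure (gibbs g \<tau> x) (space (gibbs g \<tau> x)) = 1" by simp
qed

lemma covariance_gibbs_shift:
  assumes "0 < \<tau>" "exp_growth q" "exp_growth \<Phi>"
  shows "covariance (gibbs g \<tau> x) (\<lambda>y. q y - c) (\<lambda>y. \<Phi> y - v) = covariance (gibbs g \<tau> x) q \<Phi>"
  using assms
  by (intro prob_space.covariance_shift prob_space_gibbs integrable_gibbs exp_growth_intros)

lemma gibbs_quotient_has_derivative_covariance:
  fixes q :: "'p::real_normed_vector \<Rightarrow> 'a \<Rightarrow> real"
  assumes \<sigma>_pos: "0 < \<sigma> z" and \<Phi>_growth: "exp_growth \<Phi>" and q_growth: "\<And>h. exp_growth (q h)"
    and numerator: "((\<lambda>z. gauss_integral (\<sigma> z) (\<lambda>y. exp (- g y) *\<^sub>R \<Phi> y) (\<xi> z)) has_derivative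
      (\<lambda>h. gauss_integral (\<sigma> z) (\<lambda>y. q h y *\<^sub>R exp (- g y) *\<^sub>R \<Phi> y) (\<xi> z))) (at z)"
    and denominator: "((\<lambda>z. partition_function g (\<sigma> z) (\<xi> z)) has_derivative
      (\<lambda>h. gauss_integral (\<sigma> z) (\<lambda>y. q h y *\<^sub>R exp (- g y)) (\<xi> z))) (at z)"
  shows "((\<lambda>z. gauss_integral (\<sigma> z) (\<lambda>y. exp (- g y) *\<^sub>R \<Phi> y) (\<xi> z)
          /\<^sub>R partition_function g (\<sigma> z) (\<xi> z))
    has_derivative (\<lambda>h. covariance (gibbs g (\<sigma> z) (\<xi> z)) (q h) \<Phi>)) (at z)"
proof -
  let ?Z = "partition_function g (\<sigma> z) (\<xi> z)" and ?\<mu> = "gibbs g (\<sigma> z) (\<xi> z)"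
  have Z_nonzero: "?Z \<noteq> 0" using partition_function_pos[OF \<sigma>_pos, of "\<xi> z"] by simp
  have numerator_deriv: "gauss_integral (\<sigma> z) (\<lambda>y. q h y *\<^sub>R exp (- g y) *\<^sub>R \<Phi> y) (\<xi> z)
      = ?Z *\<^sub>R (\<integral>y. q h y *\<^sub>R \<Phi> y \<partial>?\<mu>)" for h
    using gauss_integral_weight[OF \<sigma>_pos exp_growth_scaleR[OF q_growth \<Phi>_growth], of h]
    by (simp add: mult.commute)
  have denominator_deriv: "gauss_integral (\<sigma> z) (\<lambda>y. q h y *\<^sub>R exp (- g y)) (\<xi> z)
      = ?Z * (\<integral>y. q h y \<partial>?\<mu>)" for h
    using gauss_integral_weight[OF \<sigma>_pos q_growth, of h] by (simp add: mult.commute)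
  show ?thesis
    using has_derivative_divideR[OF numerator denominator Z_nonzero] Z_nonzero
    unfolding numerator_deriv denominator_deriv gauss_integral_weight[OF \<sigma>_pos \<Phi>_growth]
      covariance_def
    by (simp add: scaleR_diff_right flip: mult.assoc)
qed

lemma gibbs_mean_has_derivative:
  assumes \<tau>_pos: "0 < \<tau>" and \<Phi>_growth: "exp_growth \<Phi>"
  shows "(gibbs_mean g \<tau> \<Phi> has_derivative gibbs_mean_deriv g \<tau> \<Phi> x) (at x)"
proof -
  have weight: "exp_growth (\<lambda>y. exp (- g y) *\<^sub>R \<Phi> y)"
    by (intro exp_growth_intros exp_growth_weight \<Phi>_growth)
  have "exp_growth (\<lambda>y. ((y - x) \<bullet> h) / \<tau>)" for h by (intro exp_growth_intros)
  from gibbs_quotient_has_derivative_covariance[where \<xi> = "\<lambda>x. x", OF \<tau>_pos \<Phi>_growth this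
      gauss_integral_has_derivative[OF \<tau>_pos weight]
      gauss_integral_has_derivative[OF \<tau>_pos exp_growth_weight, folded partition_function_def]]
  have "(gibbs_mean g \<tau> \<Phi> has_derivative
      (\<lambda>h. covariance (gibbs g \<tau> x) (\<lambda>y. ((y - x) \<bullet> h) / \<tau>) \<Phi>)) (at x)"
    by (simp add: gibbs_mean_eq_quotient[OF \<tau>_pos exp_growth_measurable[OF \<Phi>_growth]])
  moreover have "covariance (gibbs g \<tau> x) (\<lambda>y. ((y - x) \<bullet> h) / \<tau>) \<Phi> = gibbs_mean_deriv g \<tau> \<Phi> x h"
    for h
  proof -
    have "exp_growth (\<lambda>y. y \<bullet> h)" by (intro exp_growth_intros)
    from covariance_gibbs_shift[OF \<tau>_pos this \<Phi>_growth, of x "x \<bullet> h" 0] show ?thesis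
      using covariance_scale_left[of "gibbs g \<tau> x" "inverse \<tau>" "\<lambda>y. (y - x) \<bullet> h" \<Phi>]
      by (simp add: gibbs_mean_deriv_def inner_diff_left divide_inverse_commute)
  qed
  ultimately show ?thesis by simp
qed

lemma gibbs_mean_has_time_derivative:
  assumes \<tau>_pos: "0 < \<tau>" and \<Phi>_growth: "exp_growth \<Phi>"
  shows "((\<lambda>\<tau>. gibbs_mean g \<tau> \<Phi> x) has_vector_derivative gibbs_mean_time_deriv g \<tau> \<Phi> x) (at \<tau>)"
proof -
  let ?q = "\<lambda>h y. h / (2 * \<tau>\<^sup>2) * (norm (y - x))\<^sup>2"
  have weight: "exp_growth (\<lambda>y. exp (- g y) *\<^sub>R \<Phi> y)"
    by (intro exp_growth_intros exp_growth_weight \<Phi>_growth)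
  have "((\<lambda>\<tau>. gauss_integral \<tau> (\<lambda>y. exp (- g y) *\<^sub>R \<Phi> y) x /\<^sub>R partition_function g \<tau> x)
      has_derivative (\<lambda>h. covariance (gibbs g \<tau> x) (?q h) \<Phi>)) (at \<tau>)"
  proof (rule gibbs_quotient_has_derivative_covariance[where z = \<tau> and \<sigma> = "\<lambda>\<tau>. \<tau>" and \<xi> = "\<lambda>_. x"
    and q = ?q])
    show "exp_growth (?q h)" for h by (intro exp_growth_intros)
  qed (use gauss_integral_has_time_derivative[OF \<tau>_pos weight]
      gauss_integral_has_time_derivative[OF \<tau>_pos exp_growth_weight]
        in \<open>simp_all add: \<tau>_pos \<Phi>_growth partition_function_def\<close>)
  then have "((\<lambda>\<tau>. gauss_integral \<tau> (\<lambda>y. exp (- g y) *\<^sub>R \<Phi> y) x /\<^sub>R partition_function g \<tau> x)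
      has_vector_derivative gibbs_mean_time_deriv g \<tau> \<Phi> x) (at \<tau>)"
    by (simp only: has_vector_derivative_def gibbs_mean_time_deriv_def covariance_scale_left
        scaleR_scaleR divide_inverse)
  then show ?thesis
    by (rule has_vector_derivative_transform_within_open[where S = "{0<..}"])
       (use \<tau>_pos in \<open>auto simp: gibbs_mean_eq_quotient exp_growth_measurable[OF \<Phi>_growth]\<close>)
qed

lemma gibbs_mean_deriv_has_derivative:
  assumes \<tau>_pos: "0 < \<tau>" and \<Phi>_growth: "exp_growth \<Phi>"
  shows "((\<lambda>x. gibbs_mean_deriv g \<tau> \<Phi> x a) has_derivative gibbs_mean_deriv2 g \<tau> \<Phi> x a) (at x)"
proof -
  have coordinate: "exp_growth (\<lambda>y. y \<bullet> a)" and product: "exp_growth (\<lambda>y. (y \<bullet> a) *\<^sub>R \<Phi> y)"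
    by (intro exp_growth_intros \<Phi>_growth)+
  show ?thesis
    unfolding gibbs_mean_deriv_def covariance_def
    by (rule has_derivative_eq_rhs[OF has_derivative_scaleR_right[OF has_derivative_diff[OF
              gibbs_mean_has_derivative[OF \<tau>_pos product]
              has_derivative_scaleR[OF gibbs_mean_has_derivative[OF \<tau>_pos coordinate]
                gibbs_mean_has_derivative[OF \<tau>_pos \<Phi>_growth]]]]])
       (simp add: fun_eq_iff gibbs_mean_deriv2_def gibbs_mean_deriv_def algebra_simps
          power2_eq_square)
qed

lemma gibbs_mean_heat_equation:
  assumes \<tau>_pos: "0 < \<tau>" and \<Phi>_growth: "exp_growth \<Phi>" and basis: "orthonormal_basis S"
  shows "gibbs_mean_time_deriv g \<tau> \<Phi> x = (1 / 2) *\<^sub>R (\<Sum>b\<in>S. gibbs_mean_deriv2 g \<tau> \<Phi> x b b)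
    - gibbs_mean_deriv g \<tau> \<Phi> x (gibbs_drift g \<tau> x)"
proof -
  interpret prob_space "gibbs g \<tau> x" by (rule prob_space_gibbs[OF \<tau>_pos])
  note integrable = integrable_gibbs[OF \<tau>_pos]
  let ?cov = "covariance (gibbs g \<tau> x)"
  define m where "m = gibbs_mean g \<tau> (\<lambda>y. y) x - x"
  have m_inner: "m \<bullet> b = gibbs_mean g \<tau> (\<lambda>y. y \<bullet> b) x - x \<bullet> b" for b
    by (simp add: m_def inner_diff_left integral_inner_left[OF integrable[OF exp_growth_ident]])
  have deriv2: "gibbs_mean_deriv2 g \<tau> \<Phi> x b b
      = (?cov (\<lambda>y. ((y - x) \<bullet> b)\<^sup>2) \<Phi> - (2 * (m \<bullet> b)) *\<^sub>R ?cov (\<lambda>y. y \<bullet> b) \<Phi>) /\<^sub>R \<tau>\<^sup>2" for b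
    unfolding gibbs_mean_deriv2_def m_inner inner_diff_left
    by (subst third_cumulant_shift[of "\<lambda>y. y \<bullet> b" _ "x \<bullet> b"])
      (intro integrable exp_growth_intros \<Phi>_growth refl)+
  have square: "(\<Sum>b\<in>S. ?cov (\<lambda>y. ((y - x) \<bullet> b)\<^sup>2) \<Phi>) = ?cov (\<lambda>y. (norm (y - x))\<^sup>2) \<Phi>"
    unfolding sum_inner_square_orthonormal_basis[OF basis, symmetric]
    by (rule covariance_sum_left[symmetric]) (intro integrable exp_growth_intros \<Phi>_growth)+
  have linear: "linear (gibbs_mean_deriv g \<tau> \<Phi> x)"
    using gibbs_mean_has_derivative[OF \<tau>_pos \<Phi>_growth] by (rule has_derivative_linear)
  have "(\<Sum>b\<in>S. (m \<bullet> b) *\<^sub>R ?cov (\<lambda>y. y \<bullet> b) \<Phi>)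
      = \<tau> *\<^sub>R (\<Sum>b\<in>S. gibbs_mean_deriv g \<tau> \<Phi> x ((m \<bullet> b) *\<^sub>R b))"
    unfolding linear_cmul[OF linear] using \<tau>_pos
    by (simp add: gibbs_mean_deriv_def scaleR_sum_right mult.left_commute[of \<tau>])
  also have "\<dots> = \<tau> *\<^sub>R gibbs_mean_deriv g \<tau> \<Phi> x m"
    by (simp add: linear_sum[OF linear, symmetric] sum_inner_scaleR_orthonormal_basis[OF basis])
  finally have drift: "(\<Sum>b\<in>S. (m \<bullet> b) *\<^sub>R ?cov (\<lambda>y. y \<bullet> b) \<Phi>) = \<tau> *\<^sub>R gibbs_mean_deriv g \<tau> \<Phi> x m" .
  have laplacian: "(\<Sum>b\<in>S. gibbs_mean_deriv2 g \<tau> \<Phi> x b b)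
      = (?cov (\<lambda>y. (norm (y - x))\<^sup>2) \<Phi> - 2 *\<^sub>R \<tau> *\<^sub>R gibbs_mean_deriv g \<tau> \<Phi> x m) /\<^sub>R \<tau>\<^sup>2"
    unfolding deriv2 scaleR_sum_right[symmetric] sum_subtractf square
    by (simp add: drift[symmetric] scaleR_sum_right)
  have "gibbs_drift g \<tau> x = (- inverse \<tau>) *\<^sub>R m" by (simp add: gibbs_drift_def m_def algebra_simps)
  then have "gibbs_mean_deriv g \<tau> \<Phi> x (gibbs_drift g \<tau> x)
      = (- inverse \<tau>) *\<^sub>R gibbs_mean_deriv g \<tau> \<Phi> x m"
    by (simp only: linear_cmul[OF linear])
  then show ?thesis
    unfolding laplacian gibbs_mean_time_deriv_def
    using \<tau>_pos by (simp add: scaleR_diff_right power2_eq_square)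
qed

lemma gibbs_mean_by_parts:
  fixes \<phi> :: "'a \<Rightarrow> real"
  assumes \<tau>_pos: "0 < \<tau>" and gradient: "\<And>y. GDERIV g y :> G y" and G_growth: "exp_growth G"
    and \<phi>_growth: "exp_growth \<phi>" "exp_growth (\<lambda>y. \<phi>' y a)"
    and deriv: "\<And>y. (\<phi> has_derivative \<phi>' y) (at y)"
  shows "gibbs_mean g \<tau> (\<lambda>y. \<phi>' y a - (a \<bullet> G y) * \<phi> y) x
      = gibbs_mean g \<tau> (\<lambda>y. ((y - x) \<bullet> a) / \<tau> * \<phi> y) x"
proof -
  have derivative: "((\<lambda>y. exp (- g y) * \<phi> y) has_derivative
      (\<lambda>a. exp (- g y) * (\<phi>' y a - (a \<bullet> G y) * \<phi> y))) (at y)" for y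
    using gradient[of y, unfolded gderiv_def] deriv[of y]
    by (auto intro!: derivative_eq_intros simp: fun_eq_iff algebra_simps)
  have "gauss_integral \<tau> (\<lambda>y. exp (- g y) * (\<phi>' y a - (a \<bullet> G y) * \<phi> y)) x
      = gauss_integral \<tau> (\<lambda>y. ((y - x) \<bullet> a) / \<tau> * (exp (- g y) * \<phi> y)) x"
    by (rule gauss_integral_by_parts[OF \<tau>_pos _ _ derivative])
      (intro exp_growth_intros exp_growth_weight G_growth \<phi>_growth)+
  also have "\<dots> = gauss_integral \<tau> (\<lambda>y. exp (- g y) * (((y - x) \<bullet> a) / \<tau> * \<phi> y)) x"
    by (simp only: mult.left_commute)
  finally have "gauss_integral \<tau> (\<lambda>y. exp (- g y) *\<^sub>R (\<phi>' y a - (a \<bullet> G y) * \<phi> y)) x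
      = gauss_integral \<tau> (\<lambda>y. exp (- g y) *\<^sub>R (((y - x) \<bullet> a) / \<tau> * \<phi> y)) x"
    by (simp only: real_scaleR_def)
  moreover have "exp_growth (\<lambda>y. \<phi>' y a - (a \<bullet> G y) * \<phi> y)"
    "exp_growth (\<lambda>y. ((y - x) \<bullet> a) / \<tau> * \<phi> y)"
    by (intro exp_growth_intros G_growth \<phi>_growth)+
  ultimately show ?thesis
    by (simp only: gibbs_mean_eq_quotient[OF \<tau>_pos] exp_growth_measurable)
qed

lemma gibbs_mean_gradient:
  assumes \<tau>_pos: "0 < \<tau>" and gradient: "\<And>y. GDERIV g y :> G y" and G_growth: "exp_growth G"
  shows "gibbs_mean g \<tau> G x = gibbs_drift g \<tau> x"
proof (rule vector_eq_rdot[THEN iffD1], rule allI)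
  fix a
  interpret prob_space "gibbs g \<tau> x" by (rule prob_space_gibbs[OF \<tau>_pos])
  have integrable: "integrable (gibbs g \<tau> x) G" "integrable (gibbs g \<tau> x) (\<lambda>y. y)"
    by (intro integrable_gibbs exp_growth_intros \<tau>_pos G_growth)+
  have "gibbs_mean g \<tau> (\<lambda>y. 0 - (a \<bullet> G y) * 1) x = gibbs_mean g \<tau> (\<lambda>y. ((y - x) \<bullet> a) / \<tau> * 1) x"
    by (rule gibbs_mean_by_parts[OF \<tau>_pos gradient G_growth, where \<phi>' = "\<lambda>_ _. 0"])
      (auto intro: exp_growth_const)
  also have "\<dots> = (gibbs_mean g \<tau> (\<lambda>y. y) x \<bullet> a - x \<bullet> a) / \<tau>"
    using integrable(2) by (simp add: inner_diff_left prob_space)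
  finally show "gibbs_mean g \<tau> G x \<bullet> a = gibbs_drift g \<tau> x \<bullet> a"
    using integrable(1)
    by (simp add: gibbs_drift_def inner_commute[of a] inner_diff_left divide_inverse algebra_simps)
qed

lemma gibbs_mean_virial:
  assumes \<tau>_pos: "0 < \<tau>" and gradient: "\<And>y. GDERIV g y :> G y" and G_growth: "exp_growth G"
  shows "gibbs_mean g \<tau> (\<lambda>y. (norm (y - x))\<^sup>2) x
    = \<tau> * (real DIM('a) - gibbs_mean g \<tau> (\<lambda>y. G y \<bullet> (y - x)) x)"
proof -
  interpret prob_space "gibbs g \<tau> x" by (rule prob_space_gibbs[OF \<tau>_pos])
  note integrable = integrable_gibbs[OF \<tau>_pos]
  have parts: "gibbs_mean g \<tau> (\<lambda>y. b \<bullet> b - (b \<bullet> G y) * ((y - x) \<bullet> b)) x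
      = gibbs_mean g \<tau> (\<lambda>y. ((y - x) \<bullet> b) / \<tau> * ((y - x) \<bullet> b)) x" for b
    by (rule gibbs_mean_by_parts[OF \<tau>_pos gradient G_growth, where \<phi>' = "\<lambda>_ a. a \<bullet> b"])
       (auto intro!: exp_growth_intros derivative_eq_intros)
  have "(norm (y - x))\<^sup>2 / \<tau> = (\<Sum>b\<in>Basis. ((y - x) \<bullet> b) / \<tau> * ((y - x) \<bullet> b))" for y
    using sum_inner_square_orthonormal_basis[OF orthonormal_basis_Basis, of "y - x"]
    by (simp add: power2_eq_square flip: sum_divide_distrib)
  then have "gibbs_mean g \<tau> (\<lambda>y. (norm (y - x))\<^sup>2 / \<tau>) x
      = (\<Sum>b\<in>Basis. gibbs_mean g \<tau> (\<lambda>y. ((y - x) \<bullet> b) / \<tau> * ((y - x) \<bullet> b)) x)"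
    by (simp only:) (rule Bochner_Integration.integral_sum, intro integrable exp_growth_intros)
  also have "\<dots> = gibbs_mean g \<tau> (\<lambda>y. \<Sum>b\<in>Basis. b \<bullet> b - (b \<bullet> G y) * ((y - x) \<bullet> b)) x"
    unfolding parts[symmetric]
    by (rule Bochner_Integration.integral_sum[symmetric])
      (intro integrable exp_growth_intros G_growth)
  also have "(\<lambda>y. \<Sum>b\<in>Basis. b \<bullet> b - (b \<bullet> G y) * ((y - x) \<bullet> b)) = (\<lambda>y. real DIM('a) - G y \<bullet> (y - x))"
    by (simp add: fun_eq_iff sum_subtractf euclidean_inner[of "G _"] inner_commute)
  also have "gibbs_mean g \<tau> (\<lambda>y. real DIM('a) - G y \<bullet> (y - x)) x
      = real DIM('a) - gibbs_mean g \<tau> (\<lambda>y. G y \<bullet> (y - x)) x"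
    by (subst Bochner_Integration.integral_diff)
      (auto intro!: integrable exp_growth_intros G_growth simp: prob_space)
  finally show ?thesis using \<tau>_pos by (simp add: field_simps)
qed

lemma partition_function_gderiv:
  assumes \<tau>_pos: "0 < \<tau>"
  shows "GDERIV (partition_function g \<tau>) x :> - partition_function g \<tau> x *\<^sub>R gibbs_drift g \<tau> x"
  unfolding gderiv_def
proof (rule has_derivative_eq_rhs[OF
    gauss_integral_has_derivative[OF \<tau>_pos exp_growth_weight, folded partition_function_def]],
    rule ext)
  fix h
  interpret prob_space "gibbs g \<tau> x" by (rule prob_space_gibbs[OF \<tau>_pos])
  have "exp_growth (\<lambda>y. ((y - x) \<bullet> h) / \<tau>)" by (intro exp_growth_intros)
  from gauss_integral_weight[OF \<tau>_pos this, of x]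
  have "gauss_integral \<tau> (\<lambda>y. (((y - x) \<bullet> h) / \<tau>) *\<^sub>R exp (- g y)) x
      = partition_function g \<tau> x * gibbs_mean g \<tau> (\<lambda>y. ((y - x) \<bullet> h) / \<tau>) x"
    by (simp add: mult.commute)
  also have "gibbs_mean g \<tau> (\<lambda>y. ((y - x) \<bullet> h) / \<tau>) x = - (h \<bullet> gibbs_drift g \<tau> x)"
    using integrable_gibbs[OF \<tau>_pos exp_growth_ident, of x]
    by (simp add: gibbs_drift_def inner_commute[of h] inner_diff_left prob_space divide_inverse
      algebra_simps)
  finally show "gauss_integral \<tau> (\<lambda>y. (((y - x) \<bullet> h) / \<tau>) *\<^sub>R exp (- g y)) x
      = h \<bullet> (- partition_function g \<tau> x *\<^sub>R gibbs_drift g \<tau> x)"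
    by simp
qed

end

lemma exp_potentialI:
  assumes "continuous_on UNIV g" "\<And>y. a - b * norm y \<le> g y"
  shows "exp_potential g"
proof
  show "exp_growth (\<lambda>y. exp (- g y))"
  proof (rule exp_growthI[where A = "exp (- a)" and B = b])
    show "(\<lambda>y. exp (- g y)) \<in> borel_measurable borel"
      by (intro borel_measurable_continuous_onI continuous_intros assms(1))
    show "norm (exp (- g y)) \<le> exp (- a) * exp (b * norm y)" for y
      using assms(2)[of y] by (simp flip: exp_add)
  qed
qed

lemma gibbs_mean_tendsto:
  fixes \<Phi> :: "'a::euclidean_space \<Rightarrow> 'b::euclidean_space"
  assumes \<tau>_pos: "0 < \<tau>" and potential: "exp_potential g" "\<And>n. exp_potential (g\<^sub>n n)"
    and \<Phi>_growth: "exp_growth \<Phi>"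
    and pointwise: "\<And>y. (\<lambda>n. g\<^sub>n n y) \<longlonglongrightarrow> g y" and lower: "\<And>n y. a - b * norm y \<le> g\<^sub>n n y"
  shows "(\<lambda>n. gibbs_mean (g\<^sub>n n) \<tau> \<Phi> x) \<longlonglongrightarrow> gibbs_mean g \<tau> \<Phi> x"
proof -
  interpret exp_potential g by (rule potential(1))
  have weights: "(\<lambda>n. gauss_integral \<tau> (\<lambda>y. exp (- g\<^sub>n n y) *\<^sub>R \<Psi> y) x)
      \<longlonglongrightarrow> gauss_integral \<tau> (\<lambda>y. exp (- g y) *\<^sub>R \<Psi> y) x"
    if \<Psi>_growth: "exp_growth \<Psi>" for \<Psi> :: "'a \<Rightarrow> 'c::euclidean_space"
  proof (rule gauss_integral_tendsto[OF \<tau>_pos,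
    where \<Psi> = "\<lambda>y. (exp (- a) * exp (b * norm y)) * norm (\<Psi> y)"])
    have "exp_growth (\<lambda>y::'a. exp (- a) * exp (b * norm y))"
      by (rule exp_growthI[where A = "exp (- a)" and B = b]) auto
    from exp_growth_mult[OF this exp_growth_norm[OF \<Psi>_growth]]
    show "exp_growth (\<lambda>y. (exp (- a) * exp (b * norm y)) * norm (\<Psi> y))" .
    show "(\<lambda>y. exp (- g\<^sub>n n y) *\<^sub>R \<Psi> y) \<in> borel_measurable borel" for n
      using exp_potential.exp_growth_weight[OF potential(2)]
      by (intro exp_growth_measurable exp_growth_intros \<Psi>_growth)
    show "(\<lambda>y. exp (- g y) *\<^sub>R \<Psi> y) \<in> borel_measurable borel"
      by (intro exp_growth_measurable exp_growth_intros exp_growth_weight \<Psi>_growth)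
    show "(\<lambda>n. exp (- g\<^sub>n n y) *\<^sub>R \<Psi> y) \<longlonglongrightarrow> exp (- g y) *\<^sub>R \<Psi> y" for y
      by (intro tendsto_intros pointwise)
    show "norm (exp (- g\<^sub>n n y) *\<^sub>R \<Psi> y) \<le> (exp (- a) * exp (b * norm y)) * norm (\<Psi> y)" for n y
      using lower[of y n] by (auto intro!: mult_right_mono simp flip: exp_add)
  qed
  have "(\<lambda>n. partition_function (g\<^sub>n n) \<tau> x) \<longlonglongrightarrow> partition_function g \<tau> x"
    using weights[OF exp_growth_const[of "1::real"]] by (simp add: partition_function_def)
  then have
    "(\<lambda>n. gauss_integral \<tau> (\<lambda>y. exp (- g\<^sub>n n y) *\<^sub>R \<Phi> y) x /\<^sub>R partition_function (g\<^sub>n n) \<tau> x)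
      \<longlonglongrightarrow> gauss_integral \<tau> (\<lambda>y. exp (- g y) *\<^sub>R \<Phi> y) x /\<^sub>R partition_function g \<tau> x"
    using partition_function_pos[OF \<tau>_pos, of x] by (intro tendsto_intros weights \<Phi>_growth) auto
  then show ?thesis
    by (simp add: exp_potential.gibbs_mean_eq_quotient[OF potential(1) \<tau>_pos]
      exp_potential.gibbs_mean_eq_quotient[OF potential(2) \<tau>_pos]
        exp_growth_measurable[OF \<Phi>_growth])
qed

section \<open>Coupling profiles and semimonotone vector fields\<close>

text \<open>For \<open>G = \<nabla>g\<close> this is the bound \<open>\<kappa>\<^sub>g(r) \<ge> -f(r)/r\<close> for all \<open>r > 0\<close>.\<close>

definition semimonotone :: "(real \<Rightarrow> real) \<Rightarrow> ('a::real_inner \<Rightarrow> 'a) \<Rightarrow> bool" where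
  "semimonotone f G \<longleftrightarrow> (\<forall>x y. - (norm (x - y) * f (norm (x - y))) \<le> (G x - G y) \<bullet> (x - y))"

lemma semimonotoneD:
  "semimonotone f G \<Longrightarrow> - (norm (x - y) * f (norm (x - y))) \<le> (G x - G y) \<bullet> (x - y)"
  by (simp add: semimonotone_def)

lemma semimonotone_LIMSEQ:
  fixes G :: "'a::real_inner \<Rightarrow> 'a" and G\<^sub>n :: "nat \<Rightarrow> 'a \<Rightarrow> 'a"
  assumes f_limit: "\<And>r. 0 \<le> r \<Longrightarrow> (\<lambda>n. f\<^sub>n n r) \<longlonglongrightarrow> f r" and G_limit: "\<And>x. (\<lambda>n. G\<^sub>n n x) \<longlonglongrightarrow> G x"
    and semimonotone: "\<And>n. semimonotone (f\<^sub>n n) (G\<^sub>n n)"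
  shows "semimonotone f G"
  unfolding semimonotone_def
proof (intro allI)
  fix x y :: 'a
  have "(\<lambda>n. - (norm (x - y) * f\<^sub>n n (norm (x - y)))) \<longlonglongrightarrow> - (norm (x - y) * f (norm (x - y)))"
    by (intro tendsto_intros f_limit) simp
  moreover have "(\<lambda>n. (G\<^sub>n n x - G\<^sub>n n y) \<bullet> (x - y)) \<longlonglongrightarrow> (G x - G y) \<bullet> (x - y)"
    by (intro tendsto_intros G_limit)
  ultimately show "- (norm (x - y) * f (norm (x - y))) \<le> (G x - G y) \<bullet> (x - y)"
    by (rule LIMSEQ_le) (use semimonotoneD[OF semimonotone] in blast)
qed

locale coupling_profile =
  fixes f f' f'' :: "real \<Rightarrow> real" and \<Lambda> \<beta> :: real
  assumes f_zero: "f 0 = 0"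
    and f_continuous: "continuous_on {0..} f"
    and f_deriv: "\<And>r. 0 < r \<Longrightarrow> (f has_real_derivative f' r) (at r)"
    and f'_deriv: "\<And>r. 0 < r \<Longrightarrow> (f' has_real_derivative f'' r) (at r)"
    and f_ode: "\<And>r. 0 < r \<Longrightarrow> 2 * f'' r + f r * f' r \<le> 0"
    and f'_nonneg: "\<And>r. 0 < r \<Longrightarrow> 0 \<le> f' r"
    and f'_le: "\<And>r. 0 < r \<Longrightarrow> f' r \<le> \<Lambda>"
    and f_le: "\<And>r. 0 < r \<Longrightarrow> f r \<le> \<beta>"
begin

lemma \<Lambda>_nonneg: "0 \<le> \<Lambda>"
  using f'_nonneg[of 1] f'_le[of 1] by simp

lemma f_mono:
  assumes "0 \<le> r" "r \<le> s"
  shows "f r \<le> f s"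
proof (rule DERIV_nonneg_imp_increasing_open[OF \<open>r \<le> s\<close>])
  show "continuous_on {r..s} f" using f_continuous assms by (auto intro: continuous_on_subset)
  show "\<exists>y. (f has_real_derivative y) (at t) \<and> 0 \<le> y" if "r < t" for t
    using f_deriv[of t] f'_nonneg[of t] that assms by auto
qed

lemma f_nonneg: "0 \<le> r \<Longrightarrow> 0 \<le> f r"
  using f_mono[of 0 r] f_zero by simp

lemma \<beta>_nonneg: "0 \<le> \<beta>"
  using f_nonneg[of 1] f_le[of 1] by simp

lemma f_le_linear:
  assumes "0 \<le> r"
  shows "f r \<le> \<Lambda> * r"
proof -
  have "\<Lambda> * 0 - f 0 \<le> \<Lambda> * r - f r"
  proof (rule DERIV_nonneg_imp_increasing_open[OF assms])
    show "continuous_on {0..r} (\<lambda>r. \<Lambda> * r - f r)"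
      using f_continuous by (intro continuous_intros) (auto intro: continuous_on_subset)
    show "\<exists>y. ((\<lambda>r. \<Lambda> * r - f r) has_real_derivative y) (at t) \<and> 0 \<le> y" if "0 < t" for t
      using f'_le[OF that] that
      by (intro exI[of _ "\<Lambda> - f' t"]) (auto intro!: derivative_eq_intros f_deriv)
  qed
  then show ?thesis by (simp add: f_zero)
qed

lemma f''_nonpos: "0 < r \<Longrightarrow> f'' r \<le> 0"
  using f_ode[of r] f_nonneg[of r] f'_nonneg[of r] mult_nonneg_nonneg[of "f r" "f' r"] by linarith

lemma coupling_profile_rescale:
  assumes "0 < c" "c \<le> 1"
  shows "coupling_profile (\<lambda>r. f (r / c)) (\<lambda>r. f' (r / c) / c) (\<lambda>r. f'' (r / c) / c\<^sup>2) (\<Lambda> / c) \<beta>"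
proof
  show "continuous_on {0..} (\<lambda>r. f (r / c))"
    using assms by (intro continuous_on_compose2[OF f_continuous]) (auto intro!: continuous_intros)
  fix r :: real assume r_pos: "0 < r"
  then have rc_pos: "0 < r / c" using assms by simp
  have scale: "((\<lambda>r. r / c) has_real_derivative 1 / c) (at r)"
    by (rule DERIV_cdivide[OF DERIV_ident])
  show "((\<lambda>r. f (r / c)) has_real_derivative f' (r / c) / c) (at r)"
    using DERIV_chain2[of f "f' (r / c)", OF f_deriv[OF rc_pos] scale] by simp
  from DERIV_cdivide[OF DERIV_chain2[of f' "f'' (r / c)", OF f'_deriv[OF rc_pos] scale], of c]
  show "((\<lambda>r. f' (r / c) / c) has_real_derivative f'' (r / c) / c\<^sup>2) (at r)"
    by (simp add: power2_eq_square)
  have "2 * f'' (r / c) / c \<le> 2 * f'' (r / c) / 1"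
    using f''_nonpos[OF rc_pos] assms by (intro divide_left_mono_neg) auto
  then have "(2 * f'' (r / c) / c + f (r / c) * f' (r / c)) / c \<le> 0"
    using f_ode[OF rc_pos] assms by (intro divide_nonpos_pos) linarith+
  then show "2 * (f'' (r / c) / c\<^sup>2) + f (r / c) * (f' (r / c) / c) \<le> 0"
    by (simp add: add_divide_distrib power2_eq_square)
  show "0 \<le> f' (r / c) / c" "f' (r / c) / c \<le> \<Lambda> / c"
    using f'_nonneg[OF rc_pos] f'_le[OF rc_pos] assms by (auto intro: divide_right_mono)
  show "f (r / c) \<le> \<beta>" by (rule f_le[OF rc_pos])
qed (simp add: f_zero)

lemma semimonotone_lower_bound:
  assumes "semimonotone f G"
  shows "- ((norm (G x) + \<beta>) * norm (y - x)) \<le> G y \<bullet> (y - x)"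
proof (cases "y = x")
  case False
  then have "norm (y - x) * f (norm (y - x)) \<le> norm (y - x) * \<beta>"
    by (intro mult_left_mono f_le) auto
  then have "- (\<beta> * norm (y - x)) \<le> (G y - G x) \<bullet> (y - x)"
    using semimonotoneD[OF assms, of y x] by (simp add: mult.commute)
  moreover have "- (norm (G x) * norm (y - x)) \<le> G x \<bullet> (y - x)"
    using Cauchy_Schwarz_ineq2[of "G x" "y - x"] by linarith
  ultimately show ?thesis by (simp add: inner_diff_left distrib_right)
qed simp

end

lemma coupling_profile_fL:
  assumes "0 < L"
  shows "coupling_profile (fL L) (\<lambda>r. L * (1 - (tanh (r * sqrt L / 2))\<^sup>2))
    (\<lambda>r. - (fL L r * (L * (1 - (tanh (r * sqrt L / 2))\<^sup>2))) / 2) L (2 * sqrt L)"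
proof
  have L_eq: "L = sqrt L * sqrt L" using assms by simp
  show "fL L 0 = 0" by (simp add: fL_def)
  show "continuous_on {0..} (fL L)" unfolding fL_def by (intro continuous_intros) auto
  fix r :: real
  show "(fL L has_real_derivative L * (1 - (tanh (r * sqrt L / 2))\<^sup>2)) (at r)"
    unfolding fL_def using L_eq by (auto intro!: derivative_eq_intros)
  show "((\<lambda>r. L * (1 - (tanh (r * sqrt L / 2))\<^sup>2)) has_real_derivative
      - (fL L r * (L * (1 - (tanh (r * sqrt L / 2))\<^sup>2))) / 2) (at r)"
    unfolding fL_def by (auto intro!: derivative_eq_intros simp: power2_eq_square algebra_simps)
  show "2 * (- (fL L r * (L * (1 - (tanh (r * sqrt L / 2))\<^sup>2))) / 2)
      + fL L r * (L * (1 - (tanh (r * sqrt L / 2))\<^sup>2)) \<le> 0" by simp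
  have "(tanh (r * sqrt L / 2))\<^sup>2 \<le> 1"
    using tanh_real_bounds[of "r * sqrt L / 2"] by (auto simp: abs_square_le_1)
  then show "0 \<le> L * (1 - (tanh (r * sqrt L / 2))\<^sup>2)" "L * (1 - (tanh (r * sqrt L / 2))\<^sup>2) \<le> L"
    using assms by (auto simp: mult_le_cancel_left1)
  show "fL L r \<le> 2 * sqrt L"
    using assms tanh_real_lt_1[of "r * sqrt L / 2"] by (simp add: fL_def mult_le_cancel_left2)
qed

section \<open>Comparison by reflection coupling\<close>

locale viscous_burgers = coupling_profile f f' f'' \<Lambda> \<beta>
  for f f' f'' :: "real \<Rightarrow> real" and \<Lambda> \<beta> +
  fixes T C :: real and p pt :: "real \<Rightarrow> 'a::euclidean_space \<Rightarrow> 'a"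
    and Dp :: "real \<Rightarrow> 'a \<Rightarrow> 'a \<Rightarrow> 'a" and D2p :: "real \<Rightarrow> 'a \<Rightarrow> 'a \<Rightarrow> 'a \<Rightarrow> 'a"
  assumes T_pos: "0 < T"
    and semimonotone_initial: "semimonotone f (p 0)"
    and p_continuous_time: "\<And>x. continuous_on {0..T} (\<lambda>\<tau>. p \<tau> x)"
    and p_lipschitz: "\<And>R. \<exists>K. \<forall>\<tau>\<in>{0..T}. K-lipschitz_on (cball 0 R) (p \<tau>)"
    and p_growth: "\<And>\<tau> x. \<tau> \<in> {0..T} \<Longrightarrow> norm (p \<tau> x) \<le> C * (1 + norm x)"
    and p_has_derivative: "\<And>\<tau> x. 0 < \<tau> \<Longrightarrow> \<tau> \<le> T \<Longrightarrow> (p \<tau> has_derivative Dp \<tau> x) (at x)"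
    and Dp_has_derivative: "\<And>\<tau> x a. 0 < \<tau> \<Longrightarrow> \<tau> \<le> T \<Longrightarrow>
      ((\<lambda>x. Dp \<tau> x a) has_derivative D2p \<tau> x a) (at x)"
    and p_has_time_derivative: "\<And>\<tau> x. 0 < \<tau> \<Longrightarrow> \<tau> \<le> T \<Longrightarrow>
      ((\<lambda>\<tau>. p \<tau> x) has_vector_derivative pt \<tau> x) (at \<tau>)"
    and burgers: "\<And>\<tau> x S. 0 < \<tau> \<Longrightarrow> \<tau> \<le> T \<Longrightarrow> orthonormal_basis S \<Longrightarrow>
      pt \<tau> x = (1 / 2) *\<^sub>R (\<Sum>b\<in>S. D2p \<tau> x b b) - Dp \<tau> x (p \<tau> x)"
begin

lemma C_nonneg: "0 \<le> C"
  using p_growth[of 0 0] T_pos norm_ge_zero[of "p 0 0"] by (simp del: norm_ge_zero)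

definition excess :: "real \<Rightarrow> 'a \<Rightarrow> 'a \<Rightarrow> real" where
  "excess \<tau> x y = (p \<tau> x - p \<tau> y) \<bullet> sgn (x - y) + f (norm (x - y))"

lemma excess_nonneg_iff:
  assumes "x \<noteq> y"
  shows "0 \<le> excess \<tau> x y \<longleftrightarrow> - (norm (x - y) * f (norm (x - y))) \<le> (p \<tau> x - p \<tau> y) \<bullet> (x - y)"
proof -
  have "excess \<tau> x y = ((p \<tau> x - p \<tau> y) \<bullet> (x - y) + norm (x - y) * f (norm (x - y))) / norm (x - y)"
  proof -
    have "(p \<tau> x - p \<tau> y) \<bullet> sgn (x - y) = ((p \<tau> x - p \<tau> y) \<bullet> (x - y)) / norm (x - y)"
      by (simp add: sgn_div_norm divide_inverse mult.commute)
    then show ?thesis using assms by (simp add: excess_def add_divide_distrib)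
  qed
  then show ?thesis using assms by (simp add: zero_le_divide_iff) linarith
qed

text \<open>The penalty grows fast enough in time to absorb every error term that it causes.\<close>

definition rate :: real where "rate = 2 * real DIM('a) + \<Lambda> + 4 * C + 1"

definition weight :: "'a \<Rightarrow> 'a \<Rightarrow> real" where "weight x y = 1 + x \<bullet> x + y \<bullet> y"

definition penalized :: "real \<Rightarrow> real \<Rightarrow> 'a \<Rightarrow> 'a \<Rightarrow> real" where
  "penalized \<epsilon> \<tau> x y = excess \<tau> x y + \<epsilon> * exp (rate * \<tau>) * weight x y"

lemma weight_ge_1: "1 \<le> weight x y"
  by (simp add: weight_def)

lemma rate_pos: "0 < rate"
  unfolding rate_def using \<Lambda>_nonneg C_nonneg by simp

lemma penalized_has_time_derivative:
  assumes "0 < \<tau>" "\<tau> \<le> T"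
  shows "((\<lambda>\<tau>. penalized \<epsilon> \<tau> x y) has_real_derivative
    (pt \<tau> x - pt \<tau> y) \<bullet> sgn (x - y) + rate * (\<epsilon> * exp (rate * \<tau>)) * weight x y) (at \<tau>)"
proof -
  have "((\<lambda>\<tau>. (p \<tau> x - p \<tau> y) \<bullet> sgn (x - y)) has_real_derivative (pt \<tau> x - pt \<tau> y) \<bullet> sgn (x - y))
      (at \<tau>)"
    unfolding has_real_derivative_iff_has_vector_derivative
    by (intro bounded_linear.has_vector_derivative[OF bounded_linear_inner_left]
        has_vector_derivative_diff p_has_time_derivative assms)
  then show ?thesis
    unfolding penalized_def excess_def by (auto intro!: derivative_eq_intros)
qed

lemma penalized_has_derivative_along_line:
  fixes x y a c s
  defines "u \<equiv> x + s *\<^sub>R a" and "v \<equiv> y + s *\<^sub>R c"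
  defines "e \<equiv> sgn (u - v)"
  assumes time_range: "0 < \<tau>" "\<tau> \<le> T" and "u \<noteq> v"
  shows "((\<lambda>s. penalized \<epsilon> \<tau> (x + s *\<^sub>R a) (y + s *\<^sub>R c)) has_real_derivative
    (Dp \<tau> u a - Dp \<tau> v c) \<bullet> e
    + (p \<tau> u - p \<tau> v) \<bullet> ((a - c) - ((a - c) \<bullet> e) *\<^sub>R e) / norm (u - v)
    + f' (norm (u - v)) * ((a - c) \<bullet> e)
    + \<epsilon> * exp (rate * \<tau>) * (2 * (u \<bullet> a) + 2 * (v \<bullet> c))) (at s)"
proof -
  have line: "(x - y) + s *\<^sub>R (a - c) = x + s *\<^sub>R a - (y + s *\<^sub>R c)" for s
    by (simp add: algebra_simps)
  have nonzero: "(x - y) + s *\<^sub>R (a - c) \<noteq> 0" using \<open>u \<noteq> v\<close> by (simp add: line u_def v_def)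
  have p_deriv: "((\<lambda>s. p \<tau> (x + s *\<^sub>R a) - p \<tau> (y + s *\<^sub>R c))
      has_vector_derivative Dp \<tau> u a - Dp \<tau> v c) (at s)"
    unfolding u_def v_def
    by (intro has_vector_derivative_diff has_vector_derivative_along_line p_has_derivative
      time_range)
  have sgn_deriv: "((\<lambda>s. sgn (x + s *\<^sub>R a - (y + s *\<^sub>R c))) has_vector_derivative
      ((a - c) - ((a - c) \<bullet> e) *\<^sub>R e) /\<^sub>R norm (u - v)) (at s)"
    using has_vector_derivative_along_line[OF has_derivative_sgn[OF nonzero]]
    unfolding line e_def u_def v_def .
  have "((\<lambda>s. norm ((x - y) + s *\<^sub>R (a - c))) has_vector_derivative (a - c) \<bullet> e) (at s)"
    using has_vector_derivative_along_line[OF has_derivative_norm[OF nonzero]]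
    unfolding line e_def u_def v_def .
  then have norm_deriv: "((\<lambda>s. norm (x + s *\<^sub>R a - (y + s *\<^sub>R c)))
      has_real_derivative (a - c) \<bullet> e) (at s)"
    unfolding line has_real_derivative_iff_has_vector_derivative .
  have "(f has_real_derivative f' (norm (u - v))) (at (norm (x + s *\<^sub>R a - (y + s *\<^sub>R c))))"
    unfolding u_def v_def by (rule f_deriv) (use \<open>u \<noteq> v\<close> in \<open>simp add: u_def v_def\<close>)
  note profile_deriv = DERIV_chain2[OF this norm_deriv]
  have weight_deriv: "((\<lambda>s. \<epsilon> * exp (rate * \<tau>) * weight (x + s *\<^sub>R a) (y + s *\<^sub>R c))
      has_real_derivative
      \<epsilon> * exp (rate * \<tau>) * (2 * (u \<bullet> a) + 2 * (v \<bullet> c))) (at s)"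
    unfolding weight_def has_field_derivative_def u_def v_def
    by (auto intro!: derivative_eq_intros simp: fun_eq_iff algebra_simps inner_commute)
  have "((\<lambda>s. (p \<tau> (x + s *\<^sub>R a) - p \<tau> (y + s *\<^sub>R c)) \<bullet> sgn (x + s *\<^sub>R a - (y + s *\<^sub>R c)))
      has_real_derivative
      (p \<tau> u - p \<tau> v) \<bullet> (((a - c) - ((a - c) \<bullet> e) *\<^sub>R e) /\<^sub>R norm (u - v))
        + (Dp \<tau> u a - Dp \<tau> v c) \<bullet> e) (at s)"
    using bounded_bilinear.has_vector_derivative[OF bounded_bilinear_inner p_deriv sgn_deriv]
    unfolding has_real_derivative_iff_has_vector_derivative by (simp add: u_def v_def e_def)
  from DERIV_add[OF DERIV_add[OF this profile_deriv] weight_deriv] show ?thesis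
    unfolding penalized_def excess_def
    by (rule DERIV_cong) (simp add: divide_inverse mult.commute)
qed

definition first_zero :: "real \<Rightarrow> real \<Rightarrow> 'a \<Rightarrow> 'a \<Rightarrow> bool" where
  "first_zero \<epsilon> \<tau> x y \<longleftrightarrow> 0 < \<tau> \<and> \<tau> \<le> T \<and> x \<noteq> y \<and> penalized \<epsilon> \<tau> x y = 0
    \<and> (\<forall>u v. u \<noteq> v \<longrightarrow> 0 \<le> penalized \<epsilon> \<tau> u v) \<and> (\<forall>s. 0 \<le> s \<longrightarrow> s < \<tau> \<longrightarrow> 0 < penalized \<epsilon> s x y)"

lemma first_zero_time_derivative:
  assumes "first_zero \<epsilon> \<tau> x y"
  shows "(pt \<tau> x - pt \<tau> y) \<bullet> sgn (x - y) + rate * (\<epsilon> * exp (rate * \<tau>)) * weight x y \<le> 0"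
proof (rule ccontr)
  assume "\<not> ?thesis"
  moreover have time_range: "0 < \<tau>" "\<tau> \<le> T" using assms by (auto simp: first_zero_def)
  ultimately obtain d
    where d_increasing: "0 < d" "\<And>h. 0 < h \<Longrightarrow> h < d \<Longrightarrow> penalized \<epsilon> (\<tau> - h) x y < penalized \<epsilon> \<tau> x y"
    using DERIV_pos_inc_left[OF penalized_has_time_derivative[OF time_range, of \<epsilon> x y]]
    by (metis not_le)
  define h where "h = min d \<tau> / 2"
  have h_bounds: "0 < h" "h < d" "h < \<tau>" using d_increasing(1) time_range by (auto simp: h_def)
  have "0 < penalized \<epsilon> (\<tau> - h) x y" using assms h_bounds by (simp add: first_zero_def)
  also have "\<dots> < penalized \<epsilon> \<tau> x y" by (rule d_increasing(2)[OF h_bounds(1,2)])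
  finally show False using assms by (simp add: first_zero_def)
qed

lemma penalized_local_min_along_line:
  assumes "first_zero \<epsilon> \<tau> x y" "x + s *\<^sub>R a \<noteq> y + s *\<^sub>R c"
  shows "penalized \<epsilon> \<tau> x y \<le> penalized \<epsilon> \<tau> (x + s *\<^sub>R a) (y + s *\<^sub>R c)"
  using assms by (simp add: first_zero_def)

text \<open>The drift of both points is \<open>-p\<close>.\<close>

lemma first_zero_drift:
  assumes zero: "first_zero \<epsilon> \<tau> x y"
  defines "e \<equiv> sgn (x - y)"
  shows "(Dp \<tau> x (p \<tau> x) - Dp \<tau> y (p \<tau> y)) \<bullet> e
    \<le> - f' (norm (x - y)) * ((p \<tau> x - p \<tau> y) \<bullet> e)
      - 2 * (\<epsilon> * exp (rate * \<tau>)) * (x \<bullet> p \<tau> x + y \<bullet> p \<tau> y)"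
proof -
  have time_range: "0 < \<tau>" "\<tau> \<le> T" and distinct: "x \<noteq> y" using zero by (auto simp: first_zero_def)
  define D where "D = p \<tau> x - p \<tau> y"
  have unit: "norm e = 1" using distinct by (simp add: e_def norm_sgn)
  have linear: "linear (Dp \<tau> z)" for z using p_has_derivative[OF time_range] has_derivative_linear
    by blast
  have "x + 0 *\<^sub>R - p \<tau> x \<noteq> y + 0 *\<^sub>R - p \<tau> y" using distinct by simp
  from penalized_has_derivative_along_line[OF time_range this, of \<epsilon>]
  have deriv: "((\<lambda>s. penalized \<epsilon> \<tau> (x + s *\<^sub>R - p \<tau> x) (y + s *\<^sub>R - p \<tau> y)) has_real_derivative
      - ((Dp \<tau> x (p \<tau> x) - Dp \<tau> y (p \<tau> y)) \<bullet> e) - (D \<bullet> D - (D \<bullet> e)\<^sup>2) / norm (x - y)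
      - f' (norm (x - y)) * (D \<bullet> e) - 2 * (\<epsilon> * exp (rate * \<tau>)) * (x \<bullet> p \<tau> x + y \<bullet> p \<tau> y)) (at 0)"
    by (rule DERIV_cong)
       (simp_all add: linear_neg[OF linear] flip: e_def,
        simp add: D_def inner_diff_left inner_diff_right inner_add_right power2_eq_square
          inner_commute
          algebra_simps add_divide_distrib diff_divide_distrib)
  define w where "w s = (x + s *\<^sub>R - p \<tau> x) - (y + s *\<^sub>R - p \<tau> y)" for s
  have "isCont w 0" unfolding w_def by (intro continuous_intros)
  moreover have "w 0 \<noteq> 0" using distinct by (simp add: w_def)
  ultimately obtain d where d_away: "0 < d" "\<And>s. \<bar>s\<bar> < d \<Longrightarrow> w s \<noteq> 0"
    using continuous_at_avoid[of 0 w 0] by (auto simp: dist_real_def)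
  have "- ((Dp \<tau> x (p \<tau> x) - Dp \<tau> y (p \<tau> y)) \<bullet> e) - (D \<bullet> D - (D \<bullet> e)\<^sup>2) / norm (x - y)
      - f' (norm (x - y)) * (D \<bullet> e) - 2 * (\<epsilon> * exp (rate * \<tau>)) * (x \<bullet> p \<tau> x + y \<bullet> p \<tau> y) = 0"
  proof (rule DERIV_local_min[OF deriv d_away(1)], intro allI impI)
    fix s :: real assume "\<bar>0 - s\<bar> < d"
    then have "x + s *\<^sub>R - p \<tau> x \<noteq> y + s *\<^sub>R - p \<tau> y" using d_away(2)[of s] by (auto simp: w_def)
    from penalized_local_min_along_line[OF zero this]
    show "penalized \<epsilon> \<tau> (x + 0 *\<^sub>R - p \<tau> x) (y + 0 *\<^sub>R - p \<tau> y)
        \<le> penalized \<epsilon> \<tau> (x + s *\<^sub>R - p \<tau> x) (y + s *\<^sub>R - p \<tau> y)" by simp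
  qed
  moreover have "0 \<le> (D \<bullet> D - (D \<bullet> e)\<^sup>2) / norm (x - y)"
    using Cauchy_Schwarz_ineq[of D e] unit by (simp add: dot_square_norm)
  ultimately show ?thesis unfolding D_def by linarith
qed

text \<open>Moving \<open>x\<close> along \<open>b\<close> and \<open>y\<close> along \<open>c\<close> keeps the direction of \<open>x - y\<close> when \<open>b - c\<close> is a multiple
  of it.\<close>

definition parallel_slope :: "real \<Rightarrow> real \<Rightarrow> 'a \<Rightarrow> 'a \<Rightarrow> 'a \<Rightarrow> 'a \<Rightarrow> real \<Rightarrow> real \<Rightarrow> real" where
  "parallel_slope \<epsilon> \<tau> x y b c k s =
     (Dp \<tau> (x + s *\<^sub>R b) b - Dp \<tau> (y + s *\<^sub>R c) c) \<bullet> sgn (x - y) + f' (norm (x - y) + s * k) * k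
     + \<epsilon> * exp (rate * \<tau>) * (2 * ((x + s *\<^sub>R b) \<bullet> b) + 2 * ((y + s *\<^sub>R c) \<bullet> c))"

lemma parallel_displacement:
  fixes x y b c :: 'a
  assumes parallel: "b - c = k *\<^sub>R sgn (x - y)" and "x \<noteq> y" and pos: "0 < norm (x - y) + s * k"
  shows "sgn (x + s *\<^sub>R b - (y + s *\<^sub>R c)) = sgn (x - y)"
    and "norm (x + s *\<^sub>R b - (y + s *\<^sub>R c)) = norm (x - y) + s * k"
proof -
  have unit: "norm (sgn (x - y)) = 1" using \<open>x \<noteq> y\<close> by (simp add: norm_sgn)
  have "x + s *\<^sub>R b - (y + s *\<^sub>R c) = (x - y) + s *\<^sub>R (b - c)" by (simp add: algebra_simps)
  also have "\<dots> = norm (x - y) *\<^sub>R sgn (x - y) + (s * k) *\<^sub>R sgn (x - y)"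
    unfolding parallel using \<open>x \<noteq> y\<close> by (simp add: sgn_div_norm)
  finally have line: "x + s *\<^sub>R b - (y + s *\<^sub>R c) = (norm (x - y) + s * k) *\<^sub>R sgn (x - y)"
    by (simp only: scaleR_left_distrib)
  show "sgn (x + s *\<^sub>R b - (y + s *\<^sub>R c)) = sgn (x - y)"
    unfolding line using pos unit by (simp add: sgn_scaleR sgn_div_norm[of "sgn (x - y)"])
  show "norm (x + s *\<^sub>R b - (y + s *\<^sub>R c)) = norm (x - y) + s * k"
    unfolding line using pos unit by simp
qed

lemma penalized_has_derivative_parallel:
  assumes time_range: "0 < \<tau>" "\<tau> \<le> T" and parallel: "b - c = k *\<^sub>R sgn (x - y)"
    and "x \<noteq> y" and pos: "0 < norm (x - y) + s * k"
  shows "((\<lambda>s. penalized \<epsilon> \<tau> (x + s *\<^sub>R b) (y + s *\<^sub>R c)) has_real_derivative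
    parallel_slope \<epsilon> \<tau> x y b c k s) (at s)"
proof -
  note displacement = parallel_displacement[OF parallel \<open>x \<noteq> y\<close> pos]
  have unit: "sgn (x - y) \<bullet> sgn (x - y) = 1" using \<open>x \<noteq> y\<close> by (simp add: dot_square_norm norm_sgn)
  have "x + s *\<^sub>R b \<noteq> y + s *\<^sub>R c" using displacement(2) pos by auto
  from penalized_has_derivative_along_line[OF time_range this, of \<epsilon>] show ?thesis
    unfolding displacement parallel
    by (rule DERIV_cong) (simp add: parallel_slope_def unit)
qed

lemma parallel_slope_has_derivative:
  assumes time_range: "0 < \<tau>" "\<tau> \<le> T" and "x \<noteq> y"
  shows "(parallel_slope \<epsilon> \<tau> x y b c k has_real_derivative
    (D2p \<tau> x b b - D2p \<tau> y c c) \<bullet> sgn (x - y) + k\<^sup>2 * f'' (norm (x - y))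
    + 2 * (\<epsilon> * exp (rate * \<tau>)) * (b \<bullet> b + c \<bullet> c)) (at 0)"
proof -
  have "((\<lambda>s. (Dp \<tau> (x + s *\<^sub>R b) b - Dp \<tau> (y + s *\<^sub>R c) c) \<bullet> sgn (x - y)) has_real_derivative
      (D2p \<tau> x b b - D2p \<tau> y c c) \<bullet> sgn (x - y)) (at 0)"
    unfolding has_real_derivative_iff_has_vector_derivative
    by (intro bounded_linear.has_vector_derivative[OF bounded_linear_inner_left]
        has_vector_derivative_diff has_vector_derivative_along_line)
       (simp_all add: Dp_has_derivative time_range)
  moreover have "((\<lambda>s. f' (norm (x - y) + s * k)) has_real_derivative f'' (norm (x - y)) * k)
      (at 0)"
    by (rule DERIV_chain2[of f' "f'' (norm (x - y))"])
       (use \<open>x \<noteq> y\<close> in \<open>auto intro!: derivative_eq_intros f'_deriv\<close>)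
  moreover have "((\<lambda>s. \<epsilon> * exp (rate * \<tau>) * (2 * ((x + s *\<^sub>R b) \<bullet> b) + 2 * ((y + s *\<^sub>R c) \<bullet> c)))
      has_real_derivative
      2 * (\<epsilon> * exp (rate * \<tau>)) * (b \<bullet> b + c \<bullet> c)) (at 0)"
    unfolding has_field_derivative_def
    by (auto intro!: derivative_eq_intros simp: fun_eq_iff algebra_simps)
  ultimately show ?thesis
    unfolding parallel_slope_def[abs_def]
    by (intro DERIV_add) (auto intro!: derivative_eq_intros simp: power2_eq_square)
qed

lemma first_zero_second_order:
  assumes zero: "first_zero \<epsilon> \<tau> x y" and parallel: "b - c = k *\<^sub>R sgn (x - y)"
  shows "0 \<le> (D2p \<tau> x b b - D2p \<tau> y c c) \<bullet> sgn (x - y) + k\<^sup>2 * f'' (norm (x - y))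
    + 2 * (\<epsilon> * exp (rate * \<tau>)) * (b \<bullet> b + c \<bullet> c)"
proof -
  have time_range: "0 < \<tau>" "\<tau> \<le> T" and distinct: "x \<noteq> y" using zero by (auto simp: first_zero_def)
  define d where "d = norm (x - y) / (\<bar>k\<bar> + 1)"
  have d_pos: "0 < d" using distinct by (simp add: d_def)
  have pos: "0 < norm (x - y) + s * k" if "\<bar>s\<bar> < d" for s
  proof -
    have "\<bar>s * k\<bar> \<le> \<bar>s\<bar> * (\<bar>k\<bar> + 1)" by (simp add: abs_mult mult_left_mono)
    also have "\<dots> < norm (x - y)" using that by (simp add: d_def pos_less_divide_eq)
    finally show ?thesis by linarith
  qed
  show ?thesis
  proof (rule second_derivative_nonneg_at_local_min[OF d_pos _
      parallel_slope_has_derivative[OF time_range distinct]])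
    fix s assume s_small: "\<bar>s\<bar> < d"
    show "((\<lambda>s. penalized \<epsilon> \<tau> (x + s *\<^sub>R b) (y + s *\<^sub>R c)) has_real_derivative
        parallel_slope \<epsilon> \<tau> x y b c k s) (at s)"
      by (rule penalized_has_derivative_parallel[OF time_range parallel distinct pos[OF s_small]])
    have "x + s *\<^sub>R b \<noteq> y + s *\<^sub>R c"
      using parallel_displacement(2)[OF parallel distinct pos[OF s_small]] pos[OF s_small] by auto
    from penalized_local_min_along_line[OF zero this]
    show "penalized \<epsilon> \<tau> (x + 0 *\<^sub>R b) (y + 0 *\<^sub>R c) \<le> penalized \<epsilon> \<tau> (x + s *\<^sub>R b) (y + s *\<^sub>R c)"
      by simp
  qed
qed

lemma D2p_minus:
  assumes time_range: "0 < \<tau>" "\<tau> \<le> T"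
  shows "D2p \<tau> x (- a) (- b) = D2p \<tau> x a b"
proof -
  have "Dp \<tau> x (- a) = - Dp \<tau> x a" for x
    using has_derivative_linear[OF p_has_derivative[OF time_range, of x]] by (rule linear_neg)
  then have "((\<lambda>x. - Dp \<tau> x a) has_derivative D2p \<tau> x (- a)) (at x)"
    using Dp_has_derivative[OF time_range, of "- a" x] by simp
  then have "D2p \<tau> x (- a) = (\<lambda>h. - D2p \<tau> x a h)"
    by (rule has_derivative_unique) (rule has_derivative_minus[OF Dp_has_derivative[OF time_range]])
  then show ?thesis
    using linear_neg[OF has_derivative_linear[OF Dp_has_derivative[OF time_range]], of x a b]
    by simp
qed

text \<open>Translating both points in the directions orthogonal to \<open>x - y\<close> and reflecting them in the
  direction \<open>x - y\<close> leaves only \<open>4f''\<close> from the distance.\<close>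

lemma first_zero_laplacian:
  assumes zero: "first_zero \<epsilon> \<tau> x y" and basis: "orthonormal_basis S" "sgn (x - y) \<in> S"
  shows "0 \<le> ((\<Sum>b\<in>S. D2p \<tau> x b b) - (\<Sum>b\<in>S. D2p \<tau> y b b)) \<bullet> sgn (x - y)
    + 4 * f'' (norm (x - y)) + 4 * real DIM('a) * (\<epsilon> * exp (rate * \<tau>))"
proof -
  define e where "e = sgn (x - y)"
  define E where "E = \<epsilon> * exp (rate * \<tau>)"
  have time_range: "0 < \<tau>" "\<tau> \<le> T" using zero by (auto simp: first_zero_def)
  have unit: "b \<bullet> b = 1" if "b \<in> S" for b
    using basis(1) that by (auto simp: orthonormal_basis_def dot_square_norm)
  have "0 \<le> (D2p \<tau> x b b - D2p \<tau> y b b) \<bullet> e + (if b = e then 4 * f'' (norm (x - y)) else 0) + 4 * E"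
    if b_in_S: "b \<in> S" for b
  proof (cases "b = e")
    case True
    have "e - (- e) = 2 *\<^sub>R e" by (simp add: scaleR_2)
    then show ?thesis
      using first_zero_second_order[OF zero, of e "- e" 2] D2p_minus[OF time_range, of y e e]
        unit[OF b_in_S] True
      by (simp add: E_def flip: e_def)
  next
    case False
    then show ?thesis
      using first_zero_second_order[OF zero, of b b 0] unit[OF b_in_S]
      by (simp add: E_def flip: e_def)
  qed
  then have "0 \<le> (\<Sum>b\<in>S. (D2p \<tau> x b b - D2p \<tau> y b b) \<bullet> e
      + (if b = e then 4 * f'' (norm (x - y)) else 0) + 4 * E)"
    by (rule sum_nonneg)
  also have "\<dots> = ((\<Sum>b\<in>S. D2p \<tau> x b b) - (\<Sum>b\<in>S. D2p \<tau> y b b)) \<bullet> e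
      + 4 * f'' (norm (x - y)) + 4 * real DIM('a) * E"
    using basis(2) orthonormal_basis_finite_card[OF basis(1)]
    by (simp add: sum.distrib inner_sum_left sum_subtractf inner_diff_left flip: e_def)
  finally show ?thesis unfolding e_def E_def .
qed

lemma drift_le_weight: "- (x \<bullet> p \<tau> x + y \<bullet> p \<tau> y) \<le> 2 * C * weight x y" if time_range: "\<tau> \<in> {0..T}"
proof -
  have "- (z \<bullet> p \<tau> z) \<le> C * (1 + 2 * (z \<bullet> z))" for z
  proof -
    have "- (z \<bullet> p \<tau> z) \<le> norm z * norm (p \<tau> z)"
      using Cauchy_Schwarz_ineq2[of z "p \<tau> z"] by linarith
    also have "\<dots> \<le> norm z * (C * (1 + norm z))" by (intro mult_left_mono p_growth time_range) auto
    also have "\<dots> = C * (norm z + z \<bullet> z)"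
      by (simp add: dot_square_norm power2_eq_square algebra_simps)
    also have "\<dots> \<le> C * (1 + 2 * (z \<bullet> z))"
    proof (intro mult_left_mono C_nonneg)
      have "0 \<le> (norm z - 1)\<^sup>2 + (norm z)\<^sup>2 + 1" by simp
      then show "norm z + z \<bullet> z \<le> 1 + 2 * (z \<bullet> z)" by (simp add: dot_square_norm power2_diff)
    qed
    finally show ?thesis .
  qed
  from this[of x] this[of y] show ?thesis by (simp add: weight_def algebra_simps)
qed

lemma no_first_zero:
  assumes "0 < \<epsilon>"
  shows "\<not> first_zero \<epsilon> \<tau> x y"
proof
  assume zero: "first_zero \<epsilon> \<tau> x y"
  then have time_range: "0 < \<tau>" "\<tau> \<le> T" and distance_pos: "0 < norm (x - y)"
    by (auto simp: first_zero_def)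
  define e where "e = sgn (x - y)"
  define E where "E = \<epsilon> * exp (rate * \<tau>)"
  define f'r where "f'r = f' (norm (x - y))"
  define drift where "drift = (Dp \<tau> x (p \<tau> x) - Dp \<tau> y (p \<tau> y)) \<bullet> e"
  have E_pos: "0 < E" using assms by (simp add: E_def)
  obtain S where basis: "orthonormal_basis S" "e \<in> S"
    using orthonormal_basis_containing[of e] distance_pos by (auto simp: e_def norm_sgn)
  define laplacian where "laplacian = ((\<Sum>b\<in>S. D2p \<tau> x b b) - (\<Sum>b\<in>S. D2p \<tau> y b b)) \<bullet> e"
  have "(pt \<tau> x - pt \<tau> y) \<bullet> e = laplacian / 2 - drift"
    unfolding burgers[OF time_range basis(1)] laplacian_def drift_def by (simp add: inner_diff_left)
  then have time: "laplacian / 2 - drift + rate * E * weight x y \<le> 0"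
    using first_zero_time_derivative[OF zero] by (simp add: E_def flip: e_def)
  have second: "0 \<le> laplacian + 4 * f'' (norm (x - y)) + 4 * real DIM('a) * E"
    using first_zero_laplacian[OF zero basis(1)] basis(2)
    by (simp add: laplacian_def E_def flip: e_def)
  have first: "drift \<le> - f'r * ((p \<tau> x - p \<tau> y) \<bullet> e) - 2 * E * (x \<bullet> p \<tau> x + y \<bullet> p \<tau> y)"
    using first_zero_drift[OF zero] by (simp add: drift_def E_def f'r_def flip: e_def)
  have contact: "(p \<tau> x - p \<tau> y) \<bullet> e = - f (norm (x - y)) - E * weight x y"
    using zero by (simp add: first_zero_def penalized_def excess_def E_def flip: e_def)
  have "rate * E * weight x y
      \<le> 2 * f'' (norm (x - y)) + f (norm (x - y)) * f'r + f'r * (E * weight x y)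
      + 2 * real DIM('a) * E - 2 * E * (x \<bullet> p \<tau> x + y \<bullet> p \<tau> y)"
    using time second first unfolding contact by (simp add: algebra_simps)
  moreover have "f'r * (E * weight x y) \<le> \<Lambda> * (E * weight x y)"
    unfolding f'r_def using f'_le[OF distance_pos] E_pos weight_ge_1[of x y]
    by (intro mult_right_mono) auto
  moreover have "2 * E * - (x \<bullet> p \<tau> x + y \<bullet> p \<tau> y) \<le> 2 * E * (2 * C * weight x y)"
    using E_pos time_range by (intro mult_left_mono drift_le_weight) auto
  moreover have "2 * real DIM('a) * E * 1 \<le> 2 * real DIM('a) * E * weight x y"
    using E_pos by (intro mult_left_mono weight_ge_1) auto
  moreover have "rate * E * weight x y
      = 2 * real DIM('a) * E * weight x y + \<Lambda> * (E * weight x y)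
        + 2 * E * (2 * C * weight x y) + E * weight x y"
    by (simp add: rate_def algebra_simps)
  moreover have "0 < E * weight x y" using E_pos weight_ge_1[of x y] by simp
  ultimately show False using f_ode[OF distance_pos] unfolding f'r_def[symmetric] by linarith
qed

lemma penalized_nonpos_bounds:
  assumes \<epsilon>_pos: "0 < \<epsilon>" and time_range: "\<tau> \<in> {0..T}" and "penalized \<epsilon> \<tau> x y \<le> 0"
  shows "\<epsilon> \<le> norm (p \<tau> x - p \<tau> y)" and "norm x \<le> 4 * C / \<epsilon>" and "norm y \<le> 4 * C / \<epsilon>"
proof -
  define s where "s = sqrt (weight x y)"
  have s_bounds: "1 \<le> s" "s * s = weight x y" using weight_ge_1[of x y] by (auto simp: s_def)
  have norm_x_le: "norm x \<le> s" and norm_y_le: "norm y \<le> s"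
    unfolding s_def weight_def by (auto intro!: real_le_rsqrt simp: power2_norm_eq_inner)
  have "- norm (p \<tau> x - p \<tau> y) \<le> (p \<tau> x - p \<tau> y) \<bullet> sgn (x - y)"
    using Cauchy_Schwarz_ineq2[of "p \<tau> x - p \<tau> y" "sgn (x - y)"]
    by (cases "x = y") (auto simp: norm_sgn)
  moreover have "\<epsilon> * 1 * weight x y \<le> \<epsilon> * exp (rate * \<tau>) * weight x y"
    using \<epsilon>_pos time_range rate_pos weight_ge_1[of x y]
    by (intro mult_right_mono mult_left_mono) auto
  ultimately have weight_le: "\<epsilon> * weight x y \<le> norm (p \<tau> x - p \<tau> y)"
    using assms(3) f_nonneg[of "norm (x - y)"] unfolding penalized_def excess_def by simp
  moreover have "\<epsilon> * 1 \<le> \<epsilon> * weight x y" using \<epsilon>_pos by (intro mult_left_mono weight_ge_1) auto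
  ultimately show "\<epsilon> \<le> norm (p \<tau> x - p \<tau> y)" by linarith
  have "\<epsilon> * (s * s) \<le> C * (1 + norm x) + C * (1 + norm y)"
    using weight_le norm_triangle_ineq4[of "p \<tau> x" "p \<tau> y"] p_growth[OF time_range, of x]
      p_growth[OF time_range, of y] s_bounds(2)
    by simp
  also have "\<dots> \<le> C * (4 * s)"
    unfolding distrib_left[symmetric] using norm_x_le norm_y_le s_bounds(1)
    by (intro mult_left_mono C_nonneg) auto
  finally have "(\<epsilon> * s) * s \<le> (4 * C) * s" by (simp add: mult_ac)
  then have "\<epsilon> * s \<le> 4 * C" by (rule mult_right_le_imp_le) (use s_bounds(1) in simp)
  then have "s \<le> 4 * C / \<epsilon>" using \<epsilon>_pos by (simp add: pos_le_divide_eq mult.commute)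
  then show "norm x \<le> 4 * C / \<epsilon>" "norm y \<le> 4 * C / \<epsilon>" using norm_x_le norm_y_le by linarith+
qed

lemma continuous_on_p: "continuous_on ({0..T} \<times> UNIV) (\<lambda>(\<tau>, x). p \<tau> x)"
proof (rule continuous_on_TimesI)
  show "local_lipschitz {0..T} UNIV p"
    unfolding local_lipschitz_def
  proof (intro ballI)
    fix x :: 'a and t assume "t \<in> {0..T}"
    obtain K where K_lipschitz: "\<And>\<tau>. \<tau> \<in> {0..T} \<Longrightarrow> K-lipschitz_on (cball 0 (norm x + 1)) (p \<tau>)"
      using p_lipschitz[of "norm x + 1"] by blast
    have "cball x 1 \<subseteq> cball 0 (norm x + 1)" by (simp add: cball_subset_cball_iff)
    then have "K-lipschitz_on (cball x 1 \<inter> UNIV) (p \<tau>)" if "\<tau> \<in> {0..T}" for \<tau>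
      using lipschitz_on_subset[OF K_lipschitz[OF that]] by auto
    then show "\<exists>u>0. \<exists>K. \<forall>t\<in>cball t u \<inter> {0..T}. K-lipschitz_on (cball x u \<inter> UNIV) (p t)"
      by (intro exI[of _ 1] conjI exI[of _ K]) auto
  qed
qed (rule p_continuous_time)

lemma continuous_on_penalized:
  assumes "Q \<subseteq> {0..T} \<times> UNIV \<times> UNIV" "\<And>\<tau> x y. (\<tau>, x, y) \<in> Q \<Longrightarrow> x \<noteq> y"
  shows "continuous_on Q (\<lambda>k. penalized \<epsilon> (fst k) (fst (snd k)) (snd (snd k)))"
proof -
  have p_fst_continuous: "continuous_on Q (\<lambda>k. p (fst k) (fst (snd k)))"
    by (rule continuous_on_compose2[OF continuous_on_p,
      of _ "\<lambda>k. (fst k, fst (snd k))", simplified])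
       (use assms in \<open>auto intro!: continuous_intros\<close>)
  have p_snd_continuous: "continuous_on Q (\<lambda>k. p (fst k) (snd (snd k)))"
    by (rule continuous_on_compose2[OF continuous_on_p,
      of _ "\<lambda>k. (fst k, snd (snd k))", simplified])
       (use assms in \<open>auto intro!: continuous_intros\<close>)
  have "continuous_on Q (\<lambda>k. f (norm (fst (snd k) - snd (snd k))))"
    by (rule continuous_on_compose2[OF f_continuous]) (auto intro!: continuous_intros)
  then show ?thesis
    unfolding penalized_def excess_def weight_def
    using assms(2)
    by (intro continuous_intros p_fst_continuous p_snd_continuous continuous_on_sgn) auto
qed

lemma penalized_nonpos_compact:
  assumes \<epsilon>_pos: "0 < \<epsilon>"
  obtains Q where "compact Q" "\<And>\<tau> x y. (\<tau>, x, y) \<in> Q \<Longrightarrow> \<tau> \<in> {0..T} \<and> x \<noteq> y"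
    "\<And>\<tau> x y. \<tau> \<in> {0..T} \<Longrightarrow> x \<noteq> y \<Longrightarrow> penalized \<epsilon> \<tau> x y \<le> 0 \<Longrightarrow> (\<tau>, x, y) \<in> Q"
proof -
  define R where "R = 4 * C / \<epsilon>"
  obtain K where K_lipschitz: "\<And>\<tau>. \<tau> \<in> {0..T} \<Longrightarrow> K-lipschitz_on (cball 0 R) (p \<tau>)"
    using p_lipschitz[of R] by blast
  have "0 \<le> K" using lipschitz_on_nonneg[OF K_lipschitz[of 0]] T_pos by simp
  define \<delta> where "\<delta> = \<epsilon> / (K + 1)"
  have \<delta>_pos: "0 < \<delta>" using \<epsilon>_pos \<open>0 \<le> K\<close> by (simp add: \<delta>_def)
  define Q where
    "Q = {0..T} \<times> cball (0::'a) R \<times> cball (0::'a) R \<inter> {k. \<delta> \<le> norm (fst (snd k) - snd (snd k))}"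
  show ?thesis
  proof
    show "compact Q" unfolding Q_def
      by (intro compact_Int_closed compact_Times compact_cball compact_Icc closed_Collect_le
        continuous_intros)
    show "\<tau> \<in> {0..T} \<and> x \<noteq> y" if "(\<tau>, x, y) \<in> Q" for \<tau> x y using that \<delta>_pos by (auto simp: Q_def)
    fix \<tau> x y assume time_range: "\<tau> \<in> {0..T}" and "penalized \<epsilon> \<tau> x y \<le> 0"
    note bounds = penalized_nonpos_bounds[OF \<epsilon>_pos this, folded R_def]
    have "\<epsilon> \<le> K * norm (x - y)"
      using bounds lipschitz_onD[OF K_lipschitz[OF time_range], of x y] by (simp add: dist_norm)
    also have "\<dots> \<le> (K + 1) * norm (x - y)" by (intro mult_right_mono) auto
    finally have "\<delta> \<le> norm (x - y)"
      unfolding \<delta>_def using \<open>0 \<le> K\<close> by (simp add: pos_divide_le_eq mult.commute)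
    then show "(\<tau>, x, y) \<in> Q" using time_range bounds by (simp add: Q_def)
  qed
qed

lemma first_nonpos_time_exists:
  assumes \<epsilon>_pos: "0 < \<epsilon>" and "\<tau> \<in> {0..T}" "x \<noteq> y" "penalized \<epsilon> \<tau> x y \<le> 0"
  obtains t u v where "t \<in> {0..T}" "u \<noteq> v" "penalized \<epsilon> t u v \<le> 0"
    "\<And>s a b. 0 \<le> s \<Longrightarrow> s < t \<Longrightarrow> a \<noteq> b \<Longrightarrow> 0 < penalized \<epsilon> s a b"
proof -
  obtain Q where Q_props: "compact Q" "\<And>\<tau> x y. (\<tau>, x, y) \<in> Q \<Longrightarrow> \<tau> \<in> {0..T} \<and> x \<noteq> y"
    "\<And>\<tau> x y. \<tau> \<in> {0..T} \<Longrightarrow> x \<noteq> y \<Longrightarrow> penalized \<epsilon> \<tau> x y \<le> 0 \<Longrightarrow> (\<tau>, x, y) \<in> Q"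
    using penalized_nonpos_compact[OF \<epsilon>_pos] by blast
  define A where "A = {k \<in> Q. penalized \<epsilon> (fst k) (fst (snd k)) (snd (snd k)) \<le> 0}"
  have "continuous_on Q (\<lambda>k. penalized \<epsilon> (fst k) (fst (snd k)) (snd (snd k)))"
    by (rule continuous_on_penalized) (use Q_props(2) in auto)
  from continuous_closedin_preimage[OF this closed_atMost[of 0]]
  have "closedin (top_of_set Q) A" unfolding A_def vimage_def Int_def by simp
  then have "compact A" using Q_props(1) closedin_compact by blast
  moreover have "(\<tau>, x, y) \<in> A" using Q_props(3) assms by (simp add: A_def)
  ultimately obtain k where k_earliest: "k \<in> A" "\<And>k'. k' \<in> A \<Longrightarrow> fst k \<le> fst k'"
    using continuous_attains_inf[of A fst] continuous_on_fst[OF continuous_on_id] by blast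
  obtain t u v where k_eq: "k = (t, u, v)" by (cases k) auto
  have t_props: "t \<in> {0..T}" "u \<noteq> v" "penalized \<epsilon> t u v \<le> 0"
    using k_earliest(1) Q_props(2)[of t u v] by (auto simp: A_def k_eq)
  moreover have "0 < penalized \<epsilon> s a b" if "0 \<le> s" "s < t" "a \<noteq> b" for s a b
  proof (rule ccontr)
    assume "\<not> ?thesis"
    then have "(s, a, b) \<in> A" using Q_props(3)[of s a b] that t_props(1) by (simp add: A_def)
    then show False using k_earliest(2)[of "(s, a, b)"] that(2) by (simp add: k_eq)
  qed
  ultimately show ?thesis using that by blast
qed

lemma penalized_initial_pos:
  assumes "0 < \<epsilon>" "x \<noteq> y"
  shows "0 < penalized \<epsilon> 0 x y"
proof -
  have "0 \<le> excess 0 x y"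
    unfolding excess_nonneg_iff[OF assms(2)] by (rule semimonotoneD[OF semimonotone_initial])
  moreover have "0 < \<epsilon> * exp (rate * 0) * weight x y" using assms weight_ge_1[of x y] by simp
  ultimately show ?thesis unfolding penalized_def by linarith
qed

lemma penalized_pos:
  assumes \<epsilon>_pos: "0 < \<epsilon>" and time_range: "\<tau> \<in> {0..T}" and "x \<noteq> y"
  shows "0 < penalized \<epsilon> \<tau> x y"
proof (rule ccontr)
  assume "\<not> ?thesis"
  then obtain t u v where t_props: "t \<in> {0..T}" and distinct: "u \<noteq> v"
    and nonpos: "penalized \<epsilon> t u v \<le> 0"
    and before: "\<And>s a b. 0 \<le> s \<Longrightarrow> s < t \<Longrightarrow> a \<noteq> b \<Longrightarrow> 0 < penalized \<epsilon> s a b"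
    using first_nonpos_time_exists[OF assms] by (metis not_less)
  have "t \<noteq> 0" using penalized_initial_pos[OF \<epsilon>_pos distinct] nonpos by auto
  then have t_range: "0 < t" "t \<le> T" using t_props by auto
  have "0 \<le> penalized \<epsilon> t a b" if "a \<noteq> b" for a b
  proof (rule tendsto_lowerbound)
    show "((\<lambda>s. penalized \<epsilon> s a b) \<longlongrightarrow> penalized \<epsilon> t a b) (at_left t)"
      using DERIV_isCont[OF penalized_has_time_derivative[OF t_range]]
      by (simp add: isCont_def filterlim_at_split)
    show "\<forall>\<^sub>F s in at_left t. 0 \<le> penalized \<epsilon> s a b"
      unfolding eventually_at_left_field using before that t_range
      by (intro exI[of _ 0]) (auto intro: less_imp_le)
  qed simp
  then have "first_zero \<epsilon> t u v"
    using t_range distinct nonpos before by (auto simp: first_zero_def intro: antisym)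
  then show False using no_first_zero[OF \<epsilon>_pos] by blast
qed

theorem semimonotone_preserved: "semimonotone f (p T)"
  unfolding semimonotone_def
proof (intro allI)
  fix x y :: 'a
  show "- (norm (x - y) * f (norm (x - y))) \<le> (p T x - p T y) \<bullet> (x - y)"
  proof (cases "x = y")
    case False
    define V where "V = exp (rate * T) * weight x y"
    have V_pos: "0 < V" unfolding V_def using weight_ge_1[of x y] by simp
    have "0 \<le> excess T x y"
    proof (rule field_le_epsilon)
      fix \<eta> :: real assume "0 < \<eta>"
      then have "0 < penalized (\<eta> / V) T x y" using V_pos T_pos False by (intro penalized_pos) auto
      then show "0 \<le> excess T x y + \<eta>" unfolding penalized_def mult.assoc V_def[symmetric]
        using V_pos by simp
    qed
    then show ?thesis unfolding excess_nonneg_iff[OF False] .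
  qed simp
qed

end

section \<open>Semimonotone potentials\<close>

locale semimonotone_potential = coupling_profile f f' f'' \<Lambda> \<beta>
  for f f' f'' :: "real \<Rightarrow> real" and \<Lambda> \<beta> +
  fixes g :: "'a::euclidean_space \<Rightarrow> real" and G :: "'a \<Rightarrow> 'a"
  assumes gradient: "\<And>x. GDERIV g x :> G x" and semimonotone: "semimonotone f G"
begin

lemma potential_lower_bound: "g x - (norm (G x) + \<beta>) * norm (y - x) \<le> g y"
proof -
  have "((\<lambda>s. g (x + s *\<^sub>R (y - x))) has_real_derivative (y - x) \<bullet> G (x + s *\<^sub>R (y - x))) (at s)"
    for s
    using has_vector_derivative_along_line[OF gradient[unfolded gderiv_def]]
    by (simp add: has_real_derivative_iff_has_vector_derivative)
  then obtain s where s_mean_value: "0 < s" "g y - g x = (y - x) \<bullet> G (x + s *\<^sub>R (y - x))"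
    using MVT2[of 0 1 "\<lambda>s. g (x + s *\<^sub>R (y - x))" "\<lambda>s. (y - x) \<bullet> G (x + s *\<^sub>R (y - x))"] by auto
  have "s * - ((norm (G x) + \<beta>) * norm (y - x)) \<le> s * (g y - g x)"
    using semimonotone_lower_bound[OF semimonotone, of x "x + s *\<^sub>R (y - x)"] s_mean_value
    by (simp add: inner_commute mult.left_commute)
  then have "- ((norm (G x) + \<beta>) * norm (y - x)) \<le> g y - g x"
    using s_mean_value(1) by (simp only: mult_le_cancel_left_pos)
  then show ?thesis by linarith
qed

lemma exp_potential_g: "exp_potential g"
proof (rule exp_potentialI)
  show "continuous_on UNIV g" by (rule gderiv_continuous[OF gradient])
  show "g 0 - (norm (G 0) + \<beta>) * norm y \<le> g y" for y
    using potential_lower_bound[of 0 y] by simp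
qed

sublocale exp_potential g by (rule exp_potential_g)

end

lemma le_add_of_square_le:
  fixes s a b :: real
  assumes "s\<^sup>2 \<le> a\<^sup>2 + b * s" "0 \<le> a" "0 \<le> b"
  shows "s \<le> a + b"
proof (rule ccontr)
  assume "\<not> s \<le> a + b"
  then have "a + b < s" "0 < s" using assms by linarith+
  then have "(a + b) * s < s * s" by simp
  moreover have "a * a \<le> a * s" using \<open>a + b < s\<close> assms by (intro mult_left_mono) auto
  ultimately show False using assms(1) by (simp add: power2_eq_square algebra_simps)
qed

locale lipschitz_potential = semimonotone_potential f f' f'' \<Lambda> \<beta> g G
  for f f' f'' :: "real \<Rightarrow> real" and \<Lambda> \<beta> and g :: "'a::euclidean_space \<Rightarrow> real" and G :: "'a \<Rightarrow> 'a" +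
  fixes K :: real
  assumes G_lipschitz: "K-lipschitz_on UNIV G"
begin

lemma K_nonneg: "0 \<le> K"
  by (rule lipschitz_on_nonneg[OF G_lipschitz])

lemma norm_G_diff_le: "norm (G x - G y) \<le> K * norm (x - y)"
  using lipschitz_onD[OF G_lipschitz, of x y] by (simp add: dist_norm)

lemma norm_G_le: "norm (G x) \<le> norm (G 0) + K * norm x"
  using norm_G_diff_le[of x 0] norm_triangle_sub[of "G x" "G 0"] by simp

lemma exp_growth_G: "exp_growth G"
  using lipschitz_on_continuous_on[OF G_lipschitz] K_nonneg norm_G_le
  by (intro exp_growth_linear borel_measurable_continuous_onI)

text \<open>\<open>\<surd>\<tau> * width \<tau> x\<close> bounds the root mean square distance to \<open>x\<close> under the Gibbs measure.\<close>

definition width :: "real \<Rightarrow> 'a \<Rightarrow> real" where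
  "width \<tau> x = sqrt (real DIM('a)) + sqrt \<tau> * (norm (G x) + \<beta>)"

lemma width_nonneg: "0 \<le> \<tau> \<Longrightarrow> 0 \<le> width \<tau> x"
  using \<beta>_nonneg by (simp add: width_def)

lemma width_le:
  assumes "0 \<le> \<tau>" "\<tau> \<le> T" "norm x \<le> R"
  shows "width \<tau> x \<le> sqrt (real DIM('a)) + sqrt T * (norm (G 0) + K * R + \<beta>)"
  unfolding width_def using assms norm_G_le[of x] mult_left_mono[OF assms(3) K_nonneg] \<beta>_nonneg
  by (intro add_left_mono mult_mono) auto

lemma gibbs_mean_dist_le_sqrt:
  assumes \<tau>_pos: "0 < \<tau>"
  shows "gibbs_mean g \<tau> (\<lambda>y. norm (y - x)) x \<le> sqrt (gibbs_mean g \<tau> (\<lambda>y. (norm (y - x))\<^sup>2) x)"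
  by (intro real_le_rsqrt prob_space.expectation_square_le prob_space_gibbs integrable_gibbs
      exp_growth_intros \<tau>_pos)

lemma gibbs_mean_dist_square_le:
  assumes \<tau>_pos: "0 < \<tau>"
  shows "gibbs_mean g \<tau> (\<lambda>y. (norm (y - x))\<^sup>2) x \<le> \<tau> * (width \<tau> x)\<^sup>2"
proof -
  define c where "c = norm (G x) + \<beta>"
  have c_nonneg: "0 \<le> c" using \<beta>_nonneg by (simp add: c_def)
  define s where "s = sqrt (gibbs_mean g \<tau> (\<lambda>y. (norm (y - x))\<^sup>2) x)"
  have s_square: "s\<^sup>2 = gibbs_mean g \<tau> (\<lambda>y. (norm (y - x))\<^sup>2) x" by (simp add: s_def)
  have "gibbs_mean g \<tau> (\<lambda>y. - (G y \<bullet> (y - x))) x \<le> gibbs_mean g \<tau> (\<lambda>y. c * norm (y - x)) x"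
  proof (rule integral_mono)
    show "integrable (gibbs g \<tau> x) (\<lambda>y. - (G y \<bullet> (y - x)))"
      "integrable (gibbs g \<tau> x) (\<lambda>y. c * norm (y - x))"
      by (intro integrable_gibbs exp_growth_intros exp_growth_G \<tau>_pos)+
    show "- (G y \<bullet> (y - x)) \<le> c * norm (y - x)" for y
      using semimonotone_lower_bound[OF semimonotone, of x y] by (simp add: c_def)
  qed
  also have "\<dots> \<le> c * s"
    using mult_left_mono[OF gibbs_mean_dist_le_sqrt[OF \<tau>_pos, of x] c_nonneg] by (simp add: s_def)
  finally have "\<tau> * (real DIM('a) - gibbs_mean g \<tau> (\<lambda>y. G y \<bullet> (y - x)) x)
      \<le> \<tau> * (real DIM('a) + c * s)"
    using \<tau>_pos by (intro mult_left_mono) auto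
  then have "s\<^sup>2 \<le> (sqrt (\<tau> * real DIM('a)))\<^sup>2 + (\<tau> * c) * s"
    unfolding s_square gibbs_mean_virial[OF \<tau>_pos gradient exp_growth_G] using \<tau>_pos
    by (simp add: algebra_simps)
  then have "s \<le> sqrt (\<tau> * real DIM('a)) + \<tau> * c"
    by (rule le_add_of_square_le) (use \<tau>_pos c_nonneg in auto)
  also have "\<dots> = sqrt \<tau> * width \<tau> x"
  proof -
    have "\<tau> * c = sqrt \<tau> * (sqrt \<tau> * c)" using \<tau>_pos by (simp flip: mult.assoc)
    then show ?thesis by (simp add: width_def c_def real_sqrt_mult distrib_left)
  qed
  finally have "s\<^sup>2 \<le> (sqrt \<tau> * width \<tau> x)\<^sup>2" by (intro power_mono) (auto simp: s_def)
  then show ?thesis unfolding s_square using \<tau>_pos by (simp add: power_mult_distrib)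
qed

lemma gibbs_mean_dist_le:
  assumes \<tau>_pos: "0 < \<tau>"
  shows "gibbs_mean g \<tau> (\<lambda>y. norm (y - x)) x \<le> sqrt \<tau> * width \<tau> x"
proof -
  have "sqrt (gibbs_mean g \<tau> (\<lambda>y. (norm (y - x))\<^sup>2) x) \<le> sqrt (\<tau> * (width \<tau> x)\<^sup>2)"
    by (intro real_sqrt_le_mono gibbs_mean_dist_square_le \<tau>_pos)
  also have "\<dots> = sqrt \<tau> * width \<tau> x" using width_nonneg[of \<tau> x] \<tau>_pos by (simp add: real_sqrt_mult)
  finally show ?thesis using gibbs_mean_dist_le_sqrt[OF \<tau>_pos, of x] by linarith
qed

lemma norm_gibbs_mean_G_diff_le:
  assumes \<tau>_pos: "0 < \<tau>"
  shows "norm (gibbs_mean g \<tau> G x - G x) \<le> K * (sqrt \<tau> * width \<tau> x)"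
proof -
  interpret prob_space "gibbs g \<tau> x" by (rule prob_space_gibbs[OF \<tau>_pos])
  have "gibbs_mean g \<tau> G x - G x = gibbs_mean g \<tau> (\<lambda>y. G y - G x) x"
    using integrable_gibbs[OF \<tau>_pos exp_growth_G, of x] by (simp add: prob_space)
  also have "norm \<dots> \<le> gibbs_mean g \<tau> (\<lambda>y. K * norm (y - x)) x"
    by (rule norm_integral_le_integral)
      (intro integrable_gibbs exp_growth_intros exp_growth_G \<tau>_pos norm_G_diff_le)+
  also have "\<dots> \<le> K * (sqrt \<tau> * width \<tau> x)"
    using mult_left_mono[OF gibbs_mean_dist_le[OF \<tau>_pos, of x] K_nonneg] by simp
  finally show ?thesis .
qed

lemma norm_gibbs_mean_deriv_le:
  assumes \<tau>_pos: "0 < \<tau>"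
  shows "norm (gibbs_mean_deriv g \<tau> G x h) \<le> 2 * K * (width \<tau> x)\<^sup>2 * norm h"
proof -
  interpret prob_space "gibbs g \<tau> x" by (rule prob_space_gibbs[OF \<tau>_pos])
  have "exp_growth (\<lambda>y. y \<bullet> h)" by (intro exp_growth_intros)
  from covariance_gibbs_shift[OF \<tau>_pos this exp_growth_G, of x "x \<bullet> h" "G x"]
  have "norm (covariance (gibbs g \<tau> x) (\<lambda>y. y \<bullet> h) G)
      = norm (covariance (gibbs g \<tau> x) (\<lambda>y. (y - x) \<bullet> h) (\<lambda>y. G y - G x))"
    by (simp add: inner_diff_left)
  also have "\<dots> \<le> 2 * norm h * K * gibbs_mean g \<tau> (\<lambda>y. (norm (y - x))\<^sup>2) x"
  proof (rule norm_covariance_le)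
    show "\<bar>(y - x) \<bullet> h\<bar> \<le> norm h * norm (y - x)" for y
      using Cauchy_Schwarz_ineq2[of "y - x" h] by (simp add: mult.commute)
  qed (intro integrable_gibbs exp_growth_intros exp_growth_G \<tau>_pos norm_G_diff_le K_nonneg
    norm_ge_zero)+
  also have "\<dots> \<le> 2 * norm h * K * (\<tau> * (width \<tau> x)\<^sup>2)"
    using K_nonneg by (intro mult_left_mono gibbs_mean_dist_square_le \<tau>_pos) auto
  finally show ?thesis using \<tau>_pos by (simp add: gibbs_mean_deriv_def divide_le_eq field_simps)
qed

definition p :: "real \<Rightarrow> 'a \<Rightarrow> 'a" where
  "p \<tau> x = (if \<tau> = 0 then G x else gibbs_mean g \<tau> G x)"

lemma p_has_time_derivative:
  assumes \<tau>_pos: "0 < \<tau>"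
  shows "((\<lambda>\<tau>. p \<tau> x) has_vector_derivative gibbs_mean_time_deriv g \<tau> G x) (at \<tau>)"
  by (rule has_vector_derivative_transform_within_open
      [OF gibbs_mean_has_time_derivative[OF \<tau>_pos exp_growth_G], where S = "{0<..}"])
     (use \<tau>_pos in \<open>auto simp: p_def\<close>)

lemma continuous_on_p_time: "continuous_on {0..T} (\<lambda>\<tau>. p \<tau> x)"
  unfolding continuous_on_def
proof
  fix \<tau> assume time_range: "\<tau> \<in> {0..T}"
  show "((\<lambda>\<tau>. p \<tau> x) \<longlongrightarrow> p \<tau> x) (at \<tau> within {0..T})"
  proof (cases "\<tau> = 0")
    case False
    then have "isCont (\<lambda>\<tau>. p \<tau> x) \<tau>"
      using time_range has_vector_derivative_continuous[OF p_has_time_derivative] by simp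
    then show ?thesis by (simp add: isCont_def tendsto_within_subset[OF _ subset_UNIV])
  next
    case True
    have "((\<lambda>t. p t x - G x) \<longlongrightarrow> 0) (at 0 within {0..T})"
    proof (rule Lim_null_comparison)
      show "\<forall>\<^sub>F t in at 0 within {0..T}. norm (p t x - G x) \<le> K * (sqrt t * width t x)"
        unfolding eventually_at_filter using norm_gibbs_mean_G_diff_le
        by (auto intro!: always_eventually simp: p_def)
      have "((\<lambda>t. K * (sqrt t * width t x)) \<longlongrightarrow> K * (sqrt 0 * width 0 x)) (at 0 within {0..T})"
        unfolding width_def by (intro tendsto_intros)
      then show "((\<lambda>t. K * (sqrt t * width t x)) \<longlongrightarrow> 0) (at 0 within {0..T})" by simp
    qed
    then show ?thesis using True LIM_zero_iff by (auto simp: p_def)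
  qed
qed

lemma p_lipschitz_on_ball: "\<exists>K'. \<forall>\<tau>\<in>{0..T}. K'-lipschitz_on (cball 0 R) (p \<tau>)"
proof (intro exI ballI)
  define W where "W = sqrt (real DIM('a)) + sqrt T * (norm (G 0) + K * R + \<beta>)"
  fix \<tau> assume time_range: "\<tau> \<in> {0..T}"
  show "(K + 2 * K * W\<^sup>2)-lipschitz_on (cball 0 R) (p \<tau>)"
  proof (cases "\<tau> = 0")
    case True
    then have "p \<tau> = G" by (simp add: p_def fun_eq_iff)
    then show ?thesis
      using lipschitz_on_mono[OF G_lipschitz, of "cball 0 R" "K + 2 * K * W\<^sup>2"] K_nonneg by simp
  next
    case False
    then have \<tau>_pos: "0 < \<tau>" using time_range by simp
    have "(2 * K * W\<^sup>2)-lipschitz_on (cball 0 R) (gibbs_mean g \<tau> G)"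
    proof (rule bounded_derivative_imp_lipschitz)
      show "(gibbs_mean g \<tau> G has_derivative gibbs_mean_deriv g \<tau> G x) (at x within cball 0 R)"
        for x
        by (rule has_derivative_at_withinI[OF gibbs_mean_has_derivative[OF \<tau>_pos exp_growth_G]])
      show "onorm (gibbs_mean_deriv g \<tau> G x) \<le> 2 * K * W\<^sup>2" if "x \<in> cball 0 R" for x
      proof (rule onorm_bound)
        have "width \<tau> x \<le> W" unfolding W_def using time_range that by (intro width_le) auto
        then have "2 * K * (width \<tau> x)\<^sup>2 \<le> 2 * K * W\<^sup>2"
          using K_nonneg width_nonneg[of \<tau> x] time_range by (intro mult_left_mono power_mono) auto
        then show "norm (gibbs_mean_deriv g \<tau> G x h) \<le> 2 * K * W\<^sup>2 * norm h" for h
          using norm_gibbs_mean_deriv_le[OF \<tau>_pos, of x h] mult_right_mono[OF _ norm_ge_zero[of h]]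
          by (meson order_trans)
      qed (use K_nonneg in simp)
    qed (use K_nonneg in auto)
    moreover have "p \<tau> = gibbs_mean g \<tau> G" using False by (simp add: p_def fun_eq_iff)
    ultimately show ?thesis using K_nonneg by (auto intro: lipschitz_on_le)
  qed
qed

lemma norm_p_le:
  assumes time_range: "\<tau> \<in> {0..T}"
  shows "norm (p \<tau> x)
      \<le> ((1 + K * T) * (norm (G 0) + K + \<beta>) + K * (sqrt T * sqrt (real DIM('a)))) * (1 + norm x)"
proof -
  define c where "c = norm (G x) + \<beta>"
  define b where "b = K * (sqrt T * sqrt (real DIM('a)))"
  have T_nonneg: "0 \<le> T" using time_range by simp
  have nonneg: "0 \<le> c" "0 \<le> b" using K_nonneg \<beta>_nonneg T_nonneg by (auto simp: c_def b_def)
  have "norm (p \<tau> x - G x) \<le> K * (sqrt \<tau> * width \<tau> x)"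
    using time_range norm_gibbs_mean_G_diff_le[of \<tau> x] by (cases "\<tau> = 0") (auto simp: p_def)
  also have "sqrt \<tau> * width \<tau> x = sqrt \<tau> * sqrt (real DIM('a)) + \<tau> * c"
    using time_range by (simp add: width_def c_def distrib_left flip: mult.assoc)
  also have "K * (sqrt \<tau> * sqrt (real DIM('a)) + \<tau> * c)
      \<le> K * (sqrt T * sqrt (real DIM('a)) + T * c)"
    using time_range K_nonneg nonneg(1) by (intro mult_left_mono add_mono mult_right_mono) auto
  finally have "norm (p \<tau> x) \<le> norm (G x) + K * (sqrt T * sqrt (real DIM('a)) + T * c)"
    using norm_triangle_sub[of "p \<tau> x" "G x"] by linarith
  also have "\<dots> \<le> (1 + K * T) * c + b * 1"
    using \<beta>_nonneg by (simp add: b_def c_def algebra_simps)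
  also have "\<dots> \<le> (1 + K * T) * ((norm (G 0) + K + \<beta>) * (1 + norm x)) + b * (1 + norm x)"
  proof (intro add_mono mult_left_mono)
    have "(norm (G 0) + K + \<beta>) * (1 + norm x)
        = norm (G 0) + K * norm x + \<beta> + K + (norm (G 0) + \<beta>) * norm x"
      by (simp add: algebra_simps)
    moreover have "0 \<le> (norm (G 0) + \<beta>) * norm x" using \<beta>_nonneg by simp
    ultimately show "c \<le> (norm (G 0) + K + \<beta>) * (1 + norm x)"
      using norm_G_le[of x] K_nonneg unfolding c_def by linarith
  qed (use K_nonneg T_nonneg nonneg in auto)
  finally show ?thesis by (simp add: b_def algebra_simps)
qed

theorem semimonotone_gibbs_drift_lipschitz:
  assumes "0 < T"
  shows "semimonotone f (gibbs_drift g T)"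
proof -
  interpret viscous_burgers f f' f'' \<Lambda> \<beta> T
    "(1 + K * T) * (norm (G 0) + K + \<beta>) + K * (sqrt T * sqrt (real DIM('a)))"
    p "\<lambda>\<tau>. gibbs_mean_time_deriv g \<tau> G" "\<lambda>\<tau>. gibbs_mean_deriv g \<tau> G" "\<lambda>\<tau>. gibbs_mean_deriv2 g \<tau> G"
  proof
    show "semimonotone f (p 0)" using semimonotone by (simp add: p_def[abs_def])
    fix \<tau> :: real and x :: 'a assume \<tau>_pos: "0 < \<tau>"
    have p_eq: "p \<tau> = gibbs_mean g \<tau> G" using \<tau>_pos by (simp add: p_def fun_eq_iff)
    show "(p \<tau> has_derivative gibbs_mean_deriv g \<tau> G x) (at x)"
      unfolding p_eq by (rule gibbs_mean_has_derivative[OF \<tau>_pos exp_growth_G])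
    show "((\<lambda>x. gibbs_mean_deriv g \<tau> G x a) has_derivative gibbs_mean_deriv2 g \<tau> G x a) (at x)"
      for a
      by (rule gibbs_mean_deriv_has_derivative[OF \<tau>_pos exp_growth_G])
    show "((\<lambda>\<tau>. p \<tau> x) has_vector_derivative gibbs_mean_time_deriv g \<tau> G x) (at \<tau>)"
      by (rule p_has_time_derivative[OF \<tau>_pos])
    show "gibbs_mean_time_deriv g \<tau> G x = (1 / 2) *\<^sub>R (\<Sum>b\<in>S. gibbs_mean_deriv2 g \<tau> G x b b)
        - gibbs_mean_deriv g \<tau> G x (p \<tau> x)" if "orthonormal_basis S" for S
      using gibbs_mean_heat_equation[OF \<tau>_pos exp_growth_G that, of x]
      by (simp add: p_eq gibbs_mean_gradient[OF \<tau>_pos gradient exp_growth_G])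
  qed (fact assms continuous_on_p_time p_lipschitz_on_ball norm_p_le)+
  have "p T = gibbs_drift g T"
    using assms by (simp add: p_def fun_eq_iff gibbs_mean_gradient[OF assms gradient exp_growth_G])
  then show ?thesis using semimonotone_preserved by simp
qed

end

section \<open>Moreau envelopes\<close>

definition prox :: "real \<Rightarrow> ('a::euclidean_space \<Rightarrow> real) \<Rightarrow> 'a \<Rightarrow> 'a" where
  "prox l g x = arg_min (\<lambda>z. g z + (norm (z - x))\<^sup>2 / (2 * l)) (\<lambda>_. True)"

definition moreau_env :: "real \<Rightarrow> ('a::euclidean_space \<Rightarrow> real) \<Rightarrow> 'a \<Rightarrow> real" where
  "moreau_env l g x = g (prox l g x) + (norm (prox l g x - x))\<^sup>2 / (2 * l)"

locale moreau_regularization = semimonotone_potential f f' f'' \<Lambda> \<beta> g G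
  for f f' f'' :: "real \<Rightarrow> real" and \<Lambda> \<beta> and g :: "'a::euclidean_space \<Rightarrow> real" and G :: "'a \<Rightarrow> 'a" +
  fixes l :: real
  assumes l_pos: "0 < l" and l_less: "l * \<Lambda> < 1"
begin

abbreviation J :: "'a \<Rightarrow> 'a" where "J \<equiv> prox l g"

lemma objective_gderiv:
  "GDERIV (\<lambda>z. g z + (norm (z - x))\<^sup>2 / (2 * l)) z :> G z + (z - x) /\<^sub>R l"
proof -
  have "((\<lambda>z. g z + ((z - x) \<bullet> (z - x)) / (2 * l)) has_derivative
      (\<lambda>h. h \<bullet> G z + (2 * (h \<bullet> (z - x))) / (2 * l))) (at z)"
    using gradient[of z] l_pos unfolding gderiv_def
    by (auto intro!: derivative_eq_intros simp: inner_commute)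
  then show ?thesis
    unfolding gderiv_def power2_norm_eq_inner
    by (rule has_derivative_eq_rhs) (simp add: inner_add_right inverse_eq_divide)
qed

lemma objective_attains_inf:
  obtains q where "\<And>z. g q + (norm (q - x))\<^sup>2 / (2 * l) \<le> g z + (norm (z - x))\<^sup>2 / (2 * l)"
proof (rule continuous_attains_inf_coercive)
  define c where "c = norm (G x) + \<beta>"
  show "continuous_on UNIV (\<lambda>z. g z + (norm (z - x))\<^sup>2 / (2 * l))"
    by (rule gderiv_continuous[OF objective_gderiv])
  show "0 \<le> 2 * l * c" using l_pos \<beta>_nonneg by (simp add: c_def)
  fix z assume "2 * l * c < dist x z"
  then have far: "c \<le> norm (z - x) / (2 * l)"
    using l_pos by (simp add: dist_norm norm_minus_commute field_simps)
  have "c * norm (z - x) \<le> (norm (z - x))\<^sup>2 / (2 * l)"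
    using mult_right_mono[OF far norm_ge_zero[of "z - x"]] by (simp add: power2_eq_square)
  then show "g x + (norm (x - x))\<^sup>2 / (2 * l) \<le> g z + (norm (z - x))\<^sup>2 / (2 * l)"
    using potential_lower_bound[of x z] by (simp add: c_def)
qed (rule that, assumption)

lemma moreau_env_le_objective: "moreau_env l g x \<le> g z + (norm (z - x))\<^sup>2 / (2 * l)"
proof -
  obtain q where q_min: "\<And>z. g q + (norm (q - x))\<^sup>2 / (2 * l) \<le> g z + (norm (z - x))\<^sup>2 / (2 * l)"
    using objective_attains_inf by blast
  show ?thesis unfolding moreau_env_def prox_def
    by (rule arg_minI[of _ q]) (use q_min in \<open>auto simp: not_less\<close>)
qed

lemma moreau_env_le: "moreau_env l g x \<le> g x"
  using moreau_env_le_objective[of x x] by simp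

lemma G_prox: "G (J x) = (x - J x) /\<^sub>R l"
proof -
  have "G (J x) + (J x - x) /\<^sub>R l = 0"
    by (rule gderiv_minimum_eq_zero[OF objective_gderiv])
       (use moreau_env_le_objective in \<open>simp add: moreau_env_def\<close>)
  then show ?thesis by (simp add: eq_neg_iff_add_eq_0[symmetric] algebra_simps)
qed

lemma scaleR_G_prox_diff: "l *\<^sub>R (G (J x) - G (J y)) = (x - y) - (J x - J y)"
  using l_pos by (simp add: G_prox flip: scaleR_diff_right)

lemma dist_prox_le: "norm (J x - x) \<le> 2 * l * (norm (G x) + \<beta>)"
proof (cases "J x = x")
  case False
  define c where "c = norm (G x) + \<beta>"
  have "(norm (J x - x))\<^sup>2 / (2 * l) \<le> c * norm (J x - x)"
    using potential_lower_bound[of x "J x"] moreau_env_le[of x] by (simp add: moreau_env_def c_def)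
  then have "norm (J x - x) * norm (J x - x) \<le> (2 * l * c) * norm (J x - x)"
    using l_pos by (simp add: power2_eq_square pos_divide_le_eq mult_ac)
  then show ?thesis unfolding c_def by (rule mult_right_le_imp_le) (use False in simp)
qed (use l_pos \<beta>_nonneg in simp)

lemma moreau_env_lower_bound:
  defines "c \<equiv> norm (G 0) + \<beta>"
  shows "g 0 - c\<^sup>2 * l / 2 - c * norm x \<le> moreau_env l g x"
proof -
  define \<rho> where "\<rho> = norm (J x - x)"
  have "0 \<le> (\<rho> - c * l)\<^sup>2 / (2 * l)" using l_pos by simp
  also have "\<dots> = \<rho>\<^sup>2 / (2 * l) - c * \<rho> + c\<^sup>2 * l / 2"
    unfolding power2_diff using l_pos by (simp add: power2_eq_square field_simps)
  finally have "c * \<rho> - c\<^sup>2 * l / 2 \<le> \<rho>\<^sup>2 / (2 * l)" by simp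
  moreover have "c * norm (J x) \<le> c * norm x + c * \<rho>"
    unfolding \<rho>_def distrib_left[symmetric] using \<beta>_nonneg norm_triangle_sub[of "J x" x]
    by (intro mult_left_mono) (auto simp: c_def)
  ultimately show ?thesis
    using potential_lower_bound[of 0 "J x"] by (simp add: moreau_env_def \<rho>_def c_def)
qed

lemma prox_expansion: "norm (J x - J y) - l * f (norm (J x - J y)) \<le> norm (x - y)"
proof (cases "J x = J y")
  case False
  define w where "w = J x - J y"
  have "x - y = w + l *\<^sub>R (G (J x) - G (J y))"
    by (simp add: w_def scaleR_G_prox_diff)
  then have "(x - y) \<bullet> w = norm w * norm w + l * ((G (J x) - G (J y)) \<bullet> w)"
    by (simp add: inner_add_left dot_square_norm power2_eq_square)
  moreover have "l * - (norm w * f (norm w)) \<le> l * ((G (J x) - G (J y)) \<bullet> w)"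
    unfolding w_def using l_pos by (intro mult_left_mono semimonotoneD[OF semimonotone]) auto
  ultimately have "(norm w - l * f (norm w)) * norm w \<le> norm (x - y) * norm w"
    using norm_cauchy_schwarz[of "x - y" w] by (simp add: algebra_simps)
  then show ?thesis using False by (simp add: w_def)
qed (simp add: f_zero)

lemma prox_lipschitz: "(1 - l * \<Lambda>) * norm (J x - J y) \<le> norm (x - y)"
proof -
  have "l * f (norm (J x - J y)) \<le> l * (\<Lambda> * norm (J x - J y))"
    using l_pos by (intro mult_left_mono f_le_linear) auto
  then show ?thesis using prox_expansion[of x y] by (simp add: algebra_simps)
qed

lemma G_prox_lipschitz: "((1 + 1 / (1 - l * \<Lambda>)) / l)-lipschitz_on UNIV (\<lambda>x. G (J x))"
proof (rule lipschitz_onI)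
  fix x y
  have "norm (J x - J y) \<le> norm (x - y) / (1 - l * \<Lambda>)"
    using prox_lipschitz[of x y] l_less by (simp add: field_simps)
  then have "norm ((x - y) - (J x - J y)) \<le> (1 + 1 / (1 - l * \<Lambda>)) * norm (x - y)"
    using norm_triangle_ineq4[of "x - y" "J x - J y"] by (simp add: algebra_simps)
  then have "l * norm (G (J x) - G (J y)) \<le> (1 + 1 / (1 - l * \<Lambda>)) * norm (x - y)"
    using l_pos by (simp flip: scaleR_G_prox_diff)
  then show "dist (G (J x)) (G (J y)) \<le> ((1 + 1 / (1 - l * \<Lambda>)) / l) * dist x y"
    using l_pos by (simp add: dist_norm pos_le_divide_eq mult.commute)
qed (use l_pos l_less in simp)

lemma moreau_env_upper_expansion:
  "moreau_env l g y - moreau_env l g x \<le> G (J x) \<bullet> (y - x) + (norm (y - x))\<^sup>2 / (2 * l)"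
proof -
  have "(norm (J x - y))\<^sup>2 - (norm (J x - x))\<^sup>2 = 2 * ((x - J x) \<bullet> (y - x)) + (norm (y - x))\<^sup>2"
    unfolding power2_norm_eq_inner by (simp add: inner_simps inner_commute algebra_simps)
  moreover have "G (J x) \<bullet> (y - x) = ((x - J x) \<bullet> (y - x)) / l"
    by (simp add: G_prox divide_inverse mult.commute)
  ultimately have "((norm (J x - y))\<^sup>2 - (norm (J x - x))\<^sup>2) / (2 * l)
      = G (J x) \<bullet> (y - x) + (norm (y - x))\<^sup>2 / (2 * l)"
    using l_pos by (simp add: field_simps)
  then show ?thesis
    using moreau_env_le_objective[of y "J x"]
    by (simp add: moreau_env_def[of l g x] diff_divide_distrib)
qed

lemma moreau_env_gderiv: "GDERIV (moreau_env l g) x :> G (J x)"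
proof (rule gderivI_quadratic_remainder)
  define lip where "lip = (1 + 1 / (1 - l * \<Lambda>)) / l"
  fix y
  have "\<bar>(G (J y) - G (J x)) \<bullet> (y - x)\<bar> \<le> norm (G (J y) - G (J x)) * norm (y - x)"
    by (rule Cauchy_Schwarz_ineq2)
  also have "\<dots> \<le> lip * norm (y - x) * norm (y - x)"
    using lipschitz_onD[OF G_prox_lipschitz, of y x] unfolding lip_def dist_norm
    by (intro mult_right_mono) auto
  finally have "\<bar>(G (J y) - G (J x)) \<bullet> (y - x)\<bar> \<le> lip * (norm (y - x))\<^sup>2"
    by (simp add: power2_eq_square mult.assoc)
  moreover have "G (J y) \<bullet> (x - y) = - (G (J x) \<bullet> (y - x)) - (G (J y) - G (J x)) \<bullet> (y - x)"
    by (simp add: inner_diff_left inner_diff_right)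
  moreover have "0 \<le> lip * (norm (y - x))\<^sup>2"
    using l_pos l_less by (simp add: lip_def)
  ultimately have "\<bar>moreau_env l g y - moreau_env l g x - G (J x) \<bullet> (y - x)\<bar>
      \<le> lip * (norm (y - x))\<^sup>2 + (norm (y - x))\<^sup>2 / (2 * l)"
    using moreau_env_upper_expansion[of y x] moreau_env_upper_expansion[of x y]
    by (simp add: norm_minus_commute[of x y])
  then show "\<bar>moreau_env l g y - moreau_env l g x - G (J x) \<bullet> (y - x)\<bar>
      \<le> (lip + 1 / (2 * l)) * (norm (y - x))\<^sup>2"
    by (simp add: distrib_right)
qed

lemma moreau_env_semimonotone: "semimonotone (\<lambda>r. f (r / (1 - l * \<Lambda>))) (\<lambda>x. G (J x))"
  unfolding semimonotone_def
proof (intro allI)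
  fix x y :: 'a
  define r where "r = norm (x - y)"
  define \<rho> where "\<rho> = norm (J x - J y)"
  have "\<rho> \<le> r / (1 - l * \<Lambda>)"
    using prox_lipschitz[of x y] l_less by (simp add: r_def \<rho>_def field_simps)
  then have "f \<rho> \<le> f (r / (1 - l * \<Lambda>))" by (intro f_mono) (auto simp: \<rho>_def)
  moreover have "\<rho> - l * f \<rho> \<le> r" unfolding \<rho>_def r_def by (rule prox_expansion)
  moreover have "l * f \<rho> \<le> l * f (r / (1 - l * \<Lambda>))"
    using calculation(1) l_pos by (intro mult_left_mono) auto
  ultimately have "r * (\<rho> - r) \<le> r * (l * f (r / (1 - l * \<Lambda>)))"
    by (intro mult_left_mono) (auto simp: r_def)
  moreover have "(x - y) \<bullet> (J x - J y) \<le> r * \<rho>"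
    unfolding r_def \<rho>_def by (rule norm_cauchy_schwarz)
  moreover have "l * ((G (J x) - G (J y)) \<bullet> (x - y)) = r * r - (x - y) \<bullet> (J x - J y)"
  proof -
    have "l * ((G (J x) - G (J y)) \<bullet> (x - y)) = ((x - y) - (J x - J y)) \<bullet> (x - y)"
      by (simp only: inner_scaleR_left[symmetric] scaleR_G_prox_diff)
    also have "\<dots> = r * r - (J x - J y) \<bullet> (x - y)"
      unfolding inner_diff_left[of "x - y"] by (simp only: r_def dot_square_norm power2_eq_square)
    finally show ?thesis by (simp only: inner_commute)
  qed
  ultimately have "l * - (r * f (r / (1 - l * \<Lambda>))) \<le> l * ((G (J x) - G (J y)) \<bullet> (x - y))"
    by (simp add: algebra_simps)
  then show "- (norm (x - y) * f (norm (x - y) / (1 - l * \<Lambda>))) \<le> (G (J x) - G (J y)) \<bullet> (x - y)"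
    unfolding r_def using l_pos by (simp only: mult_le_cancel_left_pos)
qed

lemma moreau_env_lipschitz_potential:
  defines "c \<equiv> 1 - l * \<Lambda>"
  shows "lipschitz_potential (\<lambda>r. f (r / c)) (\<lambda>r. f' (r / c) / c) (\<lambda>r. f'' (r / c) / c\<^sup>2) (\<Lambda> / c) \<beta>
    (moreau_env l g) (\<lambda>x. G (J x)) ((1 + 1 / c) / l)"
proof (intro lipschitz_potential.intro semimonotone_potential.intro
  semimonotone_potential_axioms.intro
    lipschitz_potential_axioms.intro)
  show "coupling_profile (\<lambda>r. f (r / c)) (\<lambda>r. f' (r / c) / c) (\<lambda>r. f'' (r / c) / c\<^sup>2) (\<Lambda> / c) \<beta>"
    using l_pos l_less \<Lambda>_nonneg by (intro coupling_profile_rescale) (auto simp: c_def)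
qed (simp_all only: c_def moreau_env_gderiv moreau_env_semimonotone G_prox_lipschitz)

end

context semimonotone_potential
begin

lemma moreau_env_tendsto:
  fixes l :: "nat \<Rightarrow> real"
  assumes moreau: "\<And>n. moreau_regularization f f' f'' \<Lambda> \<beta> g G (l n)" and l_limit: "l \<longlonglongrightarrow> 0"
  shows "(\<lambda>n. moreau_env (l n) g x) \<longlonglongrightarrow> g x"
proof -
  have "(\<lambda>n. prox (l n) g x - x) \<longlonglongrightarrow> 0"
  proof (rule Lim_null_comparison)
    show "\<forall>\<^sub>F n in sequentially. norm (prox (l n) g x - x) \<le> 2 * l n * (norm (G x) + \<beta>)"
      by (intro always_eventually allI moreau_regularization.dist_prox_le[OF moreau])
    have "(\<lambda>n. 2 * l n * (norm (G x) + \<beta>)) \<longlonglongrightarrow> 2 * 0 * (norm (G x) + \<beta>)"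
      by (intro tendsto_intros l_limit)
    then show "(\<lambda>n. 2 * l n * (norm (G x) + \<beta>)) \<longlonglongrightarrow> 0" by simp
  qed
  then have "(\<lambda>n. prox (l n) g x) \<longlonglongrightarrow> x" by (rule LIM_zero_cancel)
  moreover have "isCont g x"
    using gradient[of x] unfolding gderiv_def by (rule has_derivative_continuous)
  ultimately have g_limit: "(\<lambda>n. g (prox (l n) g x)) \<longlonglongrightarrow> g x"
    by (rule isCont_tendsto_compose[rotated])
  have lower: "g (prox (l n) g x) \<le> moreau_env (l n) g x" for n
    using moreau_regularization.l_pos[OF moreau, of n] by (simp add: moreau_env_def)
  have upper: "moreau_env (l n) g x \<le> g x" for n
    by (rule moreau_regularization.moreau_env_le[OF moreau])
  show ?thesis
    by (rule tendsto_sandwich[OF _ _ g_limit tendsto_const]) (use lower upper in auto)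
qed

lemma moreau_regularization_sequence:
  obtains l where "\<And>n. moreau_regularization f f' f'' \<Lambda> \<beta> g G (l n)" "\<And>n::nat. l n \<le> 1" "l \<longlonglongrightarrow> 0"
proof
  define l where "l n = inverse (real (Suc n)) / (\<Lambda> + 1)" for n
  have bounds: "0 < l n" "l n \<le> 1 / (\<Lambda> + 1)" for n
    using \<Lambda>_nonneg by (auto simp: l_def divide_right_mono inverse_le_1_iff)
  show "l n \<le> 1" for n
    using order_trans[OF bounds(2)] \<Lambda>_nonneg by simp
  show "moreau_regularization f f' f'' \<Lambda> \<beta> g G (l n)" for n
  proof unfold_locales
    have "l n * \<Lambda> \<le> 1 / (\<Lambda> + 1) * \<Lambda>" by (rule mult_right_mono[OF bounds(2) \<Lambda>_nonneg])
    also have "\<dots> < 1" using \<Lambda>_nonneg by (simp add: field_simps)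
    finally show "l n * \<Lambda> < 1" .
  qed (rule bounds(1))
  have "(\<lambda>n. inverse (real (Suc n)) / (\<Lambda> + 1)) \<longlonglongrightarrow> 0 / (\<Lambda> + 1)"
    using \<Lambda>_nonneg by (intro tendsto_intros LIMSEQ_inverse_real_of_nat) auto
  then show "l \<longlonglongrightarrow> 0" by (simp add: l_def[abs_def])
qed

lemma rescaled_profile_tendsto:
  assumes "l \<longlonglongrightarrow> 0" "\<And>n::nat. l n * \<Lambda> < 1" "0 \<le> r"
  shows "(\<lambda>n. f (r / (1 - l n * \<Lambda>))) \<longlonglongrightarrow> f r"
proof (rule continuous_on_tendsto_compose[OF f_continuous])
  have "(\<lambda>n. r / (1 - l n * \<Lambda>)) \<longlonglongrightarrow> r / (1 - 0 * \<Lambda>)"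
    by (intro tendsto_intros assms(1)) simp
  then show "(\<lambda>n. r / (1 - l n * \<Lambda>)) \<longlonglongrightarrow> r" by simp
  have "0 \<le> r / (1 - l n * \<Lambda>)" for n using assms(2)[of n] assms(3) by simp
  then show "\<forall>\<^sub>F n in sequentially. r / (1 - l n * \<Lambda>) \<in> {0..}" by simp
qed (use assms(3) in simp)

theorem semimonotone_gibbs_drift:
  assumes \<tau>_pos: "0 < \<tau>"
  shows "semimonotone f (gibbs_drift g \<tau>)"
proof -
  obtain l where moreau: "\<And>n. moreau_regularization f f' f'' \<Lambda> \<beta> g G (l n)"
    and l_le: "\<And>n::nat. l n \<le> 1" and l_limit: "l \<longlonglongrightarrow> 0"
    using moreau_regularization_sequence by blast
  note lipschitz = moreau_regularization.moreau_env_lipschitz_potential[OF moreau]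
  define c where "c = norm (G 0) + \<beta>"
  have lower: "(g 0 - c\<^sup>2 * 1 / 2) - c * norm y \<le> moreau_env (l n) g y" for n y
  proof -
    have "c\<^sup>2 * l n / 2 \<le> c\<^sup>2 * 1 / 2" by (intro divide_right_mono mult_left_mono l_le) auto
    then show ?thesis
      using moreau_regularization.moreau_env_lower_bound[OF moreau, of n y] unfolding c_def
      by linarith
  qed
  have potential: "exp_potential (moreau_env (l n) g)" for n
    by (rule semimonotone_potential.exp_potential_g[OF lipschitz_potential.axioms(1)[OF lipschitz]])
  show ?thesis
  proof (rule semimonotone_LIMSEQ)
    show "semimonotone (\<lambda>r. f (r / (1 - l n * \<Lambda>))) (gibbs_drift (moreau_env (l n) g) \<tau>)" for n
      by (rule lipschitz_potential.semimonotone_gibbs_drift_lipschitz[OF lipschitz \<tau>_pos])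
    show "(\<lambda>n. f (r / (1 - l n * \<Lambda>))) \<longlonglongrightarrow> f r" if "0 \<le> r" for r
      by (rule rescaled_profile_tendsto[OF l_limit moreau_regularization.l_less[OF moreau] that])
    show "(\<lambda>n. gibbs_drift (moreau_env (l n) g) \<tau> x) \<longlonglongrightarrow> gibbs_drift g \<tau> x" for x
      unfolding gibbs_drift_def
      by (intro tendsto_intros
        gibbs_mean_tendsto[OF \<tau>_pos exp_potential_g potential exp_growth_ident
            moreau_env_tendsto[OF moreau l_limit] lower])
  qed
qed

end

section \<open>Propagation along the HJB flow\<close>

lemma gderiv_iff_has_derivative_inner:
  "GDERIV F x :> v \<longleftrightarrow> (F has_derivative (\<lambda>h. v \<bullet> h)) (at x)"
  by (simp add: gderiv_def inner_commute)

lemma grad_eq_gderiv: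
  assumes "GDERIV U x :> v"
  shows "grad U x = v"
proof -
  have v_deriv: "(U has_derivative (\<lambda>h. v \<bullet> h)) (at x)"
    using assms by (simp only: gderiv_iff_has_derivative_inner)
  show ?thesis
    unfolding grad_def
  proof (rule the_equality)
    fix w assume "(U has_derivative (\<lambda>h. w \<bullet> h)) (at x)"
    from has_derivative_unique[OF this v_deriv] show "w = v" by (metis vector_eq_rdot)
  qed (rule v_deriv)
qed

lemma kappa_ge_iff_semimonotone:
  assumes gradient: "\<And>x. GDERIV g x :> G x"
  shows "(\<forall>r>0. ereal (- f r / r) \<le> kappa g r) \<longleftrightarrow> semimonotone f G"
proof -
  have "- f (norm (x - y)) / norm (x - y) \<le> ((G x - G y) \<bullet> (x - y)) / (norm (x - y))\<^sup>2
      \<longleftrightarrow> - (norm (x - y) * f (norm (x - y))) \<le> (G x - G y) \<bullet> (x - y)" if "x \<noteq> y" for x y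
    using that by (simp add: field_simps power2_eq_square)
  moreover have "(\<forall>r>0. ereal (- f r / r) \<le> kappa g r) \<longleftrightarrow> (\<forall>x y. x \<noteq> y \<longrightarrow>
      - f (norm (x - y)) / norm (x - y) \<le> ((G x - G y) \<bullet> (x - y)) / (norm (x - y))\<^sup>2)"
    unfolding kappa_def le_INF_iff by (auto simp: grad_eq_gderiv[OF gradient])
  moreover have "- (norm (x - x) * f (norm (x - x))) \<le> (G x - G x) \<bullet> (x - x)" for x by simp
  ultimately show ?thesis unfolding semimonotone_def by metis
qed

lemma FL_iff:
  "g \<in> FL L \<longleftrightarrow> (\<exists>G. (\<forall>x. GDERIV g x :> G x) \<and> continuous_on UNIV G \<and> semimonotone (fL L) G)"
  unfolding FL_def C1_def mem_Collect_eq gderiv_iff_has_derivative_inner[symmetric]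
  using kappa_ge_iff_semimonotone[of g _ "fL L"] by blast

lemma UTg_eq_ln_partition_function:
  fixes g :: "'a::euclidean_space \<Rightarrow> real"
  assumes "t < T"
  shows "UTg T g t x
      = - ln ((2 * pi * (T - t)) powr (- real DIM('a) / 2) * partition_function g (T - t) x)"
proof -
  have "exp (- (norm (y - x))\<^sup>2 / (2 * (T - t)) - g y) = gauss_kernel (T - t) x y *\<^sub>R exp (- g y)"
    for y
    by (simp add: gauss_kernel_def flip: exp_add)
  then show ?thesis using assms by (simp add: UTg_def partition_function_def gauss_integral_def)
qed

context exp_potential
begin

lemma UTg_gderiv:
  assumes "t < T"
  shows "GDERIV (UTg T g t) x :> gibbs_drift g (T - t) x"
proof -
  have \<tau>_pos: "0 < T - t" using assms by simp
  define c where "c = (2 * pi * (T - t)) powr (- real DIM('a) / 2)"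
  have c_pos: "0 < c" using \<tau>_pos by (simp add: c_def)
  have U_eq: "UTg T g t = (\<lambda>x. - ln (c * partition_function g (T - t) x))"
    unfolding c_def by (rule ext) (rule UTg_eq_ln_partition_function[OF assms])
  show ?thesis
    using partition_function_gderiv[OF \<tau>_pos, of x] partition_function_pos[OF \<tau>_pos, of x] c_pos
    unfolding U_eq gderiv_def by (auto intro!: derivative_eq_intros simp: fun_eq_iff field_simps)
qed

lemma continuous_on_gibbs_drift:
  assumes "0 < \<tau>"
  shows "continuous_on S (gibbs_drift g \<tau>)"
  unfolding gibbs_drift_def[abs_def]
  by (intro continuous_intros continuous_at_imp_continuous_on ballI
      has_derivative_continuous[OF gibbs_mean_has_derivative[OF assms exp_growth_ident]])

end

theorem theorem3:
  fixes L T t :: real and g :: "'a::euclidean_space \<Rightarrow> real"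
  assumes "L > 0" and "0 \<le> t" and "t \<le> T" and "g \<in> FL L"
  shows "UTg T g t \<in> FL L"
proof (cases "t = T")
  case True
  then show ?thesis using assms(4) by (simp add: UTg_def[abs_def])
next
  case False
  then have t_less: "t < T" using assms(3) by simp
  obtain G where G_props: "\<And>x. GDERIV g x :> G x" "semimonotone (fL L) G"
    using assms(4) unfolding FL_iff by blast
  interpret coupling_profile "fL L" "\<lambda>r. L * (1 - (tanh (r * sqrt L / 2))\<^sup>2)"
    "\<lambda>r. - (fL L r * (L * (1 - (tanh (r * sqrt L / 2))\<^sup>2))) / 2" L "2 * sqrt L"
    by (rule coupling_profile_fL[OF assms(1)])
  interpret semimonotone_potential "fL L" "\<lambda>r. L * (1 - (tanh (r * sqrt L / 2))\<^sup>2)"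
    "\<lambda>r. - (fL L r * (L * (1 - (tanh (r * sqrt L / 2))\<^sup>2))) / 2" L "2 * sqrt L" g G
    by unfold_locales (rule G_props)+
  show ?thesis
    unfolding FL_iff using t_less
    by (intro exI[of _ "gibbs_drift g (T - t)"] conjI allI UTg_gderiv continuous_on_gibbs_drift
        semimonotone_gibbs_drift) auto
qed

end
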